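(* Let $n\geq 1$ be an integer. Up to isomorphism, the tournaments of the class $\mathcal{T}_{\delta}^{4n+3}$ (the $(4n+3)$-vertex tournaments $T$ with $\delta(T)=\delta(4n+3)$) are exactly the tournaments with one of the following forms, where $T_k$ denotes an arbitrary $k$-vertex tournament: (F11) $T_{2n+2}(\underline{1},\underline{2},\ldots,\underline{2})$; (F12) $T_{2n+1}(C_{3},\underline{2},\ldots,\underline{2})$; (F13) $C_{3}(\underline{1},\underline{1}, T_{2n}(C_{3},\underline{2},\ldots,\underline{2}))$; (F14) $C_{3}(\underline{1},\underline{1}, T_{2n+1}(\underline{1},\underline{2},\ldots,\underline{2}))$; (F15) $\underline{2}(\underline{1}, T_{2n+2}(\underline{1},\underline{1},\underline{2},\ldots,\underline{2}))$ or its dual; (F16) $\underline{2}(\underline{1},T_{2n+1}(C_{3},\underline{1},\underline{2},\ldots,\underline{2}))$ or its dual; (F17) $\underline{2}(\underline{1},T_{2n}(C_{3},C_{3},\underline{2},\ldots,\underline{2}))$ or its dual; (F18) $\underline{3}(\underline{1},T_{2n-1}(S_5,\underline{2},\ldots,\underline{2}),\underline{1})$, where $S_5=U_{5}$, $V_{5}$ or $W_{5}$; (F19) $\underline{3}(\underline{1},T_{2n+2}(\underline{1},\underline{1},\underline{1},\underline{2},\ldots,\underline{2}),\underline{1})$; (F20) $\underline{3}(\underline{1}, T_{2n}(C_{3},C_{3},\underline{1},\underline{2},\ldots,\underline{2}),\underline{1})$, when $n\geq 2$; (F21) $\underline{3}(\underline{1},T_{2n+1}(\underline{1},\underline{1},C_{3},\underline{2},\ldots,\underline{2}),\underline{1})$;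 (F22) $\underline{3}(\underline{1},T_{2n-1}(C_{3},C_{3},C_{3},\underline{2},\ldots,\underline{2}),\underline{1})$, when $n\geq 2$.
   Context: A tournament $T$ consists of a finite vertex set $V(T)$ and a set $A(T)$ of ordered pairs of distinct vertices (arcs) such that for all $x\neq y\in V(T)$, $(x,y)\in A(T)$ if and only if $(y,x)\notin A(T)$; $v(T)=|V(T)|$. The dual $T^{\star}$ of $T$ is obtained by reversing all arcs. A module of $T$ is a subset $M\subseteq V(T)$ such that for all $x,y\in M$ and $v\in V(T)\setminus M$, $(v,x)\in A(T)$ if and only if $(v,y)\in A(T)$. The trivial modules are $\emptyset$, the singletons and $V(T)$. $T$ is indecomposable if all its modules are trivial, and decomposable otherwise. For $B\subseteq A(T)$, ${\rm Inv}(T,B)$ is the tournament obtained from $T$ by reversing all arcs of $B$. For a tournament $T$ with $v(T)\ge 5$, the decomposability index $\delta(T)$ is the smallest integer $m$ for which there is $B\subseteq A(T)$ with $|B|=m$ and ${\rm Inv}(T,B)$ indecomposable (it is well-defined since for every $n\geq 5$ there exist indecomposable $n$-vertex tournaments). For an integer $m\ge 5$, $\delta(m)$ is the maximum of $\delta(T)$ over the $m$-vertex tournaments $T$, and $\mathcal{T}_{\delta}^{m}$ is the class of $m$-vertex tournaments $T$ with $\delta(T)=\delta(m)$ (tournaments with $\delta$-maximal decomposability). For $k\geq 1$, $\underline{k}$ is the transitive tournament on $\{0,\ldots,k-1\}$ whose arcs are the pairs $(i,j)$ with $0\le i<j\le k-1$. $C_3=(\{0,1,2\},\{(0,1),(1,2),(2,0)\})$.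 The tournaments $U_5,V_5,W_5$ have vertex set $\{0,\ldots,4\}$ and arc sets $A(U_5)=A(\underline{3})\cup\{(3,0),(1,3),(2,3),(4,0),(4,1),(2,4),(3,4)\}$, $A(V_5)=(A(U_5)\setminus\{(3,4)\})\cup\{(4,3)\}$, $A(W_5)=A(\underline{4})\cup\{(4,0),(4,2),(1,4),(3,4)\}$. Given a tournament $T$ with $V(T)=\{0,\ldots,k-1\}$ and tournaments $H_0,\ldots,H_{k-1}$ (replaced by isomorphic copies on pairwise disjoint vertex sets if necessary), the lexicographic sum $T(H_0,\ldots,H_{k-1})$ is the tournament on $\bigcup_i V(H_i)$ in which, for $x\in V(H_i)$ and $y\in V(H_j)$, $(x,y)$ is an arc if either $i=j$ and $(x,y)\in A(H_i)$, or $i\ne j$ and $(i,j)\in A(T)$. Arbitrary tournaments $T_k$ are taken on the vertex set $\{0,\ldots,k-1\}$; in $T_k(X_1,\ldots,X_r,\underline{2},\ldots,\underline{2})$ there are $k$ entries in total, all those after the first $r$ displayed ones being $\underline{2}$ (possibly none). *)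

theory Defs
  imports
    Graph_Theory.Digraph_Isomorphism
    Graph_Theory.Pair_Digraph
    "HOL-Library.Nat_Bijection"
begin

locale tournament = pair_digraph T for T :: "'a pair_pre_digraph" +
  assumes arc_iff_not_reverse:
    "\<lbrakk>x \<in> pverts T; y \<in> pverts T; x \<noteq> y\<rbrakk> \<Longrightarrow> (x, y) \<in> parcs T \<longleftrightarrow> (y, x) \<notin> parcs T"

abbreviation tournament_iso :: "'a pair_pre_digraph \<Rightarrow> 'b pair_pre_digraph \<Rightarrow> bool" where
  "tournament_iso T S \<equiv> digraph_iso (with_proj T) (with_proj S)"

definition dual :: "'a pair_pre_digraph \<Rightarrow> 'a pair_pre_digraph" where
  "dual T = \<lparr> pverts = pverts T, parcs = (parcs T)\<inverse> \<rparr>"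

definition is_module :: "'a pair_pre_digraph \<Rightarrow> 'a set \<Rightarrow> bool" where
  "is_module T M \<longleftrightarrow> M \<subseteq> pverts T \<and>
     (\<forall>x\<in>M. \<forall>y\<in>M. \<forall>v\<in>pverts T - M. (v, x) \<in> parcs T \<longleftrightarrow> (v, y) \<in> parcs T)"

definition trivial_module :: "'a pair_pre_digraph \<Rightarrow> 'a set \<Rightarrow> bool" where
  "trivial_module T M \<longleftrightarrow> M = {} \<or> (\<exists>x\<in>pverts T. M = {x}) \<or> M = pverts T"

definition indecomposable :: "'a pair_pre_digraph \<Rightarrow> bool" where
  "indecomposable T \<longleftrightarrow> (\<forall>M. is_module T M \<longrightarrow> trivial_module T M)"

definition Inv :: "'a pair_pre_digraph \<Rightarrow> 'a rel \<Rightarrow> 'a pair_pre_digraph" where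
  "Inv T B = \<lparr> pverts = pverts T, parcs = (parcs T - B) \<union> B\<inverse> \<rparr>"

text \<open>Only meaningful for tournaments with at least 5 vertices, where the set of candidates is
  nonempty.\<close>
definition decomposability_index :: "'a pair_pre_digraph \<Rightarrow> nat" where
  "decomposability_index T = (LEAST m. \<exists>B \<subseteq> parcs T. card B = m \<and> indecomposable (Inv T B))"

text \<open>The maximum over all \<open>m\<close>-vertex tournaments, only meaningful for \<open>m \<ge> 5\<close>.  Since the
  decomposability index is invariant under isomorphism, it suffices to range over tournaments whose
  vertices are natural numbers.\<close>
definition max_decomposability_index :: "nat \<Rightarrow> nat" where
  "max_decomposability_index m =
     Max {decomposability_index T | T :: nat pair_pre_digraph.
            tournament T \<and> card (pverts T) = m}"

definition delta_maximal :: "nat \<Rightarrow> 'a pair_pre_digraph set" where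
  "delta_maximal m =
     {T. tournament T \<and> card (pverts T) = m \<and>
         decomposability_index T = max_decomposability_index m}"

definition transitive_tournament :: "nat \<Rightarrow> nat pair_pre_digraph" where
  "transitive_tournament k = \<lparr> pverts = {0..<k}, parcs = {(i, j). i < j \<and> j < k} \<rparr>"

abbreviation "tt1 \<equiv> transitive_tournament 1"
abbreviation "tt2 \<equiv> transitive_tournament 2"
abbreviation "tt3 \<equiv> transitive_tournament 3"

definition C3 :: "nat pair_pre_digraph" where
  "C3 = \<lparr> pverts = {0, 1, 2}, parcs = {(0, 1), (1, 2), (2, 0)} \<rparr>"

definition U5 :: "nat pair_pre_digraph" where
  "U5 = \<lparr> pverts = {0..4},
          parcs = parcs (transitive_tournament 3) \<union>
                  {(3, 0), (1, 3), (2, 3), (4, 0), (4, 1), (2, 4), (3, 4)} \<rparr>"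

definition V5 :: "nat pair_pre_digraph" where
  "V5 = \<lparr> pverts = {0..4}, parcs = (parcs U5 - {(3, 4)}) \<union> {(4, 3)} \<rparr>"

definition W5 :: "nat pair_pre_digraph" where
  "W5 = \<lparr> pverts = {0..4},
          parcs = parcs (transitive_tournament 4) \<union> {(4, 0), (4, 2), (1, 4), (3, 4)} \<rparr>"

text \<open>The lexicographic sum \<open>T(H\<^sub>0, \<dots>, H\<^bsub>k-1\<^esub>)\<close>, for \<open>T\<close> on \<open>{0..<k}\<close> and a list of length \<open>k\<close>.
  The disjoint copy of the \<open>i\<close>-th component has the vertices \<open>prod_encode (i, x)\<close>; coding pairs as
  natural numbers keeps all components, including nested sums, at one type.\<close>
definition lex_sum :: "nat pair_pre_digraph \<Rightarrow> nat pair_pre_digraph list \<Rightarrow> nat pair_pre_digraph" where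
  "lex_sum T Hs =
     \<lparr> pverts = {prod_encode (i, x) | i x. i < length Hs \<and> x \<in> pverts (Hs ! i)},
       parcs = {(prod_encode (i, x), prod_encode (j, y)) | i x j y.
                  i < length Hs \<and> x \<in> pverts (Hs ! i) \<and>
                  j < length Hs \<and> y \<in> pverts (Hs ! j) \<and>
                  (i = j \<and> (x, y) \<in> parcs (Hs ! i) \<or> i \<noteq> j \<and> (i, j) \<in> parcs T)} \<rparr>"

text \<open>All tournaments \<open>T\<^sub>k(X\<^sub>1, \<dots>, X\<^sub>r, \<^bold>2, \<dots>, \<^bold>2)\<close> with \<open>k\<close> entries in total, where \<open>T\<^sub>k\<close> is any
  tournament on \<open>{0..<k}\<close>, \<open>\<^bold>2\<close> is the transitive tournament on two vertices and \<open>r \<le> k\<close>.\<close>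
definition lex_sums :: "nat \<Rightarrow> nat pair_pre_digraph list \<Rightarrow> nat pair_pre_digraph set" where
  "lex_sums k Xs =
     {lex_sum R (Xs @ replicate (k - length Xs) tt2) | R.
        tournament R \<and> pverts R = {0..<k} \<and> length Xs \<le> k}"

end

theory Submission imports Defs begin

text \<open>Adjoin to a tournament \<open>T\<close> a point \<open>None\<close> dominating all vertices, and call a set \<open>A\<close> of points
  a side if the sign matrix of the relation between \<open>A\<close> and its complement has rank one. Sides are
  closed under complements, under intersections of crossing pairs, and they do not change when all
  arcs at some points are switched. The sides having at least two points inside and outside are the
  nontrivial modules of \<open>T\<close> and their complements, so \<open>T\<close> is indecomposable iff there are none; with
  \<open>None\<close> removed they are the co-modules of \<open>T\<close>: the proper nonempty sets such that the set or its
  complement is a nontrivial module.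

  Every co-module contains an end of some reversed arc, so a disjoint family of \<open>d\<close> co-modules forces
  at least \<open>d / 2\<close> reversals. Conversely let \<open>X\<close> be an irredundant set of vertices meeting all
  co-modules, and for \<open>x\<close> in \<open>X\<close> let \<open>D x\<close> be a minimal side meeting \<open>X\<close> in \<open>x\<close> only. Reversing the arc
  between \<open>x\<close> and \<open>y\<close> creates no new side unless \<open>D x \<union> D y\<close> is a side, and a perfect matching of
  \<open>X\<close> separating as many sides as possible separates all of them; its arcs are reversed one by one.
  Since minimal sides overlap only in chains of twins, \<open>X\<close> need not be larger than a disjoint family.
  Hence the maximal tournaments on \<open>4 n + 3\<close> vertices are those with \<open>2 n + 1\<close> disjoint co-modules.
  Minimal co-modules used here have one (source or sink), two, three (3-cycle) or five vertices, and
  counting vertices leaves the listed forms.\<close>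

section \<open>Rank-one cuts of skew relations\<close>

text \<open>As sides, modules and complements of modules stand on the same footing, and any point
  outside a configuration can take over the role of \<open>None\<close>. Arcs at \<open>None\<close>
  are no arcs of \<open>T\<close>, hence the marked point \<open>o'\<close> that reversals must
  avoid. The obstacle is that the union of the two minimal sides joined by the reversed arc may
  itself be a side, for then the reversal can create sides. With two or more pairs an optimal
  matching rules this out. With a single pair the two minimal sides may even fill \<open>W\<close>,
  and an end of the arc has to be chosen afresh; this takes enough points, and eight of them (seven
  vertices and \<open>None\<close>) suffice. The final count depends on rounding. A disjoint family
  contains at most two singletons, so on \<open>4 * n + 3\<close> vertices it has at most
  \<open>2 * n + 2\<close> members, and both \<open>2 * n + 1\<close> and \<open>2 * n + 2\<close>
  members give index \<open>n + 1\<close>. If \<open>2 * n + 1\<close> disjoint minimal co-modules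
  are modules or singletons, then beyond the singletons and two vertices for each module only one,
  two or three vertices are left, according to whether none, one or two members are
  singletons.\<close>

definition skew :: "'b set \<Rightarrow> ('b \<Rightarrow> 'b \<Rightarrow> bool) \<Rightarrow> bool" where
  "skew W r \<longleftrightarrow> finite W \<and> (\<forall>x\<in>W. \<forall>y\<in>W. x \<noteq> y \<longrightarrow> r x y \<noteq> r y x)"

definition side :: "'b set \<Rightarrow> ('b \<Rightarrow> 'b \<Rightarrow> bool) \<Rightarrow> 'b set \<Rightarrow> bool" where
  "side W r A \<longleftrightarrow> A \<subseteq> W \<and> (\<forall>a\<in>A. \<forall>a'\<in>A. \<forall>b\<in>W-A. \<forall>b'\<in>W-A. (r a b = r a' b) = (r a b' = r a' b'))"

definition nside :: "'b set \<Rightarrow> ('b \<Rightarrow> 'b \<Rightarrow> bool) \<Rightarrow> 'b set \<Rightarrow> bool" where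
  "nside W r A \<longleftrightarrow> side W r A \<and> 2 \<le> card A \<and> 2 \<le> card (W - A)"

definition min_side :: "'b set \<Rightarrow> ('b \<Rightarrow> 'b \<Rightarrow> bool) \<Rightarrow> 'b set \<Rightarrow> bool" where
  "min_side W r A \<longleftrightarrow> nside W r A \<and> (\<forall>B. nside W r B \<longrightarrow> B \<subseteq> A \<longrightarrow> B = A)"

text \<open>\<open>E\<close> consists of unordered pairs, so both directions between two points
  change together and skewness survives.\<close>

definition flip :: "'b set set \<Rightarrow> ('b \<Rightarrow> 'b \<Rightarrow> bool) \<Rightarrow> 'b \<Rightarrow> 'b \<Rightarrow> bool" where
  "flip E r u v \<longleftrightarrow> r u v \<noteq> ({u, v} \<in> E)"

text \<open>Modules read along outgoing arcs; for skew relations \<open>homogD2\<close> supplies the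
  reading along incoming arcs.\<close>

definition homog :: "'b set \<Rightarrow> ('b \<Rightarrow> 'b \<Rightarrow> bool) \<Rightarrow> 'b set \<Rightarrow> bool" where
  "homog U g A \<longleftrightarrow> A \<subseteq> U \<and> (\<forall>a\<in>A. \<forall>a'\<in>A. \<forall>b\<in>U-A. g a b = g a' b)"

lemma sideD:
  assumes "side W r A" "a \<in> A" "a' \<in> A" "b \<in> W" "b \<notin> A" "b' \<in> W" "b' \<notin> A"
  shows "(r a b = r a' b) = (r a b' = r a' b')"
  using assms(1)[unfolded side_def, THEN conjunct2, THEN bspec, OF assms(2), THEN bspec, OF assms(3),
      THEN bspec, OF DiffI[OF assms(4,5)], THEN bspec, OF DiffI[OF assms(6,7)]] .

lemma side_subset: "side W r A \<Longrightarrow> A \<subseteq> W"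
  by (simp add: side_def)

lemma skewD: "skew W r \<Longrightarrow> x \<in> W \<Longrightarrow> y \<in> W \<Longrightarrow> x \<noteq> y \<Longrightarrow> r x y \<longleftrightarrow> \<not> r y x"
  unfolding skew_def by blast

lemma skew_flip: "skew W r \<Longrightarrow> skew W (flip E r)"
  unfolding skew_def flip_def by (metis insert_commute)

text \<open>Exchanging rows and columns transposes each two-by-two minor, and skewness negates all
  four of its entries, which leaves the condition intact.\<close>

lemma side_compl:
  assumes "skew W r" "side W r A" shows "side W r (W - A)"
  unfolding side_def
proof (intro conjI ballI)
  fix b b' a a' assume *: "b \<in> W - A" "b' \<in> W - A" "a \<in> W - (W - A)" "a' \<in> W - (W - A)"
  then have "(r a b = r a' b) = (r a b' = r a' b')" using sideD[OF assms(2)] by blast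
  moreover have "r b a \<noteq> r a b" "r b' a \<noteq> r a b'" "r b a' \<noteq> r a' b" "r b' a' \<noteq> r a' b'"
    using * skewD[OF assms(1)] by blast+
  ultimately show "(r b a = r b' a) = (r b a' = r b' a')" by blast
qed auto

text \<open>The column of \<open>w\<close> is a common reference: every point outside
  \<open>A \<inter> B\<close> misses \<open>A\<close> or \<open>B\<close>, so its column can be
  compared with that of \<open>w\<close> through one of the two sides.\<close>

lemma side_inter:
  assumes "side W r A" "side W r B" "w \<in> W" "w \<notin> A" "w \<notin> B" shows "side W r (A \<inter> B)"
  unfolding side_def
proof (intro conjI ballI)
  have *: "(r a b = r a' b) = (r a w = r a' w)" if "a \<in> A \<inter> B" "a' \<in> A \<inter> B" "b \<in> W - A \<inter> B" for a a' b
    using that sideD[OF assms(1), of a a' b w] sideD[OF assms(2), of a a' b w] assms(3-5) by blast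
  fix a a' b b' assume "a \<in> A \<inter> B" "a' \<in> A \<inter> B" "b \<in> W - A \<inter> B" "b' \<in> W - A \<inter> B"
  then show "(r a b = r a' b) = (r a b' = r a' b')" using * by metis
qed (use side_subset[OF assms(1)] in auto)

lemma side_Un:
  assumes "skew W r" "side W r A" "side W r B" "w \<in> A" "w \<in> B" shows "side W r (A \<union> B)"
proof -
  have "side W r ((W - A) \<inter> (W - B))"
    using assms side_compl side_subset by (intro side_inter[where w = w]) blast+
  then have "side W r (W - (W - A) \<inter> (W - B))" by (rule side_compl[OF assms(1)])
  moreover have "W - (W - A) \<inter> (W - B) = A \<union> B" using assms side_subset by blast
  ultimately show ?thesis by simp
qed

lemma side_diff:
  assumes "skew W r" "side W r A" "side W r B" "w \<in> B" "w \<notin> A" shows "side W r (A - B)"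
proof -
  have "side W r (A \<inter> (W - B))"
    using assms side_compl side_subset by (intro side_inter[where w = w]) blast+
  moreover have "A \<inter> (W - B) = A - B" using assms side_subset by blast
  ultimately show ?thesis by simp
qed

lemma nside_compl: "skew W r \<Longrightarrow> nside W r A \<Longrightarrow> nside W r (W - A)"
  using side_compl[of W r A] side_subset[of W r A] unfolding nside_def by (auto simp: double_diff)

lemma nside_subset: "nside W r A \<Longrightarrow> A \<subseteq> W"
  by (simp add: nside_def side_def)

text \<open>The three ways of splitting four points into two pairs cannot all be induced by sides: the
  product of the three corresponding signs is negative.\<close>

lemma no_three_splits:
  assumes "skew W r" "side W r R" "side W r S" "side W r P"
    "{a, b, c, d} \<subseteq> W" "a \<in> R" "b \<in> R" "c \<notin> R" "d \<notin> R" "a \<in> S" "c \<in> S" "b \<notin> S" "d \<notin> S"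
    "a \<in> P" "d \<in> P" "b \<notin> P" "c \<notin> P"
  shows False
proof -
  have "(r a c = r b c) = (r a d = r b d)" "(r a b = r c b) = (r a d = r c d)"
    "(r a b = r d b) = (r a c = r d c)"
    using assms sideD[OF assms(2), of a b c d] sideD[OF assms(3), of a c b d]
      sideD[OF assms(4), of a d b c] by blast+
  moreover have "r b c \<noteq> r c b" "r b d \<noteq> r d b" "r c d \<noteq> r d c"
    using assms skewD[OF assms(1)] by blast+
  ultimately show False by blast
qed

lemma finite_sideD: "skew W r \<Longrightarrow> side W r A \<Longrightarrow> finite A"
  by (meson finite_subset side_subset skew_def)

lemma ex_min_side:
  assumes "skew W r" "nside W r S" obtains A where "min_side W r A" "A \<subseteq> S"
proof -
  have "finite S" using assms finite_sideD nside_def by metis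
  then have "nside W r S \<Longrightarrow> \<exists>A. min_side W r A \<and> A \<subseteq> S"
  proof (induction S rule: finite_psubset_induct)
    case (psubset S)
    show ?case
    proof (cases "min_side W r S")
      case False
      then obtain B where "nside W r B" "B \<subset> S" using psubset.prems by (auto simp: min_side_def)
      then show ?thesis using psubset.IH[of B] by auto
    qed auto
  qed
  then show ?thesis using assms that by blast
qed

lemma card_ge2E:
  assumes "2 \<le> card A" "x \<in> A" obtains y where "y \<in> A" "y \<noteq> x"
proof -
  have "A \<noteq> {x}" using assms by auto
  then show ?thesis using that assms(2) by blast
qed

text \<open>Passing to a subset enlarges the complement, so a side properly inside a minimal one can
  fail to be an \<open>nside\<close> only by having fewer than two points. Most later arguments
  exhibit such a side and conclude that some piece is a single point.\<close>

lemma min_side_sub: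
  assumes "skew W r" "min_side W r A" "side W r B" "B \<subseteq> A" "x \<in> B" "B \<noteq> A"
  shows "B = {x}"
proof -
  have n: "nside W r A" using assms by (simp add: min_side_def)
  have f: "finite W" using assms by (simp add: skew_def)
  have "card (W - A) \<le> card (W - B)" using f assms(4) by (intro card_mono) auto
  then have "\<not> 2 \<le> card B" using assms n by (auto simp: min_side_def nside_def)
  moreover have "finite B" using finite_sideD[OF assms(1,3)] .
  ultimately have "card B = 1" using assms(5)
    by (metis Suc_1 card_0_eq empty_iff le_less_Suc_eq less_one linorder_not_le not_less_eq_eq)
  then show ?thesis using assms(5) by (auto simp: card_1_singleton_iff)
qed

text \<open>Switching makes \<open>w\<close> a sink or source, whereupon the sides avoiding \<open>w\<close> become modules.\<close>

definition rebase :: "'b \<Rightarrow> ('b \<Rightarrow> 'b \<Rightarrow> bool) \<Rightarrow> 'b \<Rightarrow> 'b \<Rightarrow> bool" where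
  "rebase w r u v \<longleftrightarrow> r u v \<noteq> (r u w \<noteq> r v w)"

text \<open>The correction made by switching is symmetric in the two points.\<close>

lemma skew_rebase: "skew W r \<Longrightarrow> skew (W - {w}) (rebase w r)"
  unfolding skew_def rebase_def by (metis Diff_iff finite_Diff)

lemma side_iff_homog:
  assumes "w \<in> W" "w \<notin> A"
  shows "side W r A \<longleftrightarrow> homog (W - {w}) (rebase w r) A"
proof
  assume s: "side W r A"
  show "homog (W - {w}) (rebase w r) A"
    unfolding homog_def
  proof (intro conjI ballI)
    fix a a' b assume "a \<in> A" "a' \<in> A" "b \<in> W - {w} - A"
    then show "rebase w r a b = rebase w r a' b"
      using sideD[OF s, of a a' b w] assms unfolding rebase_def by blast
  qed (use assms side_subset[OF s] in auto)
next
  assume h: "homog (W - {w}) (rebase w r) A"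
  have "(r a b = r a' b) = (r a w = r a' w)" if "a \<in> A" "a' \<in> A" "b \<in> W - A" for a a' b
  proof (cases "b = w")
    case False
    then have "rebase w r a b = rebase w r a' b" using h that unfolding homog_def by blast
    then show ?thesis unfolding rebase_def by blast
  qed (use refl in blast)
  then have "(r a b = r a' b) = (r a b' = r a' b')"
    if "a \<in> A" "a' \<in> A" "b \<in> W - A" "b' \<in> W - A" for a a' b b'
    using that by metis
  then show "side W r A" using h unfolding side_def homog_def by blast
qed

lemma flip_pair: "flip {{x, y}} r u v \<longleftrightarrow> (r u v \<noteq> (u = x \<and> v = y \<or> u = y \<and> v = x))"
  by (simp add: flip_def doubleton_eq_iff)

text \<open>The correction made by switching depends only on arcs at \<open>w\<close>, and the
  flipped pair avoids \<open>w\<close>.\<close>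

lemma rebase_flip:
  "w \<noteq> x \<Longrightarrow> w \<noteq> y \<Longrightarrow> rebase w (flip {{x, y}} r) = flip {{x, y}} (rebase w r)"
  unfolding fun_eq_iff rebase_def flip_pair by blast

lemma homogD: "homog U g A \<Longrightarrow> a \<in> A \<Longrightarrow> a' \<in> A \<Longrightarrow> b \<in> U \<Longrightarrow> b \<notin> A \<Longrightarrow> g a b = g a' b"
  unfolding homog_def by blast

lemma homogD2:
  assumes "skew U g" "homog U g A" "a \<in> A" "a' \<in> A" "b \<in> U" "b \<notin> A"
  shows "g b a = g b a'"
proof -
  have "a \<in> U" "a' \<in> U" using assms unfolding homog_def by blast+
  moreover have "g a b = g a' b" using homogD[OF assms(2-6)] .
  ultimately show ?thesis using skewD[OF assms(1), of a b] skewD[OF assms(1), of a' b] assms(3-6) by blast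
qed

text \<open>A new module \<open>M\<close> contains a single vertex \<open>x\<close> of \<open>A\<close>, and minimality forces \<open>A\<close> to be a pair; the
  other vertices of \<open>M\<close> form a module of the original tournament, which is compared with \<open>C\<close>.\<close>

lemma new_module:
  assumes sk: "skew U g" and A: "homog U g A" and C: "homog U g C"
    and mA: "\<And>B z. homog U g B \<Longrightarrow> B \<subseteq> A \<Longrightarrow> z \<in> B \<Longrightarrow> B \<noteq> A \<Longrightarrow> B = {z}"
    and mC: "\<And>B z. homog U g B \<Longrightarrow> B \<subseteq> C \<Longrightarrow> z \<in> B \<Longrightarrow> B \<noteq> C \<Longrightarrow> B = {z}"
    and cA: "2 \<le> card A" and cC: "2 \<le> card C" and dis: "A \<inter> C = {}"
    and x: "x \<in> A" and y: "y \<in> C" and M: "homog U (flip {{x,y}} g) M"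
    and xM: "x \<in> M" and yM: "y \<notin> M" and cM: "2 \<le> card M"
  shows "homog U g (insert x C)"
proof -
  have AU: "A \<subseteq> U" and CU: "C \<subseteq> U" and MU: "M \<subseteq> U" using A C M by (auto simp: homog_def)
  have xy: "x \<noteq> y" "x \<notin> C" "y \<notin> A" using x y dis by auto
  \<comment> \<open>\<open>M\<close> is a module of the flipped relation. Undoing the flip leaves it
    uniform towards every outside vertex except \<open>y\<close>, and towards \<open>y\<close>
    exactly \<open>x\<close> disagrees with the other vertices of \<open>M\<close>
    (\<open>M1\<close>, \<open>M2\<close>, \<open>M3\<close>).\<close>
  have M1: "g a b = g a' b" if "a \<in> M" "a' \<in> M" "b \<in> U" "b \<notin> M" "b \<noteq> y" for a a' b
    using homogD[OF M that(1-4)] that xM yM unfolding flip_pair by blast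
  have M2: "g a y = g a' y" if "a \<in> M" "a' \<in> M" "a \<noteq> x" "a' \<noteq> x" for a a'
    using homogD[OF M that(1,2), of y] that y CU yM unfolding flip_pair by blast
  have M3: "g x y \<noteq> g a y" if "a \<in> M" "a \<noteq> x" for a
    using homogD[OF M that(1) xM, of y] that y CU yM xy unfolding flip_pair by blast
  \<comment> \<open>A vertex of \<open>A\<close> outside \<open>M\<close> is not \<open>y\<close>,
    so \<open>M1\<close> applies to it, and a vertex outside \<open>A\<close> sees \<open>A\<close>
    uniformly: the intersection is a module. It is proper because \<open>y\<close> sees
    \<open>A\<close> uniformly but, by \<open>M3\<close>, not \<open>M\<close>.\<close>
  have AM: "A \<inter> M = {x}"
  proof (rule mA)
    show "homog U g (A \<inter> M)" unfolding homog_def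
    proof (intro conjI ballI)
      fix a a' b assume *: "a \<in> A \<inter> M" "a' \<in> A \<inter> M" "b \<in> U - A \<inter> M"
      show "g a b = g a' b"
      proof (cases "b \<in> A")
        case True
        then have "b \<noteq> y" "b \<notin> M" using * xy by auto
        then show ?thesis using * M1 by blast
      next
        case False then show ?thesis using * homogD[OF A] by blast
      qed
    qed (use AU in auto)
    obtain a where a: "a \<in> A" "a \<noteq> x" using card_ge2E[OF cA x] by blast
    show "A \<inter> M \<noteq> A"
    proof
      assume "A \<inter> M = A"
      then have "a \<in> M" using a by auto
      then have "g x y \<noteq> g a y" using M3 a by blast
      moreover have "g x y = g a y" using homogD[OF A x a(1), of y] y CU xy by blast
      ultimately show False by blast
    qed
  qed (use x xM in auto)
  obtain m where m: "m \<in> M" "m \<noteq> x" using card_ge2E[OF cM xM] by blast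
  then have mA': "m \<notin> A" using AM by blast
  obtain x' where x': "x' \<in> A" "x' \<noteq> x" using card_ge2E[OF cA x] by blast
  have x'M: "x' \<notin> M" using AM x' by blast
  \<comment> \<open>\<open>x\<close> and \<open>m\<close> look alike to the vertices of
    \<open>A - {x}\<close>, which lie outside \<open>M\<close>, and \<open>m\<close> lies outside
    the module \<open>A\<close>; so \<open>x\<close> sees \<open>A - {x}\<close> uniformly.\<close>
  have "A - {x} = {x'}"
  proof (rule mA)
    show "homog U g (A - {x})" unfolding homog_def
    proof (intro conjI ballI)
      fix a a' b assume *: "a \<in> A - {x}" "a' \<in> A - {x}" "b \<in> U - (A - {x})"
      show "g a b = g a' b"
      proof (cases "b \<in> A")
        case True
        then have b: "b = x" using * by auto
        have "a \<noteq> y" "a' \<noteq> y" "a \<notin> M" "a' \<notin> M" "a \<in> U" "a' \<in> U" "m \<in> U"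
          using * xy AM AU MU m by auto
        then have "g x a = g m a" "g x a' = g m a'" "g a m = g a' m"
          using M1[OF xM m(1)] homogD[OF A, of a a' m] mA' * by blast+
        moreover have "g x a \<noteq> g a x" "g x a' \<noteq> g a' x" "g m a \<noteq> g a m" "g m a' \<noteq> g a' m"
          using skewD[OF sk] * AU MU m mA' x by blast+
        ultimately show ?thesis using b by blast
      next
        case False then show ?thesis using * homogD[OF A] by blast
      qed
    qed (use AU in auto)
  qed (use x x' in auto)
  then have Aeq: "A = {x, x'}" using x by blast
  define N where "N = M - {x}"
  have mN: "m \<in> N" using m N_def by auto
  have NA: "N \<inter> A = {}" using AM N_def by auto
  have NU: "N \<subseteq> U" using N_def MU by auto
  have yN: "y \<notin> N" using yM N_def by auto
  have sx: "g n x = g n x'" if "n \<in> N" for n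
    using homogD2[OF sk A x x'(1), of n] that NA NU by blast
  have sx': "g x x' = g n x'" if "n \<in> N" for n
    using M1[OF xM, of n x'] that N_def x'M x' xy AU by blast
  have N: "homog U g N" unfolding homog_def
  proof (intro conjI ballI)
    fix a a' b assume *: "a \<in> N" "a' \<in> N" "b \<in> U - N"
    consider "b = x" | "b = y" | "b \<notin> M" "b \<noteq> y" using * N_def by blast
    then show "g a b = g a' b"
    proof cases
      case 1 then show ?thesis using sx sx' * by metis
    next
      case 2 then show ?thesis using M2 * N_def by blast
    next
      case 3 then show ?thesis using M1 * N_def by blast
    qed
  qed (rule NU)
  \<comment> \<open>Otherwise some \<open>c\<close> and \<open>n\<close> conflict: \<open>c\<close>
    does not distinguish \<open>x\<close> from \<open>n\<close>, and neither \<open>x\<close> nor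
    \<open>n\<close> distinguishes \<open>c\<close> from \<open>y\<close>, whereas \<open>y\<close>
    distinguishes \<open>x\<close> from \<open>n\<close>.\<close>
  have key: "C - {y} \<subseteq> N \<or> N \<subseteq> C"
  proof (rule ccontr)
    assume "\<not> ?thesis"
    then obtain c n where c: "c \<in> C" "c \<noteq> y" "c \<notin> N" and n: "n \<in> N" "n \<notin> C" by blast
    have "c \<notin> M" using c N_def xy by auto
    then have "g x c = g n c" using M1[OF xM, of n c] n N_def c CU by blast
    moreover have "g x c = g x y" "g n c = g n y"
      using homogD2[OF sk C c(1) y] x n xy AU NU by blast+
    ultimately show False using M3[of n] n N_def by blast
  qed
  obtain c where c: "c \<in> C" "c \<noteq> y" using card_ge2E[OF cC y] by blast
  \<comment> \<open>One vertex of \<open>C\<close> agreeing with \<open>x\<close> towards everything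
    outside is enough, because \<open>C\<close> is a module. If \<open>N\<close> lies in
    \<open>C\<close>, it is a module missing \<open>y\<close>, hence a single vertex; otherwise
    \<open>C\<close> is a pair \<open>{c, y}\<close> and the agreement is chased through
    \<open>x'\<close>.\<close>
  have "\<exists>c\<in>C. \<forall>b\<in>U. b \<notin> insert x C \<longrightarrow> g x b = g c b"
  proof (cases "N \<subseteq> C")
    case True
    have "N = {m}" by (rule mC[OF N True mN]) (use y yN in auto)
    then have "M = {x, m}" "m \<in> C" using N_def xM True by auto
    then show ?thesis using M1[OF xM, of m] y by (intro bexI[of _ m]) auto
  next
    case False
    then have sub: "C - {y} \<subseteq> N" using key by blast
    have "homog U g (C - {y})" unfolding homog_def
    proof (intro conjI ballI)
      fix a a' b assume *: "a \<in> C - {y}" "a' \<in> C - {y}" "b \<in> U - (C - {y})"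
      show "g a b = g a' b"
      proof (cases "b = y")
        case True then show ?thesis using homogD[OF N, of a a' y] * sub y CU yN by blast
      next
        case False then show ?thesis using homogD[OF C, of a a' b] * by blast
      qed
    qed (use CU in auto)
    then have "C - {y} = {c}" using mC[of "C - {y}" c] c y by blast
    then have Ceq: "C = {c, y}" using y by blast
    have cN: "c \<in> N" using sub c by auto
    then have cM': "c \<in> M" using N_def by auto
    have "g x b = g c b" if b: "b \<in> U" "b \<notin> insert x C" for b
    proof (cases "b \<in> M")
      case False then show ?thesis using M1[OF xM cM'] b y by blast
    next
      case True
      then have bN: "b \<in> N" using b N_def by auto
      have bA: "b \<notin> A" using bN NA by auto
      have ne: "b \<noteq> y" "b \<noteq> c" "b \<noteq> x" "x' \<noteq> c" using b c y xy x' dis Ceq by auto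
      have "g c b = g y b" using homogD[OF C c(1) y, of b] b by blast
      moreover have "g b y \<noteq> g x y" using M3[of b] bN N_def by blast
      moreover have "g x y = g x c" using homogD2[OF sk C y c(1), of x] x AU xy by blast
      moreover have "g x c = g x' c" using homogD[OF A x x'(1), of c] c CU dis by blast
      moreover have "g c x' = g b x'" using sx' cN bN by blast
      moreover have "g x b = g x' b" using homogD[OF A x x'(1), of b] b bA by blast
      moreover have "g b y \<noteq> g y b" "g x' c \<noteq> g c x'" "g b x' \<noteq> g x' b"
        using skewD[OF sk] ne bA b y c x' AU CU by blast+
      ultimately show ?thesis by blast
    qed
    then show ?thesis using c by blast
  qed
  then obtain c0 where c0: "c0 \<in> C" "\<And>b. b \<in> U \<Longrightarrow> b \<notin> insert x C \<Longrightarrow> g x b = g c0 b" by blast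
  show ?thesis unfolding homog_def
  proof (intro conjI ballI)
    fix a a' b assume *: "a \<in> insert x C" "a' \<in> insert x C" "b \<in> U - insert x C"
    have "g z b = g c0 b" if "z \<in> insert x C" for z
      using that c0 * homogD[OF C, of z c0 b] by blast
    then show "g a b = g a' b" using * by blast
  qed (use x AU CU in auto)
qed

section \<open>Reversing one arc\<close>

text \<open>A pair that does not cross the cut contributes no entry to its sign matrix.\<close>

lemma side_flip:
  assumes "\<And>e. e \<in> E \<Longrightarrow> e \<subseteq> M \<or> e \<inter> M = {}"
  shows "side W (flip E r) M \<longleftrightarrow> side W r M"
proof -
  have *: "flip E r a b = r a b" if "a \<in> M" "b \<in> W - M" for a b
    using assms[of "{a, b}"] that by (auto simp: flip_def)
  show ?thesis unfolding side_def by (intro conj_cong refl ball_cong) (simp_all only: *)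
qed

lemma nside_flip:
  assumes "\<And>e. e \<in> E \<Longrightarrow> e \<subseteq> M \<or> e \<inter> M = {}"
  shows "nside W (flip E r) M \<longleftrightarrow> nside W r M"
  using side_flip[OF assms] by (simp add: nside_def)

text \<open>Switching at \<open>w\<close>, which lies outside \<open>A\<close>, \<open>C\<close> and
  \<open>M\<close>, turns all three into modules, where \<open>new_module\<close> applies. Subsets
  of \<open>A\<close> and \<open>C\<close> avoid \<open>w\<close> as well, so minimality is carried
  over.\<close>

lemma new_side:
  assumes sk: "skew W r" and A: "min_side W r A" and C: "min_side W r C" and dis: "A \<inter> C = {}"
    and x: "x \<in> A" and y: "y \<in> C" and w: "w \<in> W" "w \<notin> A" "w \<notin> C"
    and M: "nside W (flip {{x,y}} r) M" and xM: "x \<in> M" and yM: "y \<notin> M" and wM: "w \<notin> M"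
  shows "side W r (insert x C)"
proof -
  let ?U = "W - {w}" and ?g = "rebase w r"
  have sA: "side W r A" and sC: "side W r C" and sM: "side W (flip {{x,y}} r) M"
    and c: "2 \<le> card A" "2 \<le> card C" "2 \<le> card M"
    using A C M by (auto simp: min_side_def nside_def)
  have sub: "B = {z}"
    if "D = A \<or> D = C" "homog ?U ?g B" "B \<subseteq> D" "z \<in> B" "B \<noteq> D" for B z D
  proof -
    have "w \<notin> B" using that w by auto
    then have "side W r B" using side_iff_homog[OF w(1)] that(2) by blast
    then show ?thesis using min_side_sub[OF sk _ _ that(3,4,5)] that(1) A C by blast
  qed
  have wxy: "w \<noteq> x" "w \<noteq> y" using w x y by auto
  have "homog ?U ?g (insert x C)"
  proof (rule new_module[where A = A and M = M and y = y])
    show "skew ?U ?g" using skew_rebase[OF sk] .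
    show "homog ?U ?g A" "homog ?U ?g C" using side_iff_homog[OF w(1)] sA sC w by blast+
    show "homog ?U (flip {{x, y}} ?g) M"
      using side_iff_homog[OF w(1) wM] sM rebase_flip[OF wxy] by metis
  qed (use sub c dis x y xM yM in blast)+
  then show ?thesis using side_iff_homog[OF w(1), of "insert x C"] w wxy by blast
qed

text \<open>Exactly one of \<open>M\<close> and its complement avoids \<open>w\<close>, and if
  \<open>M\<close> separates \<open>x\<close> from \<open>y\<close>, that one contains exactly one
  of them. Up to complement and exchange of the two blocks, \<open>new_side\<close> therefore covers
  every case.\<close>

lemma no_new_side:
  assumes sk: "skew W r" and A: "min_side W r A" and C: "min_side W r C" and dis: "A \<inter> C = {}"
    and x: "x \<in> A" and y: "y \<in> C" and w: "w \<in> W" "w \<notin> A" "w \<notin> C"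
    and nx: "\<not> side W r (insert x C)" and ny: "\<not> side W r (insert y A)"
    and M: "nside W (flip {{x,y}} r) M"
  shows "nside W r M" "x \<in> M \<longleftrightarrow> y \<in> M"
proof -
  have C': "C \<inter> A = {}" using dis by blast
  have M': "nside W (flip {{y,x}} r) N" if "nside W (flip {{x,y}} r) N" for N
    using that by (simp add: insert_commute)
  have Mc: "nside W (flip {{x,y}} r) (W - M)" using nside_compl[OF skew_flip[OF sk] M] .
  have xyW: "x \<in> W" "y \<in> W" using x y A C nside_subset unfolding min_side_def by blast+
  show *: "x \<in> M \<longleftrightarrow> y \<in> M"
  proof (rule ccontr)
    assume "\<not> ?thesis"
    then consider "x \<in> M" "y \<notin> M" "w \<in> M" | "x \<in> M" "y \<notin> M" "w \<notin> M"
      | "x \<notin> M" "y \<in> M" "w \<in> M" | "x \<notin> M" "y \<in> M" "w \<notin> M" by blast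
    then show False
    proof cases
      case 1
      then show ?thesis
        using new_side[OF sk C A C' y x w(1,3,2) M'[OF Mc]] ny xyW by blast
    next
      case 2
      then show ?thesis using new_side[OF sk A C dis x y w M] nx by blast
    next
      case 3
      then show ?thesis using new_side[OF sk A C dis x y w Mc] nx xyW by blast
    next
      case 4
      then show ?thesis using new_side[OF sk C A C' y x w(1,3,2) M'[OF M]] ny by blast
    qed
  qed
  show "nside W r M" using nside_flip[of "{{x,y}}" M W r] M * by auto
qed

text \<open>That the union is no side gives all hypotheses of \<open>no_new_side\<close> at once:
  overlapping sides have a side as union, the whole of \<open>W\<close> is a side, and
  \<open>insert x C\<close> as a side would, through the common point \<open>x\<close>, make
  \<open>A \<union> C\<close> one.\<close>

lemma no_new_side_Un:
  assumes sk: "skew W r" and A: "min_side W r A" and C: "min_side W r C"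
    and x: "x \<in> A" and y: "y \<in> C" and n: "\<not> side W r (A \<union> C)"
    and M: "nside W (flip {{x,y}} r) M"
  shows "nside W r M" "x \<in> M \<longleftrightarrow> y \<in> M"
proof -
  have sA: "side W r A" and sC: "side W r C" using A C by (auto simp: min_side_def nside_def)
  have dis: "A \<inter> C = {}" using side_Un[OF sk sA sC] n by blast
  have "A \<union> C \<noteq> W" using n by (auto simp: side_def)
  then obtain w where w: "w \<in> W" "w \<notin> A" "w \<notin> C" using side_subset sA sC by blast
  have nx: "\<not> side W r (insert x C)"
  proof
    assume "side W r (insert x C)"
    from side_Un[OF sk sA this x] have "side W r (A \<union> C)" using x by (simp add: insert_absorb)
    then show False using n by blast
  qed
  have ny: "\<not> side W r (insert y A)"
  proof
    assume "side W r (insert y A)"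
    from side_Un[OF sk sC this y] have "side W r (C \<union> A)" using y by (simp add: insert_absorb)
    then show False using n by (simp add: Un_commute)
  qed
  show "nside W r M" "x \<in> M \<longleftrightarrow> y \<in> M"
    using no_new_side[OF sk A C dis x y w nx ny M] by blast+
qed

text \<open>A parity argument for overlapping blocks. Let \<open>N\<close> contain \<open>p\<close>
  and a further point \<open>c\<close>, but neither \<open>q\<close> nor \<open>w\<close>. The minor
  on the rows \<open>c\<close>, \<open>p\<close> and the columns \<open>q\<close>, \<open>w\<close>
  has the right sign before the flip because \<open>{w, q}\<close> is a side, and the flip changes
  just one of its entries.\<close>

lemma no_new_side_twins:
  assumes sk: "skew W r" and A: "side W r {x, w}" and C: "side W r {w, y}"
    and d: "x \<noteq> y" "x \<noteq> w" "y \<noteq> w"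
    and M: "nside W (flip {{x,y}} r) M"
  shows "nside W r M" "x \<in> M \<longleftrightarrow> y \<in> M"
proof -
  have W: "x \<in> W" "y \<in> W" "w \<in> W" using A C side_subset by blast+
  have aux: False if H: "side W r {w, q}" "p \<noteq> q" "p \<noteq> w" "q \<noteq> w" "{p, q} = {x, y}"
      "nside W (flip {{x,y}} r) N" "p \<in> N" "q \<notin> N" "w \<notin> N" for p q N
  proof -
    have N: "2 \<le> card N" "side W (flip {{x,y}} r) N" using H(6) by (auto simp: nside_def)
    then obtain c where c: "c \<in> N" "c \<noteq> p" using card_ge2E[OF N(1) H(7)] by blast
    have cW: "c \<in> W" "c \<noteq> q" "c \<noteq> w" "p \<in> W" using that c W side_subset[OF N(2)] by blast+
    have e: "{{x, y}} = {{p, q}}" using that by simp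
    have "(flip {{p,q}} r c q = flip {{p,q}} r p q) = (flip {{p,q}} r c w = flip {{p,q}} r p w)"
      using sideD[of W "flip {{p,q}} r" N c p q w] N(2) H(7-9) c cW W e side_subset[OF H(1)] by simp
    then have "(r c q = (\<not> r p q)) = (r c w = r p w)"
      unfolding flip_pair using c cW H(2-4) by blast
    moreover have "(r w c = r q c) = (r w p = r q p)"
      using sideD[OF H(1), of w q c p] cW H(2-4) by blast
    moreover have "r w c \<noteq> r c w" "r q c \<noteq> r c q" "r w p \<noteq> r p w" "r q p \<noteq> r p q"
      using skewD[OF sk] cW H(2-4) W side_subset[OF H(1)] by blast+
    ultimately show False by blast
  qed
  have Mc: "nside W (flip {{x,y}} r) (W - M)" using nside_compl[OF skew_flip[OF sk] M] .
  have A': "side W r {w, x}" using A by (simp add: insert_commute)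
  show *: "x \<in> M \<longleftrightarrow> y \<in> M"
    using aux[OF C, of x M] aux[OF C, of x "W - M"] aux[OF A', of y M] aux[OF A', of y "W - M"]
      d M Mc W insert_commute[of x y "{}"] by blast
  show "nside W r M" using nside_flip[of "{{x,y}}" M W r] M * by auto
qed

section \<open>Two blocks\<close>

definition prime :: "'b set \<Rightarrow> ('b \<Rightarrow> 'b \<Rightarrow> bool) \<Rightarrow> bool" where
  "prime W r \<longleftrightarrow> (\<forall>S. \<not> nside W r S)"

lemma min_side_compl:
  assumes sk: "skew W r" and A: "min_side W r A" and C: "min_side W r C" and U: "A \<union> C = W"
  shows "C = W - A"
proof -
  have "nside W r (W - A)" using A nside_compl[OF sk] by (simp add: min_side_def)
  then show ?thesis using C U unfolding min_side_def by blast
qed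

text \<open>The intersection and both differences are sides lying properly in a minimal one, so each
  is a single point. For the intersection a point outside both sets is required; without one,
  \<open>A\<close> and \<open>C\<close> would be complementary and hence disjoint.\<close>

lemma min_side_Int:
  assumes sk: "skew W r" and A: "min_side W r A" and C: "min_side W r C" and ne: "A \<noteq> C"
    and w: "w \<in> A" "w \<in> C"
  obtains x y where "A = {x, w}" "C = {w, y}" "x \<noteq> w" "y \<noteq> w" "x \<noteq> y"
proof -
  have sA: "side W r A" "2 \<le> card A" and sC: "side W r C" "2 \<le> card C"
    and m: "B \<subseteq> A \<Longrightarrow> nside W r B \<Longrightarrow> B = A" "B \<subseteq> C \<Longrightarrow> nside W r B \<Longrightarrow> B = C" for B
    using A C by (auto simp: min_side_def nside_def)
  have nAC: "\<not> A \<subseteq> C" "\<not> C \<subseteq> A" using m A C ne unfolding min_side_def by blast+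
  have "A \<union> C \<noteq> W" using min_side_compl[OF sk A C] w by blast
  then obtain u where u: "u \<in> W" "u \<notin> A" "u \<notin> C" using side_subset sA sC by blast
  have i: "side W r (A \<inter> C)" using side_inter[OF sA(1) sC(1) u] .
  have i1: "A \<inter> C = {w}" using min_side_sub[OF sk A i] nAC w by blast
  have dA: "side W r (A - C)" using side_diff[OF sk sA(1) sC(1)] nAC by blast
  have dC: "side W r (C - A)" using side_diff[OF sk sC(1) sA(1)] nAC by blast
  obtain x where x: "x \<in> A" "x \<noteq> w" using card_ge2E[OF sA(2) w(1)] by blast
  obtain y where y: "y \<in> C" "y \<noteq> w" using card_ge2E[OF sC(2) w(2)] by blast
  have "A - C = {x}" using min_side_sub[OF sk A dA, of x] x i1 w by blast
  moreover have "C - A = {y}" using min_side_sub[OF sk C dC, of y] y i1 w by blast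
  ultimately have "A = {x, w}" "C = {w, y}" "x \<noteq> y" using i1 by blast+
  then show ?thesis using that x y by blast
qed

text \<open>As the two blocks fill \<open>W\<close>, there is no point to switch at, and the
  reasoning of \<open>new_module\<close> is redone on sign matrices. Both \<open>A - {x}\<close> and
  \<open>M - {x}\<close> are sides before the flip and shrink to single points by
  minimality.\<close>

lemma two_blocks_core:
  assumes sk: "skew W r" and A: "min_side W r A" and C: "min_side W r C" and CA: "C = W - A"
    and x: "x \<in> A" and y: "y \<in> C" and M: "nside W (flip {{x,y}} r) M" and P: "A \<inter> M = {x}"
    and yM: "y \<notin> M"
  obtains x' q where "A = {x, x'}" "x' \<noteq> x" "q \<in> C" "q \<noteq> y" "side W (flip {{x,y}} r) {x, q}"
proof -
  let ?r = "flip {{x,y}} r"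
  have sA: "side W r A" "2 \<le> card A" and sC: "side W r C" "2 \<le> card C"
    and sM: "side W ?r M" "2 \<le> card M"
    using A C M by (auto simp: min_side_def nside_def)
  have sub: "A \<subseteq> W" "C \<subseteq> W" "M \<subseteq> W" using side_subset sA sC sM by blast+
  have xM: "x \<in> M" using P by blast
  have ff: "?r u v = r u v" "?r v u = r v u" if "v \<noteq> x" "v \<noteq> y" for u v
    using that by (auto simp: flip_pair)
  obtain q where q: "q \<in> M" "q \<noteq> x" using card_ge2E[OF sM(2) xM] by blast
  have qC: "q \<in> C" "q \<notin> A" using q P CA sub by blast+
  obtain x' where x': "x' \<in> A" "x' \<noteq> x" using card_ge2E[OF sA(2) x] by blast
  \<comment> \<open>The column of \<open>q\<close> is the reference. Only the column of
    \<open>x\<close> calls for \<open>M\<close>, whose rows \<open>x\<close> and \<open>q\<close>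
    are compared in the columns of \<open>A - {x}\<close>, where the flip changes nothing.\<close>
  have "side W r (A - {x})"
    unfolding side_def
  proof (intro conjI ballI)
    have *: "(r b c = r b' c) = (r b q = r b' q)"
      if H: "b \<in> A - {x}" "b' \<in> A - {x}" "c \<in> W - (A - {x})" for b b' c
    proof (cases "c = x")
      case False
      then show ?thesis using sideD[OF sA(1), of b b' c q] H qC sub by blast
    next
      case True
      have n: "b \<noteq> y" "b' \<noteq> y" "b \<notin> M" "b' \<notin> M" "b \<in> W" "b' \<in> W" "q \<in> W" "x \<in> W"
        using H y CA P sub qC x by blast+
      have "(?r x b = ?r q b) = (?r x b' = ?r q b')"
        using sideD[OF sM(1) xM q(1), of b b'] n by blast
      then have "(r x b = r q b) = (r x b' = r q b')" using ff n H by simp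
      moreover have "r x b \<noteq> r b x" "r x b' \<noteq> r b' x" "r q b \<noteq> r b q" "r q b' \<noteq> r b' q"
        using skewD[OF sk] n H q by blast+
      ultimately show ?thesis using True by blast
    qed
    fix b b' c c' assume H: "b \<in> A - {x}" "b' \<in> A - {x}" "c \<in> W - (A - {x})" "c' \<in> W - (A - {x})"
    show "(r b c = r b' c) = (r b c' = r b' c')" using *[OF H(1-3)] *[OF H(1,2,4)] by blast
  qed (use sub in blast)
  then have "A - {x} = {x'}" using min_side_sub[OF sk A, of "A - {x}" x'] x x' by blast
  then have Aeq: "A = {x, x'}" using x by blast
  have x'M: "x' \<notin> M" "x' \<noteq> y" "x' \<in> W" using x' P y CA sub by blast+
  let ?Q = "M - {x}"
  have QC: "?Q \<subseteq> C" using CA P sub by blast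
  \<comment> \<open>Now \<open>x'\<close> is the reference column; in the column of \<open>x\<close>
    the side \<open>C\<close>, which contains \<open>M - {x}\<close>, is used instead of
    \<open>M\<close>.\<close>
  have "side W r ?Q"
    unfolding side_def
  proof (intro conjI ballI)
    have *: "(r b c = r b' c) = (r b x' = r b' x')"
      if H: "b \<in> ?Q" "b' \<in> ?Q" "c \<in> W - ?Q" for b b' c
    proof (cases "c = x")
      case False
      then have "(?r b c = ?r b' c) = (?r b x' = ?r b' x')"
        using sideD[OF sM(1), of b b' c x'] H x'M by blast
      moreover have "b \<noteq> x" "b' \<noteq> x" "b \<noteq> y" "b' \<noteq> y" using H yM by blast+
      ultimately show ?thesis using ff by simp
    next
      case True
      then show ?thesis using sideD[OF sC(1), of b b' x x'] QC H x x' CA sub by blast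
    qed
    fix b b' c c' assume H: "b \<in> ?Q" "b' \<in> ?Q" "c \<in> W - ?Q" "c' \<in> W - ?Q"
    show "(r b c = r b' c) = (r b c' = r b' c')" using *[OF H(1-3)] *[OF H(1,2,4)] by blast
  qed (use sub in blast)
  then have "?Q = {q}" using min_side_sub[OF sk C, of ?Q q] QC q y yM by blast
  then have "M = {x, q}" using xM by blast
  then show ?thesis using that Aeq x' qC q yM sM(1) by blast
qed

text \<open>If \<open>M\<close> contains a second point \<open>p\<close> of \<open>A\<close>, then a
  second point \<open>q\<close> of \<open>C\<close> outside \<open>M\<close> would make the minor on
  the rows \<open>x\<close>, \<open>p\<close> and columns \<open>y\<close>, \<open>q\<close> correct
  both before and after the flip, although one entry changes. So the complement of \<open>M\<close>
  meets \<open>C\<close> in \<open>y\<close> alone, and the core argument applies with the blocks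
  exchanged.\<close>

lemma two_blocks_new_side:
  assumes sk: "skew W r" and A: "min_side W r A" and C: "min_side W r C" and CA: "C = W - A"
    and x: "x \<in> A" and y: "y \<in> C" and M: "nside W (flip {{x,y}} r) M" and sep: "(x \<in> M) \<noteq> (y \<in> M)"
  shows "(\<exists>x' q. A = {x, x'} \<and> x' \<noteq> x \<and> q \<in> C \<and> q \<noteq> y \<and> side W (flip {{x,y}} r) {x, q}) \<or> card C = 2"
proof -
  have aux: ?thesis if xM: "x \<in> M" and yM: "y \<notin> M" and M: "nside W (flip {{x,y}} r) M" for M
  proof (cases "A \<inter> M = {x}")
    case True
    show ?thesis by (rule two_blocks_core[OF sk A C CA x y M True yM]) blast
  next
    case False
    then obtain p where p: "p \<in> A" "p \<in> M" "p \<noteq> x" using x xM by blast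
    have AW: "A \<subseteq> W" "M \<subseteq> W" using A M nside_subset by (auto simp: min_side_def)
    have sA: "side W r A" and sM: "side W (flip {{x,y}} r) M"
      using A M by (auto simp: min_side_def nside_def)
    have "C \<inter> (W - M) = {y}"
    proof (rule ccontr)
      assume "\<not> ?thesis"
      then obtain q where q: "q \<in> C" "q \<notin> M" "q \<noteq> y" using y yM CA by blast
      have n: "p \<noteq> y" "q \<noteq> x" using p q yM xM by blast+
      have "(flip {{x,y}} r x y = flip {{x,y}} r p y) = (flip {{x,y}} r x q = flip {{x,y}} r p q)"
        using sideD[OF sM xM p(2), of y q] y q CA yM by blast
      then have "((\<not> r x y) = r p y) = (r x q = r p q)" unfolding flip_pair using n p q by blast
      moreover have "(r x y = r p y) = (r x q = r p q)"
        using sideD[OF sA x p(1), of y q] y q CA by blast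
      ultimately show False by blast
    qed
    moreover have "A = W - C" using CA AW by blast
    moreover have "nside W (flip {{y,x}} r) (W - M)"
      using nside_compl[OF skew_flip[OF sk] M] by (simp add: insert_commute)
    moreover have "x \<notin> W - M" using xM by blast
    ultimately obtain y' q where "C = {y, y'}" "y' \<noteq> y"
      using two_blocks_core[OF sk C A _ y x, of "W - M"] by metis
    then show ?thesis by simp
  qed
  have xyW: "x \<in> W" "y \<in> W" using x y CA A nside_subset unfolding min_side_def by blast+
  show ?thesis
  proof (cases "x \<in> M")
    case True then show ?thesis using aux[OF _ _ M] sep by blast
  next
    case False
    then show ?thesis using aux[OF _ _ nside_compl[OF skew_flip[OF sk] M]] sep xyW by blast
  qed
qed

text \<open>Call \<open>y\<close> bad if some \<open>{x, q}\<close> becomes a side. Of two bad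
  points, one must be the witness \<open>q\<close> of the other (\<open>step\<close>). Among four
  bad points the witness of \<open>y1\<close> can be only one of the others, so at least two of
  these have witness \<open>y1\<close>, which contradicts \<open>step\<close> for those two. Five
  points in \<open>C\<close> leave four candidates besides \<open>o'\<close>.\<close>

lemma ex_good_vertex:
  assumes sk: "skew W r" and CA: "C = W - A" and C: "side W r C" and A: "A = {x, x'}" "x' \<noteq> x" "A \<subseteq> W"
    and c5: "5 \<le> card C"
  obtains y where "y \<in> C" "y \<noteq> o'" "\<And>q. q \<in> C \<Longrightarrow> q \<noteq> y \<Longrightarrow> \<not> side W (flip {{x,y}} r) {x, q}"
proof -
  have "finite C" using sk CA by (simp add: skew_def)
  then have "4 \<le> card (C - {o'})" using c5 by (cases "o' \<in> C") auto
  then obtain Y where Y: "Y \<subseteq> C - {o'}" "card Y = 4" using obtain_subset_with_card_n by metis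
  then obtain y1 y2 y3 y4 where Yeq: "Y = {y1, y2, y3, y4}"
    and dy: "y1 \<noteq> y2" "y1 \<noteq> y3" "y1 \<noteq> y4" "y2 \<noteq> y3" "y2 \<noteq> y4" "y3 \<noteq> y4"
    by (auto simp: card_Suc_eq numeral_eq_Suc)
  have xW: "x \<in> W" "x' \<in> W" "x \<notin> C" "x' \<notin> C" using A CA by blast+
  have step: "q2 = y1 \<or> q1 = y2"
    if H: "y1 \<in> C" "y2 \<in> C" "y1 \<noteq> y2" "q1 \<in> C" "q2 \<in> C" "q1 \<noteq> y1" "q2 \<noteq> y2"
      "side W (flip {{x,y1}} r) {x, q1}" "side W (flip {{x,y2}} r) {x, q2}" for y1 y2 q1 q2
  proof (rule ccontr)
    assume n: "\<not> ?thesis"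
    \<comment> \<open>The side \<open>{x, q}\<close> of the flipped relation read off in the columns
      \<open>b\<close> and \<open>x'\<close>; the flip shows only if \<open>b\<close> is
      \<open>y\<close>.\<close>
    have *: "(r x b \<noteq> (b = y)) = r q b \<longleftrightarrow> r x x' = r q x'"
      if B: "q \<in> C" "y \<in> C" "b \<in> C" "q \<noteq> b" "q \<noteq> y" "side W (flip {{x,y}} r) {x, q}" for q y b
    proof -
      have n: "x \<noteq> y" "x \<noteq> b" "q \<noteq> x" "x' \<noteq> q" "x' \<noteq> y" "b \<in> W" using B xW CA by blast+
      have "(flip {{x,y}} r x b = flip {{x,y}} r q b) = (flip {{x,y}} r x x' = flip {{x,y}} r q x')"
        using sideD[OF B(6), of x q b x'] n B xW A(2) by blast
      moreover have "flip {{x,y}} r x b = (r x b \<noteq> (b = y))" "flip {{x,y}} r q b = r q b"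
        "flip {{x,y}} r x x' = r x x'" "flip {{x,y}} r q x' = r q x'"
        using n B by (auto simp: flip_pair)
      ultimately show ?thesis by blast
    qed
    have Cs: "(r q1 x = r q2 x) = (r q1 x' = r q2 x')" using sideD[OF C H(4,5), of x x'] xW by blast
    show False
    proof (cases "q1 = q2")
      case True
      show False using *[OF H(4,1,1,6,6,8)] *[of q1 y2 y1] H True by blast
    next
      case False
      have a: "r x q2 = r q1 q2 \<longleftrightarrow> r x x' = r q1 x'" using *[OF H(4,1,5) False H(6,8)] n by blast
      have b: "r x q1 = r q2 q1 \<longleftrightarrow> r x x' = r q2 x'"
        using *[OF H(5,2,4) False[symmetric] H(7,9)] n by blast
      have "r x q1 \<noteq> r q1 x" "r x q2 \<noteq> r q2 x" "r q1 q2 \<noteq> r q2 q1"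
        using skewD[OF sk] H xW CA False by blast+
      then show False using a b Cs by blast
    qed
  qed
  have "\<exists>y\<in>Y. \<forall>q\<in>C. q \<noteq> y \<longrightarrow> \<not> side W (flip {{x,y}} r) {x, q}"
  proof (rule ccontr)
    assume "\<not> ?thesis"
    then have ex: "\<exists>q\<in>C. q \<noteq> y \<and> side W (flip {{x,y}} r) {x, q}" if "y \<in> Y" for y using that by blast
    obtain q1 where q1: "q1 \<in> C" "q1 \<noteq> y1" "side W (flip {{x,y1}} r) {x, q1}" using ex[of y1] Yeq by blast
    obtain q2 where q2: "q2 \<in> C" "q2 \<noteq> y2" "side W (flip {{x,y2}} r) {x, q2}" using ex[of y2] Yeq by blast
    obtain q3 where q3: "q3 \<in> C" "q3 \<noteq> y3" "side W (flip {{x,y3}} r) {x, q3}" using ex[of y3] Yeq by blast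
    obtain q4 where q4: "q4 \<in> C" "q4 \<noteq> y4" "side W (flip {{x,y4}} r) {x, q4}" using ex[of y4] Yeq by blast
    have yC: "y1 \<in> C" "y2 \<in> C" "y3 \<in> C" "y4 \<in> C" using Y Yeq by blast+
    have d: "\<not> (q = z \<and> q' = z)"
      if "q \<in> C" "q \<noteq> y" "side W (flip {{x,y}} r) {x, q}" "y \<in> C"
         "q' \<in> C" "q' \<noteq> y'" "side W (flip {{x,y'}} r) {x, q'}" "y' \<in> C" "y \<noteq> y'" "z \<noteq> y" "z \<noteq> y'" for q q' y y' z
      using step[of y y' q q'] that by blast
    have "q2 = y1 \<or> q1 = y2" "q3 = y1 \<or> q1 = y3" "q4 = y1 \<or> q1 = y4"
      using step yC dy q1 q2 q3 q4 by blast+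
    moreover have "\<not> (q2 = y1 \<and> q3 = y1)" "\<not> (q2 = y1 \<and> q4 = y1)" "\<not> (q3 = y1 \<and> q4 = y1)"
      using d q2 q3 q4 yC dy by blast+
    ultimately show False using dy by metis
  qed
  then show ?thesis using that Y by blast
qed

text \<open>A side with these points other than \<open>A\<close> splits both blocks. The four pieces
  are sides properly inside minimal ones, hence single points, and \<open>W\<close> has only four
  points.\<close>

lemma nside_two_blocks:
  assumes sk: "skew W r" and A: "min_side W r A" and C: "min_side W r C" and CA: "C = W - A"
    and c: "5 \<le> card W" and S: "nside W r S" and xS: "x \<in> A" "x \<in> S" and yS: "y \<in> C" "y \<notin> S"
  shows "S = A"
proof (rule ccontr)
  assume ne: "S \<noteq> A"
  have sA: "side W r A" "2 \<le> card A" and sC: "side W r C" "2 \<le> card C" and sS: "side W r S" "2 \<le> card S"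
    using A C S by (auto simp: min_side_def nside_def)
  have sub: "A \<subseteq> W" "C \<subseteq> W" "S \<subseteq> W" using side_subset sA sC sS by blast+
  have "W - S \<subseteq> C \<longrightarrow> W - S = C" using nside_compl[OF sk S] C unfolding min_side_def by blast
  then have nAS: "\<not> A \<subseteq> S" using ne sub CA by blast
  have i: "side W r (S \<inter> A)" using side_inter[OF sS(1) sA(1), of y] yS CA by blast
  have i1: "S \<inter> A = {x}" using min_side_sub[OF sk A i, of x] xS nAS by blast
  obtain s where s: "s \<in> S" "s \<noteq> x" using card_ge2E[OF sS(2) xS(2)] by blast
  have sC': "s \<in> C" "s \<notin> A" using s i1 sub CA by blast+
  have "side W r (S - A)" using side_diff[OF sk sS(1) sA(1)] nAS by blast
  moreover have "S - A \<subseteq> C" using sub CA by blast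
  ultimately have "S - A = {s}" using min_side_sub[OF sk C, of "S - A" s] s sC' yS by blast
  then have Seq: "S = {x, s}" using i1 by blast
  obtain x' where x': "x' \<in> A" "x' \<notin> S" using nAS by blast
  have "side W r (A - S)" using side_diff[OF sk sA(1) sS(1) s(1) sC'(2)] .
  then have "A - S = {x'}" using min_side_sub[OF sk A, of "A - S" x'] x' xS by blast
  then have Aeq: "A = {x, x'}" using i1 by blast
  have "side W r (C - S)" using side_diff[OF sk sC(1) sS(1) xS(2)] xS CA by blast
  then have "C - S = {y}" using min_side_sub[OF sk C, of "C - S" y] yS s sC' by blast
  then have "C = {s, y}" using Seq sC' xS CA by blast
  then have "W = {x, x', s, y}" using Aeq CA sub by blast
  then have "card W \<le> card {x, x', s, y}" by simp
  also have "\<dots> \<le> 4" by (simp add: card_insert_if)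
  finally show False using c by simp
qed

text \<open>The only nontrivial sides before the flip are the two blocks, which separate
  \<open>x\<close> from every point of \<open>C\<close>. What remains is the danger of a new side;
  by \<open>two_blocks_new_side\<close> it entails a side \<open>{x, q}\<close> or
  \<open>card C = 2\<close>, and the choice of \<open>y\<close> and the size of \<open>C\<close>
  exclude both.\<close>

lemma two_blocks_prime:
  assumes sk: "skew W r" and A: "min_side W r A" and C: "min_side W r C" and CA: "C = W - A"
    and c: "8 \<le> card W" and x: "x \<in> A" "x \<noteq> o'" and c2: "card A = 2"
  obtains y where "y \<in> C" "y \<noteq> o'" "prime W (flip {{x,y}} r)"
proof -
  have AW: "A \<subseteq> W" "finite W" using A sk nside_subset by (auto simp: min_side_def skew_def)
  have cC: "6 \<le> card C" using c c2 CA AW by (simp add: card_Diff_subset finite_subset)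
  obtain x' where x': "A = {x, x'}" "x' \<noteq> x" using c2 x by (auto simp: card_2_iff)
  have sC: "side W r C" using C by (simp add: min_side_def nside_def)
  obtain y where y: "y \<in> C" "y \<noteq> o'" "\<And>q. q \<in> C \<Longrightarrow> q \<noteq> y \<Longrightarrow> \<not> side W (flip {{x,y}} r) {x, q}"
    using ex_good_vertex[OF sk CA sC x' AW(1), of o'] cC by auto
  have "prime W (flip {{x,y}} r)" unfolding prime_def
  proof (intro allI notI)
    fix M assume M: "nside W (flip {{x,y}} r) M"
    show False
    proof (cases "x \<in> M \<longleftrightarrow> y \<in> M")
      case False
      then show ?thesis using two_blocks_new_side[OF sk A C CA x(1) y(1) M] y cC by auto
    next
      case True
      have M': "nside W r M" using nside_flip[of "{{x,y}}" M W r] M True by auto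
      have Mc: "nside W r (W - M)" using nside_compl[OF sk M'] .
      have MW: "M \<subseteq> W" using nside_subset[OF M'] .
      have c5: "5 \<le> card W" using c by simp
      have one: False if N: "nside W r N" "x \<in> N" "y \<in> N" for N
      proof -
        have "\<not> C \<subseteq> N"
        proof
          assume "C \<subseteq> N"
          then have "W - N \<subseteq> A" using CA AW by blast
          then have "W - N = A" using nside_compl[OF sk N(1)] A unfolding min_side_def by blast
          then show False using x N by blast
        qed
        then obtain z where z: "z \<in> C" "z \<notin> N" by blast
        show False using nside_two_blocks[OF sk A C CA c5 N(1) x(1) N(2) z] N y CA by blast
      qed
      show False using one[OF M'] one[OF Mc] True x y CA AW by blast
    qed
  qed
  then show ?thesis using that y by blast
qed

text \<open>Since every \<open>nside\<close> separates \<open>x\<close> and \<open>y\<close>, a set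
  containing both can be a side only if at most one point is missing. Thus the union of the two
  blocks is no side, or all of \<open>W\<close>, or all but one point \<open>w\<close>. In the
  second case an end of the arc may have to be moved; in the third \<open>w\<close> is the point to
  switch at.\<close>

lemma one_flip_prime:
  assumes sk: "skew W r" and c: "8 \<le> card W" and S0: "nside W r S0"
    and xy: "x \<in> W" "y \<in> W" "x \<noteq> o'" "y \<noteq> o'"
    and sep: "\<And>S. nside W r S \<Longrightarrow> (x \<in> S) \<noteq> (y \<in> S)"
  obtains p q where "p \<in> W" "q \<in> W" "p \<noteq> o'" "q \<noteq> o'" "p \<noteq> q" "prime W (flip {{p,q}} r)"
proof -
  have "\<exists>A. min_side W r A \<and> x \<in> A \<and> y \<notin> A" if "x \<in> W" and sep: "\<And>S. nside W r S \<Longrightarrow> (x \<in> S) \<noteq> (y \<in> S)" for x y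
  proof -
    obtain S where S: "nside W r S" "y \<notin> S"
      using S0 nside_compl[OF sk S0] by blast
    obtain A where "min_side W r A" "A \<subseteq> S" using ex_min_side[OF sk S(1)] .
    then show ?thesis using sep[of A] S(2) unfolding min_side_def by blast
  qed
  from this[of x y] this[of y x] obtain A C where
    A: "min_side W r A" "x \<in> A" "y \<notin> A" and C: "min_side W r C" "y \<in> C" "x \<notin> C"
    using sep xy by metis
  have sA: "side W r A" "2 \<le> card A" and sC: "side W r C" "2 \<le> card C"
    using A C by (auto simp: min_side_def nside_def)
  have fW: "finite W" using sk by (simp add: skew_def)
  have ne: "x \<noteq> y" using A by blast
  have sub: "A \<subseteq> W" "C \<subseteq> W" using side_subset sA sC by blast+
  have triv: "card (W - B) \<le> 1" if B: "side W r B" "x \<in> B" "y \<in> B" for B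
  proof -
    have "card {x, y} \<le> card B" using B finite_sideD[OF sk B(1)] by (intro card_mono) auto
    then have "2 \<le> card B" using ne by simp
    then show ?thesis using sep[of B] B unfolding nside_def by force
  qed
  consider "\<not> side W r (A \<union> C)" | "side W r (A \<union> C)" "A \<union> C = W" | "side W r (A \<union> C)" "A \<union> C \<noteq> W" by blast
  then show ?thesis
  proof cases
    case 1
    have "prime W (flip {{x,y}} r)" unfolding prime_def
      using no_new_side_Un[OF sk A(1) C(1) A(2) C(2) 1] sep by blast
    then show ?thesis using that xy ne by blast
  next
    case 2
    have CA: "C = W - A" using min_side_compl[OF sk A(1) C(1) 2(2)] .
    have AC: "A = W - C" using CA sub by blast
    consider "card A = 2" | "card C = 2" | "card A \<noteq> 2" "card C \<noteq> 2" by blast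
    then show ?thesis
    proof cases
      case 1
      obtain q where "q \<in> C" "q \<noteq> o'" "prime W (flip {{x,q}} r)"
        using two_blocks_prime[OF sk A(1) C(1) CA c A(2) xy(3) 1] .
      then show ?thesis using that[of x q] xy C sub by blast
    next
      case 2
      obtain q where "q \<in> A" "q \<noteq> o'" "prime W (flip {{y,q}} r)"
        using two_blocks_prime[OF sk C(1) A(1) AC c C(2) xy(4) 2] .
      then show ?thesis using that[of y q] xy A sub by blast
    next
      case 3
      have "prime W (flip {{x,y}} r)" unfolding prime_def
      proof (intro allI notI)
        fix M assume M: "nside W (flip {{x,y}} r) M"
        show False
        proof (cases "x \<in> M \<longleftrightarrow> y \<in> M")
          case True
          then have "nside W r M" using nside_flip[of "{{x,y}}" M W r] M by auto
          then show ?thesis using sep True by blast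
        next
          case False
          then show ?thesis using two_blocks_new_side[OF sk A(1) C(1) CA A(2) C(2) M] 3 by auto
        qed
      qed
      then show ?thesis using that xy ne by blast
    qed
  next
    case 3
    \<comment> \<open>Overlapping blocks are two pairs, so the union has at most three points and
      \<open>W\<close> at most four.\<close>
    have dis: "A \<inter> C = {}"
    proof (rule ccontr)
      assume "A \<inter> C \<noteq> {}"
      then obtain w where "w \<in> A" "w \<in> C" by blast
      then obtain p q where "A = {p, w}" "C = {w, q}"
        using min_side_Int[OF sk A(1) C(1), of w] A C by metis
      then have "card (A \<union> C) \<le> 3" by (simp add: card_insert_if)
      moreover have "card W = card (A \<union> C) + card (W - (A \<union> C))"
        using fW sub by (metis card_Diff_subset card_mono finite_subset le_add_diff_inverse sup.boundedI)
      ultimately show False using triv[OF 3(1)] A C c by auto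
    qed
    obtain w where w: "w \<in> W" "w \<notin> A" "w \<notin> C" using 3(2) sub by blast
    \<comment> \<open>Such a set contains \<open>x\<close> and \<open>y\<close> and misses the two
      points \<open>v\<close> and \<open>w\<close>, so \<open>triv\<close> forbids it.\<close>
    have no: "\<not> side W r (insert u D)"
      if H: "insert u D \<subseteq> W" "{x, y} \<subseteq> insert u D" "v \<in> W" "v \<notin> insert u D" "w \<notin> insert u D" "v \<noteq> w" for u v D
    proof
      assume s: "side W r (insert u D)"
      have "card {v, w} \<le> card (W - insert u D)" using H fW w by (intro card_mono) auto
      then show False using triv[OF s] H by auto
    qed
    obtain x' where x': "x' \<in> A" "x' \<noteq> x" using card_ge2E[OF sA(2) A(2)] by blast
    obtain y' where y': "y' \<in> C" "y' \<noteq> y" using card_ge2E[OF sC(2) C(2)] by blast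
    have nx: "\<not> side W r (insert x C)"
      by (rule no[where v = x']) (use x' w A C sub dis xy in blast)+
    have ny: "\<not> side W r (insert y A)"
      by (rule no[where v = y']) (use y' w A C sub dis xy in blast)+
    have "prime W (flip {{x,y}} r)" unfolding prime_def
      using no_new_side[OF sk A(1) C(1) dis A(2) C(2) w nx ny] sep by blast
    then show ?thesis using that xy ne by blast
  qed
qed

section \<open>Three points\<close>

text \<open>The arc is reversed between \<open>A\<close> and \<open>C\<close>, with ends chosen so
  that neither \<open>insert x C\<close> nor \<open>insert y A\<close> is a side; any point of
  \<open>B\<close> serves as the point outside. What survives are old sides not separating
  \<open>x\<close> from \<open>y\<close>, and these are \<open>B\<close> and its complement.\<close>

lemma three_blocks:
  assumes sk: "skew W r" and A: "min_side W r A" and B: "min_side W r B" and C: "min_side W r C"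
    and d: "A \<inter> B = {}" "A \<inter> C = {}" "B \<inter> C = {}" and W: "A \<union> B \<union> C = W"
    and c3: "3 \<le> card C" and oA: "o' \<notin> A"
  obtains p q where "p \<in> W" "q \<in> W" "p \<noteq> o'" "q \<noteq> o'" "p \<noteq> q"
    "\<And>M. nside W (flip {{p,q}} r) M \<Longrightarrow> M = B \<or> M = W - B"
proof -
  have sA: "side W r A" "2 \<le> card A" and sB: "side W r B" "2 \<le> card B" and sC: "side W r C"
    using A B C by (auto simp: min_side_def nside_def)
  have ne: "A \<noteq> {}" "B \<noteq> {}" "C \<noteq> {}" using sA(2) sB(2) c3 by auto
  obtain b c where b: "b \<in> B" and c: "c \<in> C" using ne by blast
  have minA: "S = A" if "nside W r S" "S \<subseteq> A" for S using A that by (simp add: min_side_def)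
  have minB: "S = B" if "nside W r S" "S \<subseteq> B" for S using B that by (simp add: min_side_def)
  have minC: "S = C" if "nside W r S" "S \<subseteq> C" for S using C that by (simp add: min_side_def)
  \<comment> \<open>If every choice failed, \<open>A\<close> would be a pair, and \<open>A\<close>,
    \<open>insert x C\<close> and the complement of \<open>insert x' C\<close> would split
    \<open>x\<close>, \<open>x'\<close>, \<open>c\<close>, \<open>b\<close> in all three
    ways.\<close>
  have "\<exists>x\<in>A. \<not> side W r (insert x C)"
  proof (rule ccontr)
    assume "\<not> ?thesis"
    then have all: "side W r (insert x C)" if "x \<in> A" for x using that by blast
    obtain x where x: "x \<in> A" using ne by blast
    obtain x' where x': "x' \<in> A" "x' \<noteq> x" using card_ge2E[OF sA(2) x] by blast
    have "side W r (A - insert x C)" using side_diff[OF sk sA(1) all[OF x], of c] c d by blast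
    then have "A - insert x C = {x'}" using min_side_sub[OF sk A, of "A - insert x C" x'] x x' d by blast
    then have "A = {x, x'}" using x d by blast
    then show False
      using no_three_splits[OF sk sA(1) all[OF x] side_compl[OF sk all[OF x'(1)]], of x x' c b]
        x x' b c d W by blast
  qed
  then obtain x where x: "x \<in> A" "\<not> side W r (insert x C)" by blast
  have "C \<noteq> {o'}" using c3 by auto
  then obtain y where y: "y \<in> C" "y \<noteq> o'" using ne by blast
  \<comment> \<open>Here the three points of \<open>C\<close> matter: \<open>C - {y}\<close> keeps
    at least two, so by minimality it is no side.\<close>
  have Cne: "C - {y} \<noteq> {z}" for z
  proof
    assume "C - {y} = {z}"
    then have "C = {y, z}" using y by blast
    then show False using c3 by (simp add: card_insert_if split: if_splits)
  qed
  have y': "y' \<in> C - {y} \<Longrightarrow> \<not> side W r (C - {y})" for y'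
    using min_side_sub[OF sk C, of "C - {y}" y'] y Cne by blast
  have "2 \<le> card C" using c3 by simp
  then obtain y' where "y' \<in> C - {y}" using card_ge2E[OF _ y(1)] by blast
  then have nC: "\<not> side W r (C - {y})" using y' by blast
  have ny: "\<not> side W r (insert y A)"
  proof
    assume "side W r (insert y A)"
    then have "side W r (C - insert y A)" using side_diff[OF sk sC, of "insert y A" x] x d by blast
    moreover have "C - insert y A = C - {y}" using d by blast
    ultimately show False using nC by simp
  qed
  have bw: "b \<in> W" "b \<notin> A" "b \<notin> C" using b d W by blast+
  \<comment> \<open>A side around \<open>x\<close> and \<open>y\<close> that does not contain
    \<open>C\<close> would make \<open>C - {y}\<close> a side, and one that does not contain
    \<open>A\<close> would make \<open>insert x C\<close> a side. So its complement lies in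
    \<open>B\<close> and equals \<open>B\<close>.\<close>
  have key: "S = W - B" if S: "nside W r S" "x \<in> S" "y \<in> S" for S
  proof -
    have sS: "side W r S" "S \<subseteq> W" using S(1) nside_subset by (auto simp: nside_def)
    have Sc: "nside W r (W - S)" using nside_compl[OF sk S(1)] .
    have CS: "C \<subseteq> S"
    proof (rule ccontr)
      assume n: "\<not> C \<subseteq> S"
      have "\<not> W - S \<subseteq> C" using minC[OF Sc] S(3) y by blast
      then obtain w where w: "w \<in> W" "w \<notin> S" "w \<notin> C" by blast
      have "S \<inter> C = {y}"
        using min_side_sub[OF sk C side_inter[OF sS(1) sC w], of y] S y n by blast
      then have "C - S = C - {y}" by blast
      moreover have "side W r (C - S)" using side_diff[OF sk sC sS(1) S(2)] x d by blast
      ultimately show False using nC by simp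
    qed
    have "\<not> W - S \<subseteq> A" using minA[OF Sc] S x by blast
    then obtain w where w: "w \<in> B" "w \<notin> S" using CS W by blast
    have wn: "w \<in> W" "w \<notin> A" "w \<notin> W - B" using w W d by blast+
    have AS: "A \<subseteq> S"
    proof (rule ccontr)
      assume n: "\<not> A \<subseteq> S"
      have "S \<inter> A = {x}"
        using min_side_sub[OF sk A side_inter[OF sS(1) sA(1) wn(1) w(2) wn(2)], of x] S x n by blast
      then have "S \<inter> (W - B) = insert x C" using CS W d sS by blast
      then show False using side_inter[OF sS(1) side_compl[OF sk sB(1)] wn(1) w(2) wn(3)] x by simp
    qed
    have "W - S = B" using minB[OF Sc] CS AS W by blast
    then show ?thesis using sS by blast
  qed
  have xyW: "x \<in> W" "y \<in> W" using x y W by blast+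
  show ?thesis
  proof (rule that[of x y])
    show "x \<in> W" "y \<in> W" "x \<noteq> o'" "y \<noteq> o'" "x \<noteq> y" using x y oA d W by blast+
    fix M assume M: "nside W (flip {{x,y}} r) M"
    note n = no_new_side[OF sk A C d(2) x(1) y(1) bw x(2) ny M]
    show "M = B \<or> M = W - B"
    proof (cases "x \<in> M")
      case True then show ?thesis using key[OF n(1)] n(2) by blast
    next
      case False
      then have "W - M = W - B" using key[OF nside_compl[OF sk n(1)]] n(2) xyW by blast
      then show ?thesis using nside_subset[OF n(1)] W by blast
    qed
  qed
qed

text \<open>The first of two flips: afterwards one pair \<open>u\<close>, \<open>v\<close> separates
  all sides, as \<open>one_flip_prime\<close> requires. Joining \<open>a\<close> and
  \<open>b\<close> works if their blocks overlap or have no side as union, because a surviving side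
  keeps \<open>a\<close> and \<open>b\<close> together and must part them from \<open>c\<close>.
  Otherwise the three blocks are disjoint with sides as unions; they fill \<open>W\<close>, and
  among eight points one block has three.\<close>

lemma three_points:
  assumes sk: "skew W r" and c: "8 \<le> card W" and oW: "o' \<in> W"
    and X: "X = {x, y, z}" "x \<noteq> y" "x \<noteq> z" "y \<noteq> z" "X \<subseteq> W - {o'}"
    and hit: "\<And>S. nside W r S \<Longrightarrow> S \<inter> X \<noteq> {}"
    and D: "\<And>v. v \<in> X \<Longrightarrow> min_side W r (D v)" "\<And>v. v \<in> X \<Longrightarrow> D v \<inter> X = {v}"
  obtains p q u v where "p \<in> W" "q \<in> W" "p \<noteq> o'" "q \<noteq> o'" "p \<noteq> q" "u \<in> W" "v \<in> W" "u \<noteq> o'" "v \<noteq> o'"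
    "\<And>S. nside W (flip {{p,q}} r) S \<Longrightarrow> (u \<in> S) \<noteq> (v \<in> S)"
proof -
  note goal = that
  have i: "v \<in> D u \<longleftrightarrow> v = u" if "u \<in> X" "v \<in> X" for u v
    using D(2)[OF that(1)] that(2) by (metis IntD1 IntI singletonD singletonI)
  have pair: thesis
    if abc: "X = {a, b, c}" "a \<noteq> b" "a \<noteq> c" "b \<noteq> c"
      and h: "\<not> side W r (D a \<union> D b) \<or> D a \<inter> D b \<noteq> {}" for a b c
  proof -
    have Da: "min_side W r (D a)" "min_side W r (D b)" "a \<in> D a" "b \<in> D b" "D a \<noteq> D b" "a \<notin> D b" "b \<notin> D a"
    proof -
      have ab: "a \<in> X" "b \<in> X" using abc(1) by blast+
      show "min_side W r (D a)" "min_side W r (D b)" using D(1) ab by blast+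
      show "a \<in> D a" "b \<in> D b" "a \<notin> D b" "b \<notin> D a" using ab abc(2) i by simp_all
      then show "D a \<noteq> D b" by blast
    qed
    have *: "nside W r M \<and> (a \<in> M \<longleftrightarrow> b \<in> M)" if M: "nside W (flip {{a,b}} r) M" for M
    proof (cases "side W r (D a \<union> D b)")
      case False
      then show ?thesis using no_new_side_Un[OF sk Da(1,2,3,4) _ M] by blast
    next
      case True
      then obtain w where w: "w \<in> D a" "w \<in> D b" using h by blast
      obtain p q where pq: "D a = {p, w}" "D b = {w, q}" "p \<noteq> w" "q \<noteq> w" "p \<noteq> q"
        using min_side_Int[OF sk Da(1,2,5) w] by metis
      then have "p = a" "q = b" using Da by auto
      then have "side W r {a, w}" "side W r {w, b}" "a \<noteq> w" "b \<noteq> w"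
        using Da pq by (auto simp: min_side_def nside_def)
      then show ?thesis using no_new_side_twins[OF sk _ _ abc(2) _ _ M] by blast
    qed
    have "(a \<in> M) \<noteq> (c \<in> M)" if M: "nside W (flip {{a,b}} r) M" for M
    proof -
      have n: "nside W r M" "a \<in> M \<longleftrightarrow> b \<in> M" using *[OF M] by blast+
      have "M \<inter> {a, b, c} \<noteq> {}" "(W - M) \<inter> {a, b, c} \<noteq> {}"
        using hit[OF n(1)] hit[OF nside_compl[OF sk n(1)]] abc(1) by simp_all
      then show ?thesis using n(2) by blast
    qed
    moreover have "{a, b, c} \<subseteq> W - {o'}" using X(5) abc(1) by simp
    ultimately show thesis using goal[of a b a c] abc(2) by blast
  qed
  show thesis
  proof (cases "(\<not> side W r (D x \<union> D y) \<or> D x \<inter> D y \<noteq> {}) \<or> (\<not> side W r (D x \<union> D z) \<or> D x \<inter> D z \<noteq> {})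
      \<or> (\<not> side W r (D y \<union> D z) \<or> D y \<inter> D z \<noteq> {})")
    case True
    moreover have "X = {x, z, y}" "X = {y, z, x}" unfolding X(1) by blast+
    ultimately show thesis
      using pair[OF X(1-4)] pair[of x z y] pair[of y z x] X(2-4) not_sym by metis
  next
    case False
    then have s: "side W r (D x \<union> D y)" "side W r (D x \<union> D z)" "side W r (D y \<union> D z)"
      and d: "D x \<inter> D y = {}" "D x \<inter> D z = {}" "D y \<inter> D z = {}" by blast+
    have DX: "min_side W r (D x)" "min_side W r (D y)" "min_side W r (D z)"
      "x \<in> D x" "y \<in> D y" "z \<in> D z"
      using D(1)[of x] D(1)[of y] D(1)[of z] i[of x x] i[of y y] i[of z z] unfolding X(1) by simp_all
    have sub: "D x \<subseteq> W" "D y \<subseteq> W" "D z \<subseteq> W" using DX nside_subset by (auto simp: min_side_def)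
    \<comment> \<open>A point outside all blocks would, together with \<open>x\<close>,
      \<open>y\<close> and \<open>z\<close>, be split in all three ways by the pairwise
      unions.\<close>
    have W: "D x \<union> D y \<union> D z = W"
    proof (rule ccontr)
      assume "\<not> ?thesis"
      then obtain w where w: "w \<in> W" "w \<notin> D x" "w \<notin> D y" "w \<notin> D z" using sub by blast
      then show False
        using no_three_splits[OF sk s(1,2) side_compl[OF sk s(3)], of x y z w] d DX X by blast
    qed
    have f: "finite W" using sk by (simp add: skew_def)
    have "card W \<le> card (D x) + card (D y) + card (D z)"
      using W card_Un_le[of "D x \<union> D y" "D z"] card_Un_le[of "D x" "D y"] by simp
    then have "3 \<le> card (D x) \<or> 3 \<le> card (D y) \<or> 3 \<le> card (D z)" using c by linarith
    moreover have main: thesis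
      if m: "min_side W r A" "min_side W r B" "min_side W r C" "3 \<le> card C" "A \<inter> B = {}" "A \<inter> C = {}"
        "B \<inter> C = {}" "A \<union> B \<union> C = W" for A B C
    proof -
      have fin: thesis
        if m: "min_side W r A" "min_side W r B" "min_side W r C" "3 \<le> card C" "A \<inter> B = {}" "A \<inter> C = {}"
        "B \<inter> C = {}" "A \<union> B \<union> C = W" "o' \<notin> A" for A B
      proof -
        have cc: "2 \<le> card B" using m by (auto simp: min_side_def nside_def)
        then have "B \<noteq> {}" "B \<noteq> {o'}" by auto
        then obtain u where u: "u \<in> B" "u \<noteq> o'" by blast
        have "C \<noteq> {}" "C \<noteq> {o'}" using m(4) by auto
        then obtain v where v: "v \<in> C" "v \<noteq> o'" by blast
        obtain p q where pq: "p \<in> W" "q \<in> W" "p \<noteq> o'" "q \<noteq> o'" "p \<noteq> q"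
          "\<And>M. nside W (flip {{p,q}} r) M \<Longrightarrow> M = B \<or> M = W - B"
          using three_blocks[OF sk m(1,2,3,5,6,7,8,4,9)] by metis
        have uv: "u \<in> W" "v \<in> W" "v \<notin> B" using u v m by blast+
        have "(u \<in> M) \<noteq> (v \<in> M)" if "nside W (flip {{p,q}} r) M" for M
          using pq(6)[OF that] u uv by blast
        then show thesis using goal[OF pq(1-5) uv(1,2) u(2) v(2)] by blast
      qed
      have "o' \<notin> A \<or> o' \<notin> B" "B \<inter> A = {}" "B \<union> A \<union> C = W" using m by blast+
      then show thesis using fin[OF m] fin[OF m(2,1,3,4) _ m(7,6)] by blast
    qed
    moreover have "D y \<union> D z \<union> D x = W" "D x \<union> D z \<union> D y = W" "D y \<inter> D x = {}" "D z \<inter> D x = {}" "D z \<inter> D y = {}"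
      using W d by blast+
    ultimately show thesis
      using main[OF DX(1,2,3) _ d(1,2,3) W] main[OF DX(2,3,1)] main[OF DX(1,3,2)] d by blast
  qed
qed

section \<open>Matchings\<close>

definition perfect_matching :: "'b set \<Rightarrow> 'b set set \<Rightarrow> bool" where
  "perfect_matching Y m \<longleftrightarrow> (\<forall>e\<in>m. card e = 2) \<and> pairwise disjnt m \<and> \<Union>m = Y"

lemma perfect_matchingD:
  assumes "perfect_matching Y m" "e \<in> m"
  shows "card e = 2" "e \<subseteq> Y" "f \<in> m \<Longrightarrow> e \<noteq> f \<Longrightarrow> e \<inter> f = {}"
proof -
  show "card e = 2" "e \<subseteq> Y" using assms unfolding perfect_matching_def by blast+
  show "e \<inter> f = {}" if "f \<in> m" "e \<noteq> f"
    using assms that unfolding perfect_matching_def pairwise_def disjnt_def by metis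
qed

lemma perfect_matching_exists:
  assumes "finite Y" "even (card Y)" shows "\<exists>m. perfect_matching Y m"
  using assms
proof (induction "card Y" arbitrary: Y rule: less_induct)
  case less
  show ?case
  proof (cases "Y = {}")
    case True
    then have "perfect_matching Y {}" by (simp add: perfect_matching_def)
    then show ?thesis by blast
  next
    case False
    then obtain a where a: "a \<in> Y" by blast
    have "2 \<le> card Y" using less.prems False
      by (metis card_0_eq dvd_imp_le less_one linorder_not_le not_less_zero nat_neq_iff)
    then obtain b where b: "b \<in> Y" "b \<noteq> a" using card_ge2E[OF _ a] by blast
    let ?Y = "Y - {a, b}"
    have c: "card ?Y = card Y - 2" using a b less.prems by (simp add: card_Diff_subset)
    have "card ?Y < card Y" "even (card ?Y)" using c \<open>2 \<le> card Y\<close> less.prems by auto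
    then obtain m where m: "perfect_matching ?Y m" using less.hyps[of ?Y] less.prems by blast
    have "pairwise disjnt (insert {a, b} m)"
      using m unfolding perfect_matching_def pairwise_insert disjnt_def by blast
    moreover have "\<Union>(insert {a, b} m) = Y" using m a b unfolding perfect_matching_def by auto
    ultimately have "perfect_matching Y (insert {a, b} m)"
      using m b unfolding perfect_matching_def by auto
    then show ?thesis by blast
  qed
qed

lemma perfect_matching_swap:
  assumes m: "perfect_matching Y m" and e: "{a, b} \<in> m" "{c, d} \<in> m"
    and dist: "a \<noteq> b" "a \<noteq> c" "a \<noteq> d" "b \<noteq> c" "b \<noteq> d" "c \<noteq> d"
  shows "perfect_matching Y (m - {{a, b}, {c, d}} \<union> {{a, c}, {b, d}})"
proof -
  let ?n = "m - {{a, b}, {c, d}}"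
  have p: "e \<inter> f = {}" if "e \<in> m" "f \<in> m" "e \<noteq> f" for e f
    using perfect_matchingD(3)[OF m] that by blast
  have dj: "e \<inter> {a, c} = {}" "e \<inter> {b, d} = {}" if "e \<in> ?n" for e
    using p[of e "{a, b}"] p[of e "{c, d}"] that e by blast+
  have acbd: "{a, c} \<inter> {b, d} = {}" using dist by blast
  have "pairwise disjnt ?n"
    unfolding pairwise_def disjnt_def using p by blast
  then have "pairwise disjnt (?n \<union> {{a, c}, {b, d}})"
    unfolding Un_insert_right Un_empty_right pairwise_insert disjnt_def
    using dj acbd by (auto simp: Int_commute)
  moreover have "\<Union>(m - {{a, b}, {c, d}} \<union> {{a, c}, {b, d}}) = \<Union>m" using e by blast
  moreover have "card {a, c} = 2" "card {b, d} = 2" using dist by auto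
  ultimately show ?thesis using m unfolding perfect_matching_def by auto
qed

definition unsplit :: "'b set \<Rightarrow> 'b set set \<Rightarrow> bool" where
  "unsplit S m \<longleftrightarrow> (\<forall>e\<in>m. e \<subseteq> S \<or> e \<inter> S = {})"

text \<open>What is kept of the optimality of a matching: a side with a pair inside and a pair
  outside also splits some pair.\<close>

definition exchanged :: "'b set \<Rightarrow> ('b \<Rightarrow> 'b \<Rightarrow> bool) \<Rightarrow> 'b set set \<Rightarrow> bool" where
  "exchanged W r m \<longleftrightarrow>
     (\<forall>S. nside W r S \<and> unsplit S m \<longrightarrow> \<not> (\<exists>e\<in>m. \<exists>f\<in>m. e \<subseteq> S \<and> f \<inter> S = {}))"

lemma exchangedD:
  assumes "exchanged W r m" "nside W r S" "unsplit S m" "e \<in> m" "f \<in> m" "e \<subseteq> S" "f \<inter> S = {}"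
  shows False
  using assms unfolding exchanged_def by blast

text \<open>A perfect matching separating as many sides as possible: were there a pair inside and a
  pair outside of a side not separated at all, then by the lemma on three splits one of the two
  ways of exchanging the ends of these pairs would separate more sides.\<close>

lemma matching_exchange:
  assumes sk: "skew W r" and Y: "Y \<subseteq> W" "even (card Y)"
  obtains m where "perfect_matching Y m" "exchanged W r m"
proof -
  have fW: "finite W" using sk by (simp add: skew_def)
  define sep where "sep m = {S. nside W r S \<and> (\<exists>g\<in>m. \<not> g \<subseteq> S \<and> g \<inter> S \<noteq> {})}" for m
  have sepW: "sep m \<subseteq> Pow W" for m using nside_subset by (auto simp: sep_def)
  have fsep: "finite (sep m)" for m using sepW fW by (meson finite_Pow_iff finite_subset)
  have bound: "card (sep m) \<le> card (Pow W)" for m using sepW fW by (simp add: card_mono)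
  obtain m0 where "perfect_matching Y m0"
    using perfect_matching_exists finite_subset[OF Y(1) fW] Y(2) by blast
  then obtain m where m: "perfect_matching Y m"
    and max: "\<And>m'. perfect_matching Y m' \<Longrightarrow> card (sep m') \<le> card (sep m)"
    using ex_has_greatest_nat[of "perfect_matching Y" m0 "\<lambda>m. card (sep m)" "Suc (card (Pow W))"] bound
    by (auto simp: less_Suc_eq_le)
  have main: "\<exists>g\<in>m. \<not> g \<subseteq> S \<and> g \<inter> S \<noteq> {}"
    if S: "nside W r S" and e: "e \<in> m" "f \<in> m" "e \<subseteq> S" "f \<inter> S = {}" for S e f
  proof (rule ccontr)
    assume uns: "\<not> ?thesis"
    have "card e = 2" "card f = 2" using perfect_matchingD(1)[OF m] e by blast+
    then obtain a b c d where ab: "e = {a, b}" "a \<noteq> b" and cd: "f = {c, d}" "c \<noteq> d"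
      by (meson card_2_iff)
    have abW: "{a, b, c, d} \<subseteq> W" using m e ab cd Y unfolding perfect_matching_def by blast
    have inS: "a \<in> S" "b \<in> S" "c \<notin> S" "d \<notin> S" using e ab cd by auto
    have step: "\<exists>R. side W r R \<and> a \<in> R \<and> p \<in> R \<and> b \<notin> R \<and> q \<notin> R"
      if pq: "{c, d} = {p, q}" "p \<noteq> q" for p q
    proof -
      define m' where "m' = m - {{a, b}, {p, q}} \<union> {{a, p}, {b, q}}"
      have n: "a \<noteq> p" "a \<noteq> q" "b \<noteq> p" "b \<noteq> q" "p \<notin> S" "q \<notin> S" using inS pq by (auto simp: doubleton_eq_iff)
      have "perfect_matching Y m'"
        using perfect_matching_swap[OF m, of a b p q] e ab cd pq n unfolding m'_def by metis
      then have le: "card (sep m') \<le> card (sep m)" by (rule max)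
      have sep': "R \<in> sep m'" if "nside W r R" "g \<in> m'" "\<not> g \<subseteq> R" "g \<inter> R \<noteq> {}" for R g
        using that unfolding sep_def by blast
      have new: "{a, p} \<in> m'" "{b, q} \<in> m'" by (simp_all add: m'_def)
      have "S \<in> sep m'" by (rule sep'[OF S new(1)]) (use inS n in blast)+
      moreover have "S \<notin> sep m" using uns by (auto simp: sep_def)
      \<comment> \<open>The exchange gains \<open>S\<close>, so by maximality it loses some
        \<open>R\<close>. That \<open>R\<close> splits an old pair but neither of the new ones,
        hence it parts \<open>{a, p}\<close> from \<open>{b, q}\<close>.\<close>
      ultimately have "\<not> sep m \<subseteq> sep m'" using le fsep
        by (metis card_subset_eq card_mono le_antisym)
      then obtain R where R: "R \<in> sep m" "R \<notin> sep m'" by blast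
      then have nR: "nside W r R" by (simp add: sep_def)
      have n1: "a \<in> R \<longleftrightarrow> p \<in> R" "b \<in> R \<longleftrightarrow> q \<in> R"
        using sep'[OF nR new(1)] sep'[OF nR new(2)] R(2) by blast+
      from R(1) obtain g where g: "g \<in> m" "\<not> g \<subseteq> R" "g \<inter> R \<noteq> {}" by (auto simp: sep_def)
      have "g \<notin> m'" using R(2) sep'[OF nR _ g(2,3)] by blast
      then have "g = {a, b} \<or> g = {p, q}" using g(1) by (simp add: m'_def)
      then have "(a \<in> R) \<noteq> (b \<in> R)" using g n1 by blast
      then show ?thesis
      proof (cases "a \<in> R")
        case True
        then show ?thesis using n1 \<open>(a \<in> R) \<noteq> (b \<in> R)\<close> nR unfolding nside_def by blast
      next
        case False
        have "side W r (W - R)" using side_compl[OF sk] nR unfolding nside_def by blast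
        then show ?thesis using n1 \<open>(a \<in> R) \<noteq> (b \<in> R)\<close> False abW pq by blast
      qed
    qed
    obtain R where R: "side W r R" "a \<in> R" "c \<in> R" "b \<notin> R" "d \<notin> R" using step[of c d] cd by blast
    obtain P where P: "side W r P" "a \<in> P" "d \<in> P" "b \<notin> P" "c \<notin> P"
      using step[of d c] cd by blast
    have "side W r S" using S by (simp add: nside_def)
    then show False using no_three_splits[OF sk _ R(1) P(1) abW] inS R P by blast
  qed
  have "exchanged W r m" unfolding exchanged_def
  proof (intro allI impI notI, elim conjE bexE)
    fix S e f assume H: "nside W r S" "unsplit S m" "e \<in> m" "f \<in> m" "e \<subseteq> S" "f \<inter> S = {}"
    show False using main[OF H(1,3-6)] H(2) unfolding unsplit_def by blast
  qed
  then show ?thesis using that m by blast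
qed

section \<open>Reversing the arcs of a matching one by one\<close>

lemma flip_insert: "e \<notin> m \<Longrightarrow> flip (insert e m) r = flip {e} (flip m r)"
  by (auto simp: flip_def fun_eq_iff)

lemma side_trivial: "skew W r \<Longrightarrow> A \<subseteq> W \<Longrightarrow> card (W - A) \<le> 1 \<Longrightarrow> side W r A"
proof -
  assume sk: "skew W r" and A: "A \<subseteq> W" "card (W - A) \<le> 1"
  have "finite (W - A)" using sk by (simp add: skew_def)
  then have "b = b'" if "b \<in> W - A" "b' \<in> W - A" for b b'
    using A(2) that card_le_Suc0_iff_eq by (metis One_nat_def)
  then show ?thesis using A(1) unfolding side_def by blast
qed

text \<open>Induction over the pairs. \<open>D v\<close> contains no end of a pair other than
  \<open>v\<close>, so reversals at other pairs leave it a side; as they create no sides, it also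
  stays minimal. Hence \<open>no_new_side_Un\<close> applies to the next pair.\<close>

lemma nside_flip_matching:
  assumes sk: "skew W r" and m: "finite m" "pairwise disjnt m" "\<And>e. e \<in> m \<Longrightarrow> card e = 2"
    and D: "\<And>x. x \<in> \<Union>m \<Longrightarrow> min_side W r (D x)" "\<And>x. x \<in> \<Union>m \<Longrightarrow> D x \<inter> \<Union>m = {x}"
    and n: "\<And>x y. {x, y} \<in> m \<Longrightarrow> \<not> side W r (D x \<union> D y)"
    and S: "nside W (flip m r) S"
  shows "nside W r S \<and> unsplit S m"
  using m D n S
proof (induction m arbitrary: S rule: finite_induct)
  case empty
  then show ?case by (simp add: flip_def[abs_def] unsplit_def)
next
  case (insert e m)
  let ?r = "flip m r"
  have sk': "skew W ?r" using skew_flip[OF sk] .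
  have em: "e \<inter> \<Union>m = {}"
    using insert.prems(1) insert.hyps(2) unfolding pairwise_insert disjnt_def by blast
  have IH: "nside W r S \<and> unsplit S m" if "nside W ?r S" for S
  proof (rule insert.IH)
    show "pairwise disjnt m" using insert.prems(1) by (simp add: pairwise_insert)
    show "D x \<inter> \<Union>m = {x}" if "x \<in> \<Union>m" for x using insert.prems(4)[of x] that by blast
  qed (use insert.prems that in auto)
  obtain x y where e: "e = {x, y}" "x \<noteq> y" using insert.prems(2)[of e] by (auto simp: card_2_iff)
  have minD: "min_side W ?r (D v)" if v: "v \<in> e" for v
  proof -
    have mv: "min_side W r (D v)" using insert.prems(3)[of v] v by blast
    have "D v \<inter> \<Union>(insert e m) = {v}" using insert.prems(4)[of v] v by blast
    then have "D v \<inter> g = {}" if "g \<in> m" for g using that em v by blast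
    then have "nside W ?r (D v)" using nside_flip[of m "D v" W r] mv unfolding min_side_def by blast
    then show ?thesis using IH mv unfolding min_side_def by blast
  qed
  have Dv: "v \<in> D v" if v: "v \<in> e" for v
  proof -
    have "v \<in> D v \<inter> \<Union>(insert e m)" using insert.prems(4)[of v] v by simp
    then show ?thesis by blast
  qed
  \<comment> \<open>A union that became a side would either be an \<open>nside\<close>, hence an old
    one, or miss at most one point, and such a set is a side of every skew relation.\<close>
  have ns: "\<not> side W ?r (D x \<union> D y)"
  proof
    assume s: "side W ?r (D x \<union> D y)"
    have c2: "2 \<le> card (D x)" using minD[of x] e by (auto simp: min_side_def nside_def)
    have "finite (D x \<union> D y)" using finite_sideD[OF sk' s] .
    then have "card (D x) \<le> card (D x \<union> D y)" by (intro card_mono) auto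
    then have "2 \<le> card (D x \<union> D y)" using c2 by simp
    moreover have "\<not> nside W ?r (D x \<union> D y)"
      using IH[of "D x \<union> D y"] insert.prems(5)[of x y] e by (auto simp: nside_def)
    ultimately have "card (W - (D x \<union> D y)) \<le> 1" using s unfolding nside_def by linarith
    then have "side W r (D x \<union> D y)" using side_trivial[OF sk side_subset[OF s]] by blast
    then show False using insert.prems(5)[of x y] e by simp
  qed
  have "nside W (flip {{x, y}} ?r) S" using insert.prems(6) insert.hyps(2) e flip_insert by metis
  then have "nside W ?r S" "x \<in> S \<longleftrightarrow> y \<in> S"
    using no_new_side_Un[OF sk' minD[of x] minD[of y] _ _ ns] Dv e by blast+
  then show ?case using IH e unfolding unsplit_def by blast
qed

definition arcs_off :: "'b set \<Rightarrow> 'b \<Rightarrow> 'b set set" where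
  "arcs_off W o' = {{p, q} | p q. p \<in> W - {o'} \<and> q \<in> W - {o'} \<and> p \<noteq> q}"

text \<open>Flipping a pair of \<open>E\<close> once more cancels it, so in that case it is removed
  instead of added.\<close>

lemma flip_more:
  assumes "E \<subseteq> arcs_off W o'" "finite E" "prime W (flip {{p, q}} (flip E r))"
    "p \<in> W" "q \<in> W" "p \<noteq> o'" "q \<noteq> o'" "p \<noteq> q"
  shows "\<exists>E' \<subseteq> arcs_off W o'. finite E' \<and> card E' \<le> Suc (card E) \<and> prime W (flip E' r)"
proof (cases "{p, q} \<in> E")
  case False
  have "{p, q} \<in> arcs_off W o'" using assms by (auto simp: arcs_off_def)
  then show ?thesis using assms flip_insert[OF False, of r]
    by (intro exI[of _ "insert {p, q} E"]) (auto simp: card_insert_if)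
next
  case True
  have "flip {{p, q}} (flip E r) = flip (E - {{p, q}}) r"
    using True by (auto simp: flip_def fun_eq_iff)
  moreover have "card (E - {{p, q}}) \<le> Suc (card E)"
    by (meson card_Diff1_le le_SucI)
  ultimately show ?thesis using assms by (intro exI[of _ "E - {{p, q}}"]) auto
qed

text \<open>The union meets \<open>X\<close> in \<open>x\<close> and \<open>y\<close> only, so it
  contains the pair \<open>{x, y}\<close>, avoids every other pair and splits none. With a second
  pair at hand, which \<open>4 \<le> card Y\<close> provides, this contradicts
  \<open>exchanged\<close>.\<close>

lemma not_side_matched_Un:
  assumes sk: "skew W r" and m: "perfect_matching Y m" "Y \<subseteq> X" "X \<subseteq> W" "4 \<le> card Y"
    and ex: "exchanged W r m"
    and D: "\<And>x. x \<in> X \<Longrightarrow> min_side W r (D x)" "\<And>x. x \<in> X \<Longrightarrow> D x \<inter> X = {x}"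
    and xy: "{x, y} \<in> m"
  shows "\<not> side W r (D x \<union> D y)"
proof
  assume s: "side W r (D x \<union> D y)"
  have fW: "finite W" using sk by (simp add: skew_def)
  have xyY: "x \<in> Y" "y \<in> Y" using m(1) xy unfolding perfect_matching_def by blast+
  have int: "(D x \<union> D y) \<inter> X = {x, y}" using D(2)[of x] D(2)[of y] xyY m(2) by blast
  have "card {x, y} < card Y" using m(4) by (simp add: card_insert_if)
  then have "\<not> Y \<subseteq> {x, y}" by (metis card_mono finite.emptyI finite.insertI not_le)
  then obtain z where z: "z \<in> Y" "z \<notin> {x, y}" by blast
  then obtain f where f: "f \<in> m" "z \<in> f" using m(1) unfolding perfect_matching_def by blast
  have "f \<noteq> {x, y}" using f z by blast
  then have "f \<inter> {x, y} = {}" using perfect_matchingD(3)[OF m(1) f(1) xy] by blast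
  moreover have fY: "f \<subseteq> Y" using perfect_matchingD(2)[OF m(1) f(1)] .
  ultimately have f0: "f \<inter> (D x \<union> D y) = {}" using int m(2) by blast
  have c2: "2 \<le> card (D x)" using D(1)[of x] xyY m(2) by (auto simp: min_side_def nside_def)
  have "card (D x) \<le> card (D x \<union> D y)" using finite_sideD[OF sk s] by (intro card_mono) auto
  moreover have "card f \<le> card (W - (D x \<union> D y))" using f0 fY m(2,3) fW by (intro card_mono) auto
  moreover have "card f = 2" using perfect_matchingD(1)[OF m(1) f(1)] .
  ultimately have "nside W r (D x \<union> D y)" using s c2 unfolding nside_def by linarith
  moreover have "{x, y} \<subseteq> D x \<union> D y" using int by blast
  ultimately have "\<not> unsplit (D x \<union> D y) m" using exchangedD[OF ex _ _ xy f(1) _ f0] by blast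
  then obtain g where g: "g \<in> m" "\<not> g \<subseteq> D x \<union> D y" "g \<inter> (D x \<union> D y) \<noteq> {}"
    unfolding unsplit_def by blast
  have "g \<subseteq> X" using perfect_matchingD(2)[OF m(1) g(1)] m(2) by blast
  then have "g \<inter> {x, y} \<noteq> {}" "g \<noteq> {x, y}" using g int by blast+
  then show False using perfect_matchingD(3)[OF m(1) g(1) xy] by blast
qed

lemma card_perfect_matching:
  assumes "perfect_matching Y m" "finite Y" shows "finite m" "card Y = 2 * card m"
proof -
  show f: "finite m" using assms unfolding perfect_matching_def by (metis finite_UnionD)
  have "card (\<Union>m) = sum card m"
  proof (rule card_Union_disjoint)
    show "pairwise disjnt m" using assms(1) by (simp add: perfect_matching_def)
    show "finite e" if "e \<in> m" for e
      using finite_subset[OF perfect_matchingD(2)[OF assms(1) that] assms(2)] .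
  qed
  also have "\<dots> = (\<Sum>e\<in>m. 2)" using assms by (intro sum.cong) (auto simp: perfect_matching_def)
  finally show "card Y = 2 * card m" using assms by (simp add: perfect_matching_def)
qed

text \<open>An even number of at least four points is matched completely; a remaining side would
  have a pair inside and a pair outside. For an odd number one point is left out, and a single
  further flip finishes. With two or three points there is no second pair for the exchange argument,
  whence the separate lemmas for these cases.\<close>

lemma flips_to_prime:
  assumes sk: "skew W r" and c: "8 \<le> card W" and oW: "o' \<in> W" and XW: "X \<subseteq> W - {o'}"
    and hit: "\<And>S. nside W r S \<Longrightarrow> S \<inter> X \<noteq> {}"
    and irr: "\<And>x. x \<in> X \<Longrightarrow> \<exists>S. nside W r S \<and> S \<inter> X = {x}"
  shows "\<exists>E \<subseteq> arcs_off W o'. finite E \<and> card E \<le> (card X + 1) div 2 \<and> prime W (flip E r)"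
proof -
  have fW: "finite W" using sk by (simp add: skew_def)
  have fX: "finite X" using XW fW by (meson finite_Diff finite_subset)
  have f0: "flip {} r = r" for r :: "'a \<Rightarrow> 'a \<Rightarrow> bool" by (simp add: flip_def fun_eq_iff)
  \<comment> \<open>A minimal side inside a witness of irredundance still meets \<open>X\<close>, so
    it meets it in \<open>x\<close> alone.\<close>
  have "\<exists>D. min_side W r D \<and> D \<inter> X = {x}" if x: "x \<in> X" for x
  proof -
    obtain S where S: "nside W r S" "S \<inter> X = {x}" using irr[OF x] by blast
    obtain D where D: "min_side W r D" "D \<subseteq> S" using ex_min_side[OF sk S(1)] .
    have "D \<inter> X \<noteq> {}" using hit[of D] D(1) unfolding min_side_def by blast
    moreover have "D \<inter> X \<subseteq> {x}" using D(2) S(2) by blast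
    ultimately show ?thesis using D(1) subset_singletonD by metis
  qed
  then obtain D where D: "\<And>x. x \<in> X \<Longrightarrow> min_side W r (D x)" "\<And>x. x \<in> X \<Longrightarrow> D x \<inter> X = {x}" by metis
  have XW': "X \<subseteq> W" using XW by blast
  have flips: "nside W r S \<and> unsplit S m"
    if m: "perfect_matching Y m" "Y \<subseteq> X" "4 \<le> card Y" "nside W (flip m r) S"
    and ex: "exchanged W r m" for m Y S
  proof (rule nside_flip_matching[where D = D, OF sk])
    have fY: "finite Y" using m(2) fX finite_subset by blast
    show "finite m" using card_perfect_matching[OF m(1) fY] by blast
    show "pairwise disjnt m" "\<And>e. e \<in> m \<Longrightarrow> card e = 2" using m(1) by (auto simp: perfect_matching_def)
    have U: "\<Union>m = Y" using m(1) by (simp add: perfect_matching_def)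
    show "min_side W r (D x)" if "x \<in> \<Union>m" for x using D(1) that U m(2) by blast
    show "D x \<inter> \<Union>m = {x}" if "x \<in> \<Union>m" for x using D(2)[of x] that U m(2) by blast
    show "\<not> side W r (D x \<union> D y)" if "{x, y} \<in> m" for x y
      by (rule not_side_matched_Un[OF sk m(1,2) XW' m(3) _ D that]) (use ex in auto)
    show "nside W (flip m r) S" using m(4) .
  qed
  have moff: "m \<subseteq> arcs_off W o'" if "perfect_matching Y m" "Y \<subseteq> X" for m Y
  proof
    fix e assume e: "e \<in> m"
    then have "card e = 2" "e \<subseteq> X" using perfect_matchingD(1,2)[OF that(1)] that(2) by blast+
    then obtain p q where "e = {p, q}" "p \<noteq> q" "p \<in> X" "q \<in> X" by (auto simp: card_2_iff)
    then show "e \<in> arcs_off W o'" unfolding arcs_off_def using XW by blast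
  qed
  show ?thesis
  proof (cases "\<exists>S. nside W r S")
    case False
    then show ?thesis using f0 by (intro exI[of _ "{}"]) (auto simp: prime_def)
  next
    case True
    then obtain S0 where S0: "nside W r S0" by blast
    obtain x where x: "x \<in> X" "x \<in> S0" using hit[OF S0] by blast
    obtain y where y: "y \<in> X" "y \<notin> S0" using hit[OF nside_compl[OF sk S0]] by blast
    have xy: "x \<noteq> y" using x y by blast
    have "card {x, y} \<le> card X" using x y fX by (intro card_mono) auto
    then have "2 \<le> card X" using xy by simp
    then have "card X = 2 \<or> card X = 3 \<or> (even (card X) \<and> 4 \<le> card X) \<or> (odd (card X) \<and> 5 \<le> card X)"
      by presburger
    then consider "card X = 2" | "card X = 3" | "even (card X)" "4 \<le> card X" | "odd (card X)" "5 \<le> card X"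
      by blast
    then show ?thesis
    proof cases
      case 1
      have X: "X = {x, y}" using card_subset_eq[OF fX, of "{x, y}"] x y xy 1 by simp
      have sep: "(x \<in> S) \<noteq> (y \<in> S)" if S: "nside W r S" for S
        using hit[OF S] hit[OF nside_compl[OF sk S]] unfolding X by blast
      have "x \<in> W" "y \<in> W" "x \<noteq> o'" "y \<noteq> o'" using x y XW by blast+
      then obtain p q where pq: "p \<in> W" "q \<in> W" "p \<noteq> o'" "q \<noteq> o'" "p \<noteq> q" "prime W (flip {{p,q}} r)"
        using one_flip_prime[OF sk c S0 _ _ _ _ sep] by metis
      then show ?thesis using flip_more[of "{}" W o' p q r] 1 f0 by auto
    next
      case 2
      then obtain a b d where X: "X = {a, b, d}" "a \<noteq> b" "a \<noteq> d" "b \<noteq> d"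
        by (auto simp: card_3_iff)
      obtain p q u v where pq: "p \<in> W" "q \<in> W" "p \<noteq> o'" "q \<noteq> o'" "p \<noteq> q" and uv: "u \<in> W" "v \<in> W" "u \<noteq> o'" "v \<noteq> o'"
        and sep: "\<And>S. nside W (flip {{p,q}} r) S \<Longrightarrow> (u \<in> S) \<noteq> (v \<in> S)"
        using three_points[OF sk c oW X XW hit D] by metis
      have off: "{{p, q}} \<subseteq> arcs_off W o'" using pq by (auto simp: arcs_off_def)
      show ?thesis
      proof (cases "\<exists>S. nside W (flip {{p,q}} r) S")
        case False
        then show ?thesis using off 2 by (intro exI[of _ "{{p, q}}"]) (auto simp: prime_def)
      next
        case True
        then obtain S1 where S1: "nside W (flip {{p,q}} r) S1" by blast
        obtain p' q' where pq': "p' \<in> W" "q' \<in> W" "p' \<noteq> o'" "q' \<noteq> o'" "p' \<noteq> q'"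
          "prime W (flip {{p',q'}} (flip {{p,q}} r))"
          using one_flip_prime[OF skew_flip[OF sk] c S1 uv sep] by metis
        then show ?thesis using flip_more[OF off _ pq'(6,1-5)] 2 by auto
      qed
    next
      case 3
      obtain m where m: "perfect_matching X m"
        and ex: "exchanged W r m"
        using matching_exchange[OF sk XW' 3(1)] .
      have U: "\<Union>m = X" using m by (simp add: perfect_matching_def)
      have "prime W (flip m r)" unfolding prime_def
      proof (intro allI notI)
        fix S assume "nside W (flip m r) S"
        from flips[OF m order_refl 3(2) this ex]
        have S: "nside W r S" "unsplit S m" by blast+
        obtain a where a: "a \<in> X" "a \<in> S" using hit[OF S(1)] by blast
        obtain b where b: "b \<in> X" "b \<notin> S" using hit[OF nside_compl[OF sk S(1)]] by blast
        obtain e where e: "e \<in> m" "a \<in> e" using U a by blast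
        obtain f where f: "f \<in> m" "b \<in> f" using U b by blast
        have "e \<subseteq> S" "f \<inter> S = {}" using S(2) e f a b unfolding unsplit_def by blast+
        then show False using exchangedD[OF ex S e(1) f(1)] by blast
      qed
      moreover have "m \<subseteq> arcs_off W o'" using moff[OF m] by blast
      ultimately show ?thesis using card_perfect_matching[OF m fX] by (intro exI[of _ m]) auto
    next
      case 4
      let ?Y = "X - {x}"
      have cY: "card ?Y = card X - 1" using x fX by simp
      have Y4: "4 \<le> card ?Y" "even (card ?Y)" using cY 4 by auto
      have YW: "?Y \<subseteq> W" using XW' by blast
      have fY: "finite ?Y" using fX by blast
      obtain m where m: "perfect_matching ?Y m"
        and ex: "exchanged W r m"
        using matching_exchange[OF sk YW Y4(2)] .
      have U: "\<Union>m = ?Y" using m by (simp add: perfect_matching_def)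
      have cm: "finite m" "card X = 2 * card m + 1"
        using card_perfect_matching[OF m fY] cY 4 by auto
      have off: "m \<subseteq> arcs_off W o'" using moff[OF m] by blast
      \<comment> \<open>If \<open>S\<close> kept \<open>x\<close> and \<open>y\<close> together, say
        inside, then the pair of \<open>y\<close> and the pair of some point of \<open>X\<close>
        outside would contradict \<open>exchanged\<close>.\<close>
      have sep: "(x \<in> S) \<noteq> (y \<in> S)" if SS: "nside W (flip m r) S" for S
      proof
        assume eq: "(x \<in> S) = (y \<in> S)"
        have S: "nside W r S" "unsplit S m"
          using flips[OF m Diff_subset Y4(1) SS ex] by blast+
        have aux: False if S: "nside W r S" "unsplit S m" "x \<in> S" "y \<in> S" for S
        proof -
          obtain b where b: "b \<in> X" "b \<notin> S" using hit[OF nside_compl[OF sk S(1)]] by blast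
          obtain e where e: "e \<in> m" "y \<in> e" using U y xy by blast
          have "b \<in> ?Y" using b S(3) by blast
          then obtain f where f: "f \<in> m" "b \<in> f" using U by blast
          have "e \<subseteq> S" "f \<inter> S = {}" using S(2,4) e f b unfolding unsplit_def by blast+
          then show False using exchangedD[OF ex S(1,2) e(1) f(1)] by blast
        qed
        show False
        proof (cases "x \<in> S")
          case True then show ?thesis using aux[OF S] eq by blast
        next
          case False
          have "\<Union>m \<subseteq> W" using U YW by blast
          then have "unsplit (W - S) m" using S(2) unfolding unsplit_def by blast
          then show ?thesis using aux[OF nside_compl[OF sk S(1)]] False eq x y XW' by blast
        qed
      qed
      show ?thesis
      proof (cases "\<exists>S. nside W (flip m r) S")
        case False
        then show ?thesis using off cm by (intro exI[of _ m]) (auto simp: prime_def)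
      next
        case True
        then obtain S1 where S1: "nside W (flip m r) S1" by blast
        have xyW: "x \<in> W" "y \<in> W" "x \<noteq> o'" "y \<noteq> o'" using x y XW by blast+
        obtain p' q' where pq': "p' \<in> W" "q' \<in> W" "p' \<noteq> o'" "q' \<noteq> o'" "p' \<noteq> q'"
          "prime W (flip {{p',q'}} (flip m r))"
          using one_flip_prime[OF skew_flip[OF sk] c S1 xyW sep] by metis
        then show ?thesis using flip_more[OF off cm(1) pq'(6,1-5)] cm(2) by auto
      qed
    qed
  qed
qed

section \<open>Minimal sides and disjoint families\<close>

text \<open>In a chain of twins all arcs point along the chain, so out-degrees grow against its
  direction. This locates an end of the chain.\<close>

lemma twins_succ_unique:
  assumes sk: "skew U g" and h: "homog U g {a, b}" "homog U g {a, c}" and d: "a \<noteq> b" "a \<noteq> c" "b \<noteq> c"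
    and g: "g a b"
  shows "g c a" "\<And>v. v \<in> U \<Longrightarrow> v \<noteq> a \<Longrightarrow> v \<noteq> c \<Longrightarrow> g c v = g a v"
proof -
  have U: "a \<in> U" "b \<in> U" "c \<in> U" using h unfolding homog_def by blast+
  have "g a c = g b c" "g a b = g c b"
    by (rule homogD[OF h(1)] homogD[OF h(2)]; use U d in simp)+
  moreover have "g b c \<noteq> g c b" "g a c \<noteq> g c a" using skewD[OF sk] U d by blast+
  ultimately show "g c a" using g by blast
  show "g c v = g a v" if "v \<in> U" "v \<noteq> a" "v \<noteq> c" for v
    using homogD[OF h(2), of c a v] that by blast
qed

text \<open>Minimal sides only overlap in chains of twins, so that hitting the chains greedily from
  their last pairs needs no more points than there are disjoint minimal sides.\<close>

lemma greedy_hitting: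
  assumes sk: "skew W r" and oW: "o' \<in> W"
    and "finite F" "\<And>A. A \<in> F \<Longrightarrow> min_side W r A"
  shows "\<exists>X P. P \<subseteq> F \<and> (\<forall>A\<in>P. \<forall>B\<in>P. A \<noteq> B \<longrightarrow> A \<inter> B \<subseteq> {o'}) \<and> X \<subseteq> W - {o'} \<and>
     (\<forall>A\<in>F. A \<inter> X \<noteq> {}) \<and> finite X \<and> card X \<le> card P"
  using assms(3,4)
proof (induction F rule: finite_psubset_induct)
  case (psubset F)
  show ?case
  proof (cases "F = {}")
    case True
    then show ?thesis by (intro exI[of _ "{}"]) auto
  next
    case False
    have F: "A \<subseteq> W" "2 \<le> card A" "side W r A" if "A \<in> F" for A
      using psubset.prems[OF that] nside_subset by (auto simp: min_side_def nside_def)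
    have ne: "\<exists>e\<in>A. e \<noteq> o'" if "A \<in> F" for A
    proof -
      have "\<not> A \<subseteq> {o'}"
      proof
        assume "A \<subseteq> {o'}"
        then have "card A \<le> card {o'}" by (intro card_mono) auto
        then show False using F(2)[OF that] by simp
      qed
      then show ?thesis by blast
    qed
    \<comment> \<open>The greedy step: \<open>e\<close> enters \<open>X\<close> and hits every
      member containing it, and \<open>A\<close> enters \<open>P\<close>. The members not hit are
      disjoint from \<open>A\<close> up to \<open>o'\<close>, so later choices cannot spoil
      disjointness.\<close>
    have "\<exists>A\<in>F. \<exists>e\<in>A. e \<noteq> o' \<and> (\<forall>B\<in>F. e \<notin> B \<longrightarrow> A \<inter> B \<subseteq> {o'})"
    proof (cases "\<exists>A\<in>F. \<forall>B\<in>F. B \<noteq> A \<longrightarrow> A \<inter> B \<subseteq> {o'}")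
      case True
      then obtain A where "A \<in> F" "\<forall>B\<in>F. B \<noteq> A \<longrightarrow> A \<inter> B \<subseteq> {o'}" by blast
      then show ?thesis using ne[of A] by blast
    next
      case False
      have two: "\<exists>a b. A = {a, b} \<and> a \<noteq> b" if A: "A \<in> F" for A
      proof -
        obtain B w where B: "B \<in> F" "B \<noteq> A" "w \<in> A" "w \<in> B" using False A by blast
        then obtain x y where "A = {x, w}" "x \<noteq> w"
          using min_side_Int[OF sk psubset.prems[OF A] psubset.prems[OF B(1)], of w] by metis
        then show ?thesis by blast
      qed
      show ?thesis
      proof (cases "\<exists>A\<in>F. o' \<in> A")
        case True
        then obtain A where A: "A \<in> F" "o' \<in> A" by blast
        obtain e where e: "A = {o', e}" "e \<noteq> o'" using two[OF A(1)] A(2) by blast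
        then show ?thesis using A by (intro bexI[of _ A] bexI[of _ e]) auto
      next
        case noF: False
        let ?U = "W - {o'}" and ?g = "rebase o' r"
        have skU: "skew ?U ?g" using skew_rebase[OF sk] .
        have fU: "finite ?U" using skU by (simp add: skew_def)
        have hF: "homog ?U ?g A" if "A \<in> F" for A
          using side_iff_homog[OF oW] F(3)[OF that] noF that by blast
        have FU: "A \<subseteq> ?U" if "A \<in> F" for A using hF[OF that] unfolding homog_def by blast
        define out where "out a = {v \<in> ?U. v \<noteq> a \<and> ?g a v}" for a
        have fout: "finite (out a)" for a using fU by (simp add: out_def)
        \<comment> \<open>\<open>Q a\<close> says that \<open>a\<close> is the beating end of some
          pair in \<open>F\<close>. Among these, \<open>a\<close> of largest out-degree sits at the
          end of a chain: another pair \<open>{a, c}\<close> would have \<open>c\<close> beating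
          \<open>a\<close> and all that \<open>a\<close> beats.\<close>
        define Q where "Q a \<longleftrightarrow> (\<exists>b. {a, b} \<in> F \<and> a \<noteq> b \<and> ?g a b)" for a
        obtain A where A: "A \<in> F" using \<open>F \<noteq> {}\<close> by blast
        obtain a b where ab: "A = {a, b}" "a \<noteq> b" using two[OF A] by blast
        have "?g a b \<or> ?g b a" using skewD[OF skU, of a b] FU[OF A] ab by blast
        then have "Q a \<or> Q b" using ab A unfolding Q_def by (metis insert_commute)
        then obtain a0 where a0: "Q a0" by blast
        have "card (out a) < Suc (card ?U)" for a
          using fU by (auto simp: out_def less_Suc_eq_le intro!: card_mono)
        then obtain a where a: "Q a" "\<And>c. Q c \<Longrightarrow> card (out c) \<le> card (out a)"
          using ex_has_greatest_nat[of Q a0 "\<lambda>a. card (out a)" "Suc (card ?U)"] a0 by auto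
        obtain b where b: "{a, b} \<in> F" "a \<noteq> b" "?g a b" using a(1) Q_def by blast
        have "{a, b} \<inter> B \<subseteq> {o'}" if B: "B \<in> F" "b \<notin> B" for B
        proof (rule ccontr)
          assume "\<not> ?thesis"
          then have aB: "a \<in> B" using B by blast
          then obtain c where c: "B = {a, c}" "a \<noteq> c" using two[OF B(1)] by blast
          have bc: "b \<noteq> c" using B c by blast
          have hc: "homog ?U ?g {a, c}" using hF[OF B(1)] c by simp
          note s = twins_succ_unique[OF skU hF[OF b(1)] hc b(2) c(2) bc b(3)]
          have cU: "c \<in> ?U" "a \<in> ?U" using FU[OF B(1)] c by blast+
          have "?g c a \<and> c \<noteq> a \<and> {c, a} \<in> F" using s(1) c B(1) by (simp add: insert_commute)
          then have Qc: "Q c" unfolding Q_def by blast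
          have "v \<in> out c" if "v \<in> insert a (out a)" for v
          proof (cases "v = a")
            case True then show ?thesis using s(1) cU c(2) by (simp add: out_def)
          next
            case False
            then have v: "v \<in> ?U" "?g a v" using that by (auto simp: out_def)
            have "v \<noteq> c" using v s(1) skewD[OF skU cU] c(2) by blast
            then show ?thesis using s(2)[of v] v False by (simp add: out_def)
          qed
          then have "card (insert a (out a)) \<le> card (out c)" using fout by (intro card_mono) auto
          moreover have "a \<notin> out a" by (simp add: out_def)
          ultimately have "card (out a) < card (out c)" using fout by simp
          then show False using a(2)[OF Qc] by simp
        qed
        moreover have "b \<noteq> o'" using FU[OF b(1)] by blast
        ultimately show ?thesis using b(1) by blast
      qed
    qed
    then obtain A e where A: "A \<in> F" "e \<in> A" "e \<noteq> o'" "\<forall>B\<in>F. e \<notin> B \<longrightarrow> A \<inter> B \<subseteq> {o'}" by blast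
    let ?F = "{B \<in> F. e \<notin> B}"
    have "?F \<subset> F" using A by blast
    then obtain X P where IH: "P \<subseteq> ?F" "\<forall>A\<in>P. \<forall>B\<in>P. A \<noteq> B \<longrightarrow> A \<inter> B \<subseteq> {o'}" "X \<subseteq> W - {o'}"
      "\<forall>A\<in>?F. A \<inter> X \<noteq> {}" "finite X" "card X \<le> card P"
      using psubset.IH[of ?F] psubset.prems by auto
    have "A \<notin> P" using IH(1) A by blast
    moreover have "finite P" using finite_subset[of P F] IH(1) psubset.hyps(1) by blast
    ultimately have "card (insert e X) \<le> card (insert A P)" using IH(5,6) by (simp add: card_insert_if)
    moreover have "\<forall>A\<in>insert A P. \<forall>B\<in>insert A P. A \<noteq> B \<longrightarrow> A \<inter> B \<subseteq> {o'}"
      using IH(1,2) A(4) by (simp add: Int_commute) blast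
    moreover have "insert e X \<subseteq> W - {o'}" using IH(3) A F(1) by blast
    moreover have "\<forall>B\<in>F. B \<inter> insert e X \<noteq> {}" using IH(4) by blast
    moreover have "insert A P \<subseteq> F" using IH(1) A(1) by blast
    ultimately show ?thesis using IH(5) by (intro exI[of _ "insert e X"] exI[of _ "insert A P"]) auto
  qed
qed

text \<open>A hitting subset of least size is irredundant, and passing to it only lowers
  \<open>card X\<close>. Members of \<open>P\<close> may share \<open>o'\<close>, which disappears
  with the added point.\<close>

lemma irredundant_hitting:
  assumes sk: "skew W r" and oW: "o' \<in> W"
  obtains X P where "X \<subseteq> W - {o'}" "\<forall>S. nside W r S \<longrightarrow> S \<inter> X \<noteq> {}"
    "\<forall>x\<in>X. \<exists>S. nside W r S \<and> S \<inter> X = {x}" "\<forall>A\<in>P. nside W r A"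
    "\<forall>A\<in>P. \<forall>B\<in>P. A \<noteq> B \<longrightarrow> A \<inter> B \<subseteq> {o'}" "finite P" "card X \<le> card P"
proof -
  have fW: "finite W" using sk by (simp add: skew_def)
  let ?F = "{A. min_side W r A}"
  have "?F \<subseteq> Pow W" using nside_subset by (auto simp: min_side_def)
  then have fF: "finite ?F" using fW by (meson finite_Pow_iff finite_subset)
  obtain X P where XP: "P \<subseteq> ?F" "\<forall>A\<in>P. \<forall>B\<in>P. A \<noteq> B \<longrightarrow> A \<inter> B \<subseteq> {o'}" "X \<subseteq> W - {o'}"
     "\<forall>A\<in>?F. A \<inter> X \<noteq> {}" "finite X" "card X \<le> card P"
    using greedy_hitting[OF sk oW fF] by auto
  define H where "H Z \<longleftrightarrow> Z \<subseteq> X \<and> (\<forall>S. nside W r S \<longrightarrow> S \<inter> Z \<noteq> {})" for Z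
  have "S \<inter> X \<noteq> {}" if S: "nside W r S" for S
  proof -
    obtain A where "min_side W r A" "A \<subseteq> S" using ex_min_side[OF sk S] .
    then show ?thesis using XP(4) by blast
  qed
  then have "H X" by (simp add: H_def)
  then obtain Z where Z: "H Z" "\<And>Z'. H Z' \<Longrightarrow> card Z \<le> card Z'"
    using ex_has_least_nat[of H X card] by blast
  have ZX: "Z \<subseteq> X" using Z(1) by (simp add: H_def)
  have fZ: "finite Z" using ZX XP(5) finite_subset by blast
  show ?thesis
  proof (rule that[of Z P])
    show "Z \<subseteq> W - {o'}" using ZX XP(3) by blast
    show hit: "\<forall>S. nside W r S \<longrightarrow> S \<inter> Z \<noteq> {}" using Z(1) by (simp add: H_def)
    show "\<forall>x\<in>Z. \<exists>S. nside W r S \<and> S \<inter> Z = {x}"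
    proof
      fix x assume x: "x \<in> Z"
      have "card (Z - {x}) < card Z" using fZ x by (rule card_Diff1_less)
      then have "\<not> H (Z - {x})" using Z(2)[of "Z - {x}"] by linarith
      then obtain S where S: "nside W r S" "S \<inter> (Z - {x}) = {}" using ZX by (auto simp: H_def)
      then have "S \<inter> Z = {x}" using hit by blast
      then show "\<exists>S. nside W r S \<and> S \<inter> Z = {x}" using S(1) by blast
    qed
    show "\<forall>A\<in>P. nside W r A" using XP(1) by (auto simp: min_side_def)
    show "\<forall>A\<in>P. \<forall>B\<in>P. A \<noteq> B \<longrightarrow> A \<inter> B \<subseteq> {o'}" using XP(2) .
    show "finite P" using XP(1) fF finite_subset by blast
    show "card Z \<le> card P" using XP(6) card_mono[OF XP(5) ZX] by linarith
  qed
qed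

lemma homog_trans:
  assumes "homog U g A" "homog A g B" shows "homog U g B"
  using assms unfolding homog_def by blast

text \<open>Six arcs decide everything: once the conditions for pairs and triples to be modules are
  spelled out, the claim is propositional. It serves for modules of four vertices and, with
  \<open>None\<close> as a fourth point, for co-modules of three.\<close>

lemma four_vertices:
  assumes sk: "skew A g" and c: "card A = 4"
  obtains B where "homog A g B" "B \<noteq> A" "2 \<le> card B"
proof -
  obtain a b c d where A: "A = {a, b, c, d}" and n: "a \<noteq> b" "a \<noteq> c" "a \<noteq> d" "b \<noteq> c" "b \<noteq> d" "c \<noteq> d"
    using c by (auto simp: card_Suc_eq numeral_eq_Suc)
  have s: "g b a = (\<not> g a b)" "g c a = (\<not> g a c)" "g d a = (\<not> g a d)" "g c b = (\<not> g b c)"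
    "g d b = (\<not> g b d)" "g d c = (\<not> g c d)"
    using skewD[OF sk] A n by blast+
  have h2: "homog A g {x, y}" if "{x, y} \<subseteq> A" "\<And>v. v \<in> A \<Longrightarrow> v \<noteq> x \<Longrightarrow> v \<noteq> y \<Longrightarrow> g x v = g y v" for x y
    using that unfolding homog_def by blast
  have h3: "homog A g {x, y, z}" if "A = {x, y, z, v}" "g x v = g y v" "g z v = g y v" for x y z v
    using that unfolding homog_def by blast
  have A': "A = {b, c, d, a}" "A = {a, c, d, b}" "A = {a, b, d, c}" using A by blast+
  have t: "\<lbrakk>g a c = g b c; g a d = g b d\<rbrakk> \<Longrightarrow> homog A g {a, b}"
    "\<lbrakk>g a b = g c b; g a d = g c d\<rbrakk> \<Longrightarrow> homog A g {a, c}"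
    "\<lbrakk>g a b = g d b; g a c = g d c\<rbrakk> \<Longrightarrow> homog A g {a, d}"
    "\<lbrakk>g b a = g c a; g b d = g c d\<rbrakk> \<Longrightarrow> homog A g {b, c}"
    "\<lbrakk>g b a = g d a; g b c = g d c\<rbrakk> \<Longrightarrow> homog A g {b, d}"
    "\<lbrakk>g c a = g d a; g c b = g d b\<rbrakk> \<Longrightarrow> homog A g {c, d}"
    by (rule h2; use A in blast)+
  have u: "\<lbrakk>g a d = g b d; g c d = g b d\<rbrakk> \<Longrightarrow> homog A g {a, b, c}"
     "\<lbrakk>g a c = g b c; g d c = g b c\<rbrakk> \<Longrightarrow> homog A g {a, b, d}"
     "\<lbrakk>g a b = g c b; g d b = g c b\<rbrakk> \<Longrightarrow> homog A g {a, c, d}"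
     "\<lbrakk>g b a = g c a; g d a = g c a\<rbrakk> \<Longrightarrow> homog A g {b, c, d}"
    using h3[OF A] h3[OF A'(1)] h3[OF A'(2)] h3[OF A'(3)] by blast+
  have "homog A g {a, b} \<or> homog A g {a, c} \<or> homog A g {a, d} \<or> homog A g {b, c} \<or> homog A g {b, d} \<or> homog A g {c, d}
     \<or> homog A g {a, b, c} \<or> homog A g {a, b, d} \<or> homog A g {a, c, d} \<or> homog A g {b, c, d}"
    using t u s by argo
  moreover have "\<And>B. card B = 2 \<or> card B = 3 \<Longrightarrow> homog A g B \<Longrightarrow> thesis"
    using that c by force
  moreover have "card {a, b} = 2" "card {a, c} = 2" "card {a, d} = 2" "card {b, c} = 2" "card {b, d} = 2"
    "card {c, d} = 2" "card {a, b, c} = 3" "card {a, b, d} = 3" "card {a, c, d} = 3" "card {b, c, d} = 3"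
    using n by simp_all
  ultimately show thesis by metis
qed

section \<open>Co-modules of tournaments\<close>

lemma tournament_iff:
  "tournament T \<longleftrightarrow> finite (pverts T) \<and> parcs T \<subseteq> pverts T \<times> pverts T \<and> (\<forall>x. (x, x) \<notin> parcs T) \<and>
     (\<forall>x\<in>pverts T. \<forall>y\<in>pverts T. x \<noteq> y \<longrightarrow> ((x, y) \<in> parcs T \<longleftrightarrow> (y, x) \<notin> parcs T))"
proof
  assume "tournament T"
  then interpret tournament T .
  have "(x, x) \<notin> parcs T" for x using pair_no_loops[of "(x, x)"] by auto
  moreover have "parcs T \<subseteq> pverts T \<times> pverts T" using in_arcsD1 in_arcsD2 by auto
  ultimately show "finite (pverts T) \<and> parcs T \<subseteq> pverts T \<times> pverts T \<and> (\<forall>x. (x, x) \<notin> parcs T) \<and>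
     (\<forall>x\<in>pverts T. \<forall>y\<in>pverts T. x \<noteq> y \<longrightarrow> ((x, y) \<in> parcs T \<longleftrightarrow> (y, x) \<notin> parcs T))"
    using pair_finite_verts arc_iff_not_reverse by blast
next
  assume *: "finite (pverts T) \<and> parcs T \<subseteq> pverts T \<times> pverts T \<and> (\<forall>x. (x, x) \<notin> parcs T) \<and>
     (\<forall>x\<in>pverts T. \<forall>y\<in>pverts T. x \<noteq> y \<longrightarrow> ((x, y) \<in> parcs T \<longleftrightarrow> (y, x) \<notin> parcs T))"
  then have sub: "parcs T \<subseteq> pverts T \<times> pverts T" and loop: "(x, x) \<notin> parcs T" for x by blast+
  show "tournament T"
  proof unfold_locales
    show "fst e \<in> pverts T" "snd e \<in> pverts T" if "e \<in> parcs T" for e using that sub by auto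
    show "finite (pverts T)" using * by blast
    then show "finite (parcs T)" using sub by (meson finite_SigmaI finite_subset)
    show "fst e \<noteq> snd e" if "e \<in> parcs T" for e using that loop by (cases e) auto
    show "((x, y) \<in> parcs T) = ((y, x) \<notin> parcs T)" if "x \<in> pverts T" "y \<in> pverts T" "x \<noteq> y" for x y
      using * that by blast
  qed
qed

lemma tournamentD:
  assumes "tournament T"
  shows "finite (pverts T)" "(x, y) \<in> parcs T \<Longrightarrow> x \<in> pverts T" "(x, y) \<in> parcs T \<Longrightarrow> y \<in> pverts T"
    "(x, x) \<notin> parcs T"
    "x \<in> pverts T \<Longrightarrow> y \<in> pverts T \<Longrightarrow> x \<noteq> y \<Longrightarrow> (x, y) \<in> parcs T \<longleftrightarrow> (y, x) \<notin> parcs T"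
  using assms unfolding tournament_iff by blast+

lemma is_moduleD:
  "is_module T M \<Longrightarrow> x \<in> M \<Longrightarrow> y \<in> M \<Longrightarrow> v \<in> pverts T \<Longrightarrow> v \<notin> M \<Longrightarrow> (v, x) \<in> parcs T \<longleftrightarrow> (v, y) \<in> parcs T"
  unfolding is_module_def by blast

lemma is_moduleD2:
  assumes "tournament T" "is_module T M" "x \<in> M" "y \<in> M" "v \<in> pverts T" "v \<notin> M"
  shows "(x, v) \<in> parcs T \<longleftrightarrow> (y, v) \<in> parcs T"
proof -
  have "x \<in> pverts T" "y \<in> pverts T" using assms(2-4) unfolding is_module_def by blast+
  then show ?thesis
    using is_moduleD[OF assms(2-6)] tournamentD(5)[OF assms(1), of x v] tournamentD(5)[OF assms(1), of y v]
      assms(3-6) by blast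
qed

lemma is_module_iff_homog:
  assumes "tournament T"
  shows "is_module T M \<longleftrightarrow> homog (pverts T) (\<lambda>u v. (u, v) \<in> parcs T) M"
proof
  assume m: "is_module T M"
  show "homog (pverts T) (\<lambda>u v. (u, v) \<in> parcs T) M" unfolding homog_def
    using is_moduleD2[OF assms m] m unfolding is_module_def by blast
next
  assume h: "homog (pverts T) (\<lambda>u v. (u, v) \<in> parcs T) M"
  have sk: "skew (pverts T) (\<lambda>u v. (u, v) \<in> parcs T)"
    using assms unfolding tournament_iff skew_def by blast
  show "is_module T M" unfolding is_module_def
    using homogD2[OF sk h] h unfolding homog_def by blast
qed

text \<open>A singleton qualifies only through its complement, that is, by being a source or a
  sink.\<close>

definition comodule :: "'a pair_pre_digraph \<Rightarrow> 'a set \<Rightarrow> bool" where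
  "comodule T M \<longleftrightarrow> M \<subseteq> pverts T \<and> M \<noteq> {} \<and> M \<noteq> pverts T \<and>
     (is_module T M \<and> 2 \<le> card M \<or> is_module T (pverts T - M) \<and> 2 \<le> card (pverts T - M))"

definition comodule_family :: "'a pair_pre_digraph \<Rightarrow> 'a set set \<Rightarrow> bool" where
  "comodule_family T P \<longleftrightarrow> finite P \<and> (\<forall>M\<in>P. comodule T M) \<and> pairwise disjnt P"

text \<open>A nontrivial module survives unless an arc across its boundary is reversed, and such an
  arc has an end on either side. So it touches \<open>M\<close> whether \<open>M\<close> or its
  complement is the module.\<close>

lemma Inv_comodule_arc:
  assumes T: "tournament T" and ind: "indecomposable (Inv T B)" and M: "comodule T M"
  obtains x where "x \<in> M" "x \<in> fst ` B \<union> snd ` B"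
proof -
  have aux: "\<exists>x\<in>K. \<exists>v\<in>pverts T - K. (v, x) \<in> B \<or> (x, v) \<in> B"
    if K: "is_module T K" "2 \<le> card K" "K \<noteq> pverts T" for K
  proof (rule ccontr)
    assume n: "\<not> ?thesis"
    have eq: "(v, x) \<in> parcs (Inv T B) \<longleftrightarrow> (v, x) \<in> parcs T" if "x \<in> K" "v \<in> pverts T - K" for x v
      using n that by (auto simp: Inv_def)
    have VI: "pverts (Inv T B) = pverts T" by (simp add: Inv_def)
    have "is_module (Inv T B) K" unfolding is_module_def VI
    proof (intro conjI ballI)
      show "K \<subseteq> pverts T" using K(1) unfolding is_module_def by blast
      fix x y v assume H: "x \<in> K" "y \<in> K" "v \<in> pverts T - K"
      show "(v, x) \<in> parcs (Inv T B) \<longleftrightarrow> (v, y) \<in> parcs (Inv T B)"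
        using is_moduleD[OF K(1), of x y v] eq H by blast
    qed
    then have "trivial_module (Inv T B) K" using ind by (simp add: indecomposable_def)
    then show False using K by (auto simp: trivial_module_def Inv_def)
  qed
  consider "is_module T M" "2 \<le> card M" "M \<noteq> pverts T"
    | "is_module T (pverts T - M)" "2 \<le> card (pverts T - M)" "pverts T - M \<noteq> pverts T"
    using M unfolding comodule_def by blast
  then show thesis
  proof cases
    case 1
    then obtain x v where "x \<in> M" "(v, x) \<in> B \<or> (x, v) \<in> B" using aux by blast
    then show thesis using that[of x] by force
  next
    case 2
    then obtain x v where "v \<in> M" "(v, x) \<in> B \<or> (x, v) \<in> B"
      using aux[of "pverts T - M"] by blast
    then show thesis using that[of v] by force
  qed
qed

lemma comodule_family_le:
  assumes T: "tournament T" and B: "finite B" and ind: "indecomposable (Inv T B)"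
    and P: "comodule_family T P"
  shows "card P \<le> 2 * card B"
proof -
  have "\<forall>M\<in>P. \<exists>x. x \<in> M \<and> x \<in> fst ` B \<union> snd ` B"
    using Inv_comodule_arc[OF T ind] P unfolding comodule_family_def by metis
  then obtain f where f: "\<And>M. M \<in> P \<Longrightarrow> f M \<in> M \<and> f M \<in> fst ` B \<union> snd ` B" by metis
  have "inj_on f P"
  proof (rule inj_onI, rule ccontr)
    fix M N assume H: "M \<in> P" "N \<in> P" "f M = f N" "M \<noteq> N"
    have "M \<inter> N = {}" using P H unfolding comodule_family_def pairwise_def disjnt_def by metis
    then show False using f[OF H(1)] f[OF H(2)] H(3) by auto
  qed
  then have "card P = card (f ` P)" by (simp add: card_image)
  also have "\<dots> \<le> card (fst ` B \<union> snd ` B)" using f B by (intro card_mono) auto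
  also have "\<dots> \<le> card (fst ` B) + card (snd ` B)" by (rule card_Un_le)
  also have "\<dots> \<le> 2 * card B" using card_image_le[OF B, of fst] card_image_le[OF B, of snd] by linarith
  finally show ?thesis .
qed

section \<open>The added point: co-modules as sides\<close>

fun hat :: "'a pair_pre_digraph \<Rightarrow> 'a option \<Rightarrow> 'a option \<Rightarrow> bool" where
  "hat T None v = (v \<noteq> None)"
| "hat T (Some u) None = False"
| "hat T (Some u) (Some v) = ((u, v) \<in> parcs T)"

definition hatV :: "'a pair_pre_digraph \<Rightarrow> 'a option set" where
  "hatV T = insert None (Some ` pverts T)"

lemma skew_hat:
  assumes T: "tournament T" shows "skew (hatV T) (hat T)"
  unfolding skew_def
proof (intro conjI ballI impI)
  show "finite (hatV T)" using tournamentD(1)[OF T] by (simp add: hatV_def)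
  fix x y assume H: "x \<in> hatV T" "y \<in> hatV T" "x \<noteq> y"
  show "hat T x y \<noteq> hat T y x"
  proof (cases x; cases y)
    fix a b assume ab: "x = Some a" "y = Some b"
    then have "a \<in> pverts T" "b \<in> pverts T" "a \<noteq> b" using H by (auto simp: hatV_def)
    then show ?thesis using tournamentD(5)[OF T, of a b] unfolding ab hat.simps by blast
  qed (use H in auto)
qed

lemma card_hatV: "tournament T \<Longrightarrow> card (hatV T) = Suc (card (pverts T))"
  using tournamentD(1)[of T] by (simp add: hatV_def card_image image_iff)

text \<open>No vertex dominates \<open>None\<close>, so switching at \<open>None\<close> leaves the
  arcs of \<open>T\<close> as they are.\<close>

lemma side_hat_iff:
  assumes T: "tournament T"
  shows "side (hatV T) (hat T) (Some ` M) \<longleftrightarrow> is_module T M"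
proof -
  have "side (hatV T) (hat T) (Some ` M) \<longleftrightarrow> homog (hatV T - {None}) (rebase None (hat T)) (Some ` M)"
    by (rule side_iff_homog) (auto simp: hatV_def)
  also have "\<dots> \<longleftrightarrow> homog (pverts T) (\<lambda>u v. (u, v) \<in> parcs T) M"
  proof -
    have W: "hatV T - {None} = Some ` pverts T" by (auto simp: hatV_def)
    have D: "Some ` pverts T - Some ` M = Some ` (pverts T - M)" by auto
    have rb: "rebase None (hat T) (Some a) (Some b) = ((a, b) \<in> parcs T)" for a b
      by (simp add: rebase_def)
    show ?thesis unfolding homog_def W D
      by (simp only: ball_simps rb inj_image_subset_iff[OF inj_Some])
  qed
  finally show ?thesis using is_module_iff_homog[OF T] by blast
qed

text \<open>The complement contains \<open>None\<close>, so it has two points as soon as one vertex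
  is missing.\<close>

lemma nside_hat_iff:
  assumes T: "tournament T" and M: "M \<subseteq> pverts T"
  shows "nside (hatV T) (hat T) (Some ` M) \<longleftrightarrow> is_module T M \<and> 2 \<le> card M \<and> M \<noteq> pverts T"
proof -
  have f: "finite (pverts T)" using tournamentD(1)[OF T] .
  have "hatV T - Some ` M = insert None (Some ` (pverts T - M))" by (auto simp: hatV_def)
  then have c: "card (hatV T - Some ` M) = Suc (card (pverts T - M))"
    using f by (simp add: card_insert_if card_image image_iff)
  have "2 \<le> Suc (card (pverts T - M)) \<longleftrightarrow> M \<noteq> pverts T"
    using f M by (auto simp: card_gt_0_iff Suc_le_eq)
  then show ?thesis
    using side_hat_iff[OF T] c by (auto simp: nside_def card_image)
qed

lemma Some_vimage: "None \<notin> S \<Longrightarrow> Some ` (Some -` S) = S"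
  by (auto simp: image_iff) (metis not_None_eq)

lemma comodule_of_nside:
  assumes T: "tournament T" and S: "nside (hatV T) (hat T) S"
  shows "comodule T (Some -` S)"
proof -
  let ?W = "hatV T"
  have SW: "S \<subseteq> ?W" using nside_subset[OF S] .
  have V: "Some -` ?W = pverts T" by (auto simp: hatV_def)
  have SV: "Some -` S \<subseteq> pverts T" using SW V by blast
  show ?thesis
  proof (cases "None \<in> S")
    case False
    have e: "Some ` (Some -` S) = S" using Some_vimage[OF False] .
    have "is_module T (Some -` S) \<and> 2 \<le> card (Some -` S) \<and> Some -` S \<noteq> pverts T"
      using nside_hat_iff[OF T SV] S unfolding e by blast
    then show ?thesis using SV unfolding comodule_def by auto
  next
    case True
    then have e: "Some ` (Some -` (?W - S)) = ?W - S" by (intro Some_vimage) blast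
    have eq: "Some -` (?W - S) = pverts T - Some -` S" using V by blast
    have sub: "pverts T - Some -` S \<subseteq> pverts T" by blast
    have "is_module T (pverts T - Some -` S) \<and> 2 \<le> card (pverts T - Some -` S)
        \<and> pverts T - Some -` S \<noteq> pverts T"
      using nside_hat_iff[OF T sub] nside_compl[OF skew_hat[OF T] S] e unfolding eq by simp
    then show ?thesis using SV unfolding comodule_def by auto
  qed
qed

text \<open>The pairs in \<open>E\<close> avoid \<open>None\<close>, so each consists of the ends of
  exactly one arc of \<open>T\<close>; these arcs form \<open>B\<close>. Seven vertices make eight
  points with \<open>None\<close>. The sides in \<open>P\<close> are disjoint up to
  \<open>None\<close>, and removing it leaves disjoint co-modules.\<close>

lemma flips_to_indecomposable:
  assumes T: "tournament T" and c: "7 \<le> card (pverts T)"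
  obtains B P where "B \<subseteq> parcs T" "indecomposable (Inv T B)" "comodule_family T P"
    "card B \<le> (card P + 1) div 2"
proof -
  let ?W = "hatV T" and ?r = "hat T"
  have sk: "skew ?W ?r" using skew_hat[OF T] .
  have N: "None \<in> ?W" by (simp add: hatV_def)
  have c8: "8 \<le> card ?W" using card_hatV[OF T] c by simp
  obtain X P where X: "X \<subseteq> ?W - {None}" "\<forall>S. nside ?W ?r S \<longrightarrow> S \<inter> X \<noteq> {}"
    "\<forall>x\<in>X. \<exists>S. nside ?W ?r S \<and> S \<inter> X = {x}" and P: "\<forall>A\<in>P. nside ?W ?r A"
    "\<forall>A\<in>P. \<forall>B\<in>P. A \<noteq> B \<longrightarrow> A \<inter> B \<subseteq> {None}" "finite P" "card X \<le> card P"
    using irredundant_hitting[OF sk N] .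
  have "\<exists>E \<subseteq> arcs_off ?W None. finite E \<and> card E \<le> (card X + 1) div 2 \<and> prime ?W (flip E ?r)"
    by (rule flips_to_prime[OF sk c8 N X(1)]) (use X(2,3) in blast)+
  then obtain E where E: "E \<subseteq> arcs_off ?W None" "finite E" "card E \<le> (card X + 1) div 2" "prime ?W (flip E ?r)"
    by blast
  define B where "B = {(u, v) \<in> parcs T. {Some u, Some v} \<in> E}"
  have BT: "B \<subseteq> parcs T" by (auto simp: B_def)
  have inj: "inj_on (\<lambda>(u, v). {Some u, Some v}) B"
  proof (rule inj_onI, clarify)
    fix u v u' v' assume H: "(u, v) \<in> B" "(u', v') \<in> B" "{Some u, Some v} = {Some u', Some v'}"
    then have "u = u' \<and> v = v' \<or> u = v' \<and> v = u'" by (auto simp: doubleton_eq_iff)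
    moreover have "\<not> ((u, v) \<in> parcs T \<and> (v, u) \<in> parcs T)" using tournamentD[OF T] by metis
    ultimately show "u = u' \<and> v = v'" using H(1,2) BT by blast
  qed
  have "card B = card ((\<lambda>(u, v). {Some u, Some v}) ` B)" using inj by (simp add: card_image)
  also have "\<dots> \<le> card E" using E(2) by (intro card_mono) (auto simp: B_def)
  finally have cB: "card B \<le> card E" .
  have TI: "tournament (Inv T B)"
  proof -
    have T': "finite (pverts T)" "parcs T \<subseteq> pverts T \<times> pverts T" "(x, x) \<notin> parcs T"
      "x \<in> pverts T \<Longrightarrow> y \<in> pverts T \<Longrightarrow> x \<noteq> y \<Longrightarrow> (x, y) \<in> parcs T \<longleftrightarrow> (y, x) \<notin> parcs T" for x y
      using T unfolding tournament_iff by blast+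
    have sym: "(x, y) \<in> B \<Longrightarrow> (y, x) \<notin> parcs T" for x y using T'(2-4) BT by blast
    have "parcs T - B \<union> B\<inverse> \<subseteq> pverts T \<times> pverts T" using T'(2) BT by blast
    moreover have "(x, x) \<notin> parcs T - B \<union> B\<inverse>" for x using T'(3) BT by blast
    moreover have "(x, y) \<in> parcs T - B \<union> B\<inverse> \<longleftrightarrow> (y, x) \<notin> parcs T - B \<union> B\<inverse>"
      if "x \<in> pverts T" "y \<in> pverts T" "x \<noteq> y" for x y
      using T'(4)[OF that] sym[of x y] sym[of y x] BT by blast
    moreover have "parcs (Inv T B) = parcs T - B \<union> B\<inverse>" "pverts (Inv T B) = pverts T"
      by (simp_all add: Inv_def)
    ultimately show ?thesis unfolding tournament_iff using T'(1) by metis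
  qed
  have WI: "hatV (Inv T B) = ?W" by (simp add: hatV_def Inv_def)
  \<comment> \<open>Agreement at distinct points is enough, as the condition for a side never
    compares a point with itself.\<close>
  have hI: "hat (Inv T B) u v = flip E ?r u v" if uv: "u \<in> ?W" "v \<in> ?W" "u \<noteq> v" for u v
  proof (cases u)
    case None
    then have "{u, v} \<notin> E" using E(1) by (auto simp: arcs_off_def doubleton_eq_iff)
    then show ?thesis using None by (simp add: flip_def)
  next
    case (Some a)
    show ?thesis
    proof (cases v)
      case None
      then have "{u, v} \<notin> E" using E(1) by (auto simp: arcs_off_def doubleton_eq_iff)
      then show ?thesis using None Some by (simp add: flip_def)
    next
      case b: (Some b)
      have ab: "a \<in> pverts T" "b \<in> pverts T" "a \<noteq> b" using uv Some b by (auto simp: hatV_def)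
      have ba: "(a, b) \<in> parcs T \<longleftrightarrow> (b, a) \<notin> parcs T" using tournamentD(5)[OF T ab] .
      have "hat (Inv T B) u v \<longleftrightarrow> (a, b) \<in> parcs T \<and> {Some a, Some b} \<notin> E \<or> (b, a) \<in> parcs T \<and> {Some b, Some a} \<in> E"
        unfolding Some b hat.simps by (auto simp: Inv_def B_def)
      moreover have "flip E ?r u v \<longleftrightarrow> ((a, b) \<in> parcs T) \<noteq> ({Some a, Some b} \<in> E)"
        unfolding Some b flip_def hat.simps ..
      ultimately show ?thesis using ba by (simp only: insert_commute[of "Some b"]) blast
    qed
  qed
  have pI: "\<not> nside ?W (hat (Inv T B)) S" for S
  proof
    assume S: "nside ?W (hat (Inv T B)) S"
    have "side ?W (flip E ?r) S" unfolding side_def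
    proof (intro conjI ballI)
      show SW: "S \<subseteq> ?W" using nside_subset[OF S] .
      fix a a' b b' assume H: "a \<in> S" "a' \<in> S" "b \<in> ?W - S" "b' \<in> ?W - S"
      then have "(hat (Inv T B) a b = hat (Inv T B) a' b) = (hat (Inv T B) a b' = hat (Inv T B) a' b')"
        using S sideD[of ?W "hat (Inv T B)" S a a' b b'] unfolding nside_def by blast
      moreover have "a \<noteq> b" "a \<noteq> b'" "a' \<noteq> b" "a' \<noteq> b'" "a \<in> ?W" "a' \<in> ?W" "b \<in> ?W" "b' \<in> ?W"
        using H SW by blast+
      ultimately show "(flip E ?r a b = flip E ?r a' b) = (flip E ?r a b' = flip E ?r a' b')"
        using hI by simp
    qed
    then have "nside ?W (flip E ?r) S" using S by (simp add: nside_def)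
    then show False using E(4) by (simp add: prime_def)
  qed
  have "indecomposable (Inv T B)"
    unfolding indecomposable_def
  proof (intro allI impI)
    fix M assume M: "is_module (Inv T B) M"
    have VI: "pverts (Inv T B) = pverts T" by (simp add: Inv_def)
    have MV: "M \<subseteq> pverts (Inv T B)" using M by (simp add: is_module_def)
    have "\<not> (2 \<le> card M \<and> M \<noteq> pverts (Inv T B))"
      using nside_hat_iff[OF TI MV] M pI unfolding WI by blast
    moreover have "finite M" using MV VI tournamentD(1)[OF T] finite_subset by metis
    ultimately show "trivial_module (Inv T B) M"
      using MV unfolding trivial_module_def
      by (metis One_nat_def Suc_1 card_0_eq card_1_singletonE insert_subset le_Suc_eq le_zero_eq linear not_less_eq_eq)
  qed
  moreover have "comodule_family T ((\<lambda>A. Some -` A) ` P)"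
    unfolding comodule_family_def
  proof (intro conjI)
    show "finite ((\<lambda>A. Some -` A) ` P)" using P(3) by simp
    show "\<forall>M\<in>(\<lambda>A. Some -` A) ` P. comodule T M" using comodule_of_nside[OF T] P(1) by blast
    show "pairwise disjnt ((\<lambda>A. Some -` A) ` P)"
      unfolding pairwise_def disjnt_def using P(2) by fastforce
  qed
  moreover have "card ((\<lambda>A. Some -` A) ` P) = card P"
  proof (rule card_image, rule inj_onI)
    fix A B assume H: "A \<in> P" "B \<in> P" "Some -` A = Some -` B"
    have "Some -` A \<noteq> {}" using comodule_of_nside[OF T] P(1) H(1) by (simp add: comodule_def)
    then obtain x where "Some x \<in> A" by auto
    then have "Some x \<in> A \<inter> B" using H(3) by auto
    then show "A = B" using P(2) H(1,2) by blast
  qed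
  ultimately show thesis using that[of B "(\<lambda>A. Some -` A) ` P"] BT cB E(3) P(4)
    by (metis (no_types, lifting) add_le_mono1 div_le_mono le_trans)
qed

section \<open>The decomposability index\<close>

lemma finite_parcs: "tournament T \<Longrightarrow> finite (parcs T)"
  unfolding tournament_iff by (meson finite_SigmaI finite_subset)

lemma decomposability_index_le:
  assumes T: "tournament T" and c: "7 \<le> card (pverts T)"
  obtains P where "comodule_family T P" "decomposability_index T \<le> (card P + 1) div 2"
proof -
  obtain B P where B: "B \<subseteq> parcs T" "indecomposable (Inv T B)" "comodule_family T P"
    "card B \<le> (card P + 1) div 2"
    using flips_to_indecomposable[OF T c] .
  have "decomposability_index T \<le> card B"
    unfolding decomposability_index_def by (rule Least_le) (use B in blast)
  then show thesis using that B by simp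
qed

lemma decomposability_index_ge:
  assumes T: "tournament T" and c: "7 \<le> card (pverts T)" and P: "comodule_family T P"
  shows "card P \<le> 2 * decomposability_index T"
proof -
  \<comment> \<open>Some set of arcs with indecomposable result must exist before anything can be
    read off the \<open>LEAST\<close> in the definition.\<close>
  obtain B0 where "B0 \<subseteq> parcs T" "indecomposable (Inv T B0)"
    using flips_to_indecomposable[OF T c] by metis
  then have "\<exists>m. \<exists>B\<subseteq>parcs T. card B = m \<and> indecomposable (Inv T B)" by blast
  from LeastI_ex[OF this] obtain B where
    B: "B \<subseteq> parcs T" "card B = decomposability_index T" "indecomposable (Inv T B)"
    unfolding decomposability_index_def by blast
  have "finite B" using B(1) finite_parcs[OF T] finite_subset by blast
  then show ?thesis using comodule_family_le[OF T _ B(3) P] B(2) by simp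
qed

lemma comodule_finite: "tournament T \<Longrightarrow> comodule T M \<Longrightarrow> finite M"
  using tournamentD(1) finite_subset unfolding comodule_def by blast

lemma comodule_singleton:
  assumes T: "tournament T" and s: "comodule T {s}"
  shows "s \<in> pverts T" "(\<forall>v\<in>pverts T - {s}. (s, v) \<in> parcs T) \<or> (\<forall>v\<in>pverts T - {s}. (v, s) \<in> parcs T)"
proof -
  show sV: "s \<in> pverts T" using s by (simp add: comodule_def)
  have m: "is_module T (pverts T - {s})" using s by (simp add: comodule_def)
  have eq: "(s, x) \<in> parcs T \<longleftrightarrow> (s, y) \<in> parcs T" if "x \<in> pverts T - {s}" "y \<in> pverts T - {s}" for x y
    using is_moduleD[OF m that sV] by blast
  have anti: "(s, v) \<in> parcs T \<or> (v, s) \<in> parcs T" if "v \<in> pverts T - {s}" for v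
    using tournamentD(5)[OF T sV, of v] that by blast
  show "(\<forall>v\<in>pverts T - {s}. (s, v) \<in> parcs T) \<or> (\<forall>v\<in>pverts T - {s}. (v, s) \<in> parcs T)"
    using eq anti by blast
qed

text \<open>Two sources would dominate each other, and so would two sinks.\<close>

lemma card_comodule_singletons:
  assumes T: "tournament T"
  shows "finite {s. comodule T {s}}" "card {s. comodule T {s}} \<le> 2"
proof -
  let ?A = "{s \<in> pverts T. \<forall>v\<in>pverts T - {s}. (s, v) \<in> parcs T}"
  let ?B = "{s \<in> pverts T. \<forall>v\<in>pverts T - {s}. (v, s) \<in> parcs T}"
  have sub: "{s. comodule T {s}} \<subseteq> ?A \<union> ?B" using comodule_singleton[OF T] by blast
  have f: "finite ?A" "finite ?B" using tournamentD(1)[OF T] by auto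
  then show "finite {s. comodule T {s}}" using sub finite_subset by blast
  have asym: "\<not> ((s, t) \<in> parcs T \<and> (t, s) \<in> parcs T)" for s t using tournamentD[OF T] by metis
  have "card ?A \<le> Suc 0" "card ?B \<le> Suc 0"
    unfolding card_le_Suc0_iff_eq[OF f(1)] card_le_Suc0_iff_eq[OF f(2)] using asym by blast+
  then show "card {s. comodule T {s}} \<le> 2"
    using card_mono[OF _ sub] f card_Un_le[of ?A ?B] by simp
qed

lemma sum_card_comodule_family:
  assumes T: "tournament T" and P: "comodule_family T P"
  shows "(\<Sum>M\<in>P. card M) = card (\<Union>P)" "card (\<Union>P) \<le> card (pverts T)"
proof -
  have "card (\<Union>P) = sum card P"
    using P comodule_finite[OF T] by (intro card_Union_disjoint) (auto simp: comodule_family_def)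
  then show "(\<Sum>M\<in>P. card M) = card (\<Union>P)" by simp
  have "\<Union>P \<subseteq> pverts T" using P unfolding comodule_family_def comodule_def by blast
  then show "card (\<Union>P) \<le> card (pverts T)" using tournamentD(1)[OF T] by (intro card_mono)
qed

text \<open>Counting every singleton twice gives each member weight at least two, and there are at
  most two singletons, a source and a sink.\<close>

lemma comodule_family_bound:
  assumes T: "tournament T" and P: "comodule_family T P"
  shows "2 * card P \<le> card (pverts T) + 2"
proof -
  let ?S = "{M \<in> P. card M = 1}"
  have fP: "finite P" using P by (simp add: comodule_family_def)
  have pos: "1 \<le> card M" if "M \<in> P" for M
  proof -
    have "comodule T M" using P that by (simp add: comodule_family_def)
    then have "finite M" "M \<noteq> {}" using comodule_finite[OF T] unfolding comodule_def by blast+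
    then show ?thesis by (simp add: Suc_le_eq card_gt_0_iff)
  qed
  have "?S \<subseteq> (\<lambda>s. {s}) ` {s. comodule T {s}}"
  proof
    fix M assume M: "M \<in> ?S"
    then obtain s where "M = {s}" by (auto simp: card_1_singleton_iff)
    then show "M \<in> (\<lambda>s. {s}) ` {s. comodule T {s}}" using M P by (auto simp: comodule_family_def)
  qed
  then have "card ?S \<le> card ((\<lambda>s. {s}) ` {s. comodule T {s}})"
    using card_comodule_singletons(1)[OF T] by (intro card_mono) auto
  also have "\<dots> \<le> 2"
    using card_comodule_singletons[OF T] card_image_le[of "{s. comodule T {s}}" "\<lambda>s. {s}"] by linarith
  finally have S2: "card ?S \<le> 2" .
  have "(\<Sum>M\<in>P. 2) \<le> (\<Sum>M\<in>P. card M + (if card M = 1 then 1 else 0))"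
  proof (rule sum_mono)
    fix M assume "M \<in> P"
    then show "2 \<le> card M + (if card M = 1 then 1 else 0)" using pos[of M] by auto
  qed
  also have "\<dots> = (\<Sum>M\<in>P. card M) + card ?S"
    using fP by (simp add: sum.distrib sum.If_cases Int_def)
  finally show ?thesis using S2 sum_card_comodule_family[OF T P] by simp
qed

lemma comodule_family_subset: "comodule_family T P \<Longrightarrow> Q \<subseteq> P \<Longrightarrow> comodule_family T Q"
  unfolding comodule_family_def by (meson finite_subset pairwise_subset subset_iff)

text \<open>A disjoint family with at least two nonempty members contains no improper ones.\<close>

lemma comodule_familyI:
  assumes "finite P" "pairwise disjnt P" "2 \<le> card P"
    "\<And>M. M \<in> P \<Longrightarrow> M \<subseteq> pverts T \<and> M \<noteq> {} \<and>
      (is_module T M \<and> 2 \<le> card M \<or> is_module T (pverts T - M) \<and> 2 \<le> card (pverts T - M))"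
  shows "comodule_family T P"
proof -
  have "M \<noteq> pverts T" if M: "M \<in> P" for M
  proof -
    obtain N where "N \<in> P" "N \<noteq> M" using card_ge2E[OF assms(3) M] by blast
    then show ?thesis using assms(2) assms(4)[of N] M unfolding pairwise_def disjnt_def by blast
  qed
  then show ?thesis using assms unfolding comodule_family_def comodule_def by blast
qed

text \<open>A family has at most \<open>2 * n + 2\<close> members, so \<open>n + 1\<close> reversals
  suffice; and \<open>2 * n + 1\<close> members already require \<open>n + 1\<close>, each arc
  having two ends. A larger family is cut down to \<open>2 * n + 1\<close> members.\<close>

lemma decomposability_index_iff:
  assumes T: "tournament T" and n: "1 \<le> n" and c: "card (pverts T) = 4 * n + 3"
  shows "decomposability_index T \<le> n + 1"
    "decomposability_index T = n + 1 \<longleftrightarrow> (\<exists>P. comodule_family T P \<and> card P = 2 * n + 1)"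
proof -
  have c7: "7 \<le> card (pverts T)" using n c by simp
  obtain P where P: "comodule_family T P" "decomposability_index T \<le> (card P + 1) div 2"
    using decomposability_index_le[OF T c7] .
  show le: "decomposability_index T \<le> n + 1" using P(2) comodule_family_bound[OF T P(1)] c by linarith
  show "decomposability_index T = n + 1 \<longleftrightarrow> (\<exists>P. comodule_family T P \<and> card P = 2 * n + 1)"
  proof
    assume "decomposability_index T = n + 1"
    then have "2 * n + 1 \<le> card P" using P(2) by linarith
    then obtain Q where "Q \<subseteq> P" "card Q = 2 * n + 1" using obtain_subset_with_card_n by metis
    then show "\<exists>P. comodule_family T P \<and> card P = 2 * n + 1" using comodule_family_subset[OF P(1)] by blast
  next
    assume "\<exists>P. comodule_family T P \<and> card P = 2 * n + 1"
    then show "decomposability_index T = n + 1" using decomposability_index_ge[OF T c7] le by fastforce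
  qed
qed

lemma tournament_transitive: "tournament (transitive_tournament k)"
  unfolding tournament_iff transitive_tournament_def by auto

text \<open>The witness for the maximum: consecutive vertices in pairs, with the last vertex left
  over.\<close>

lemma transitive_tournament_family:
  assumes "1 \<le> n"
  shows "\<exists>P. comodule_family (transitive_tournament (4 * n + 3)) P \<and> card P = 2 * n + 1"
proof -
  let ?T = "transitive_tournament (4 * n + 3)" and ?P = "(\<lambda>i. {2 * i, 2 * i + 1}) ` {..<2 * n + 1}"
  have inj: "inj_on (\<lambda>i. {2 * i, 2 * i + 1}) {..<2 * n + 1}"
  proof (rule inj_onI)
    fix i j :: nat assume "{2 * i, 2 * i + 1} = {2 * j, 2 * j + 1}"
    then have "2 * i \<in> {2 * j, 2 * j + 1}" by blast
    then show "i = j" by auto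
  qed
  then have c: "card ?P = 2 * n + 1" by (simp add: card_image)
  have "comodule_family ?T ?P"
  proof (rule comodule_familyI)
    show "pairwise disjnt ?P"
    proof (rule pairwiseI)
      fix x y assume "x \<in> ?P" "y \<in> ?P" "x \<noteq> y"
      then obtain i j where "x = {2 * i, 2 * i + 1}" "y = {2 * j, 2 * j + 1}" "i \<noteq> j" by blast
      then show "disjnt x y" unfolding disjnt_def by auto
    qed
    show "2 \<le> card ?P" using c assms by linarith
    fix M assume "M \<in> ?P"
    then obtain i where i: "M = {2 * i, 2 * i + 1}" "i < 2 * n + 1" by blast
    have sub: "M \<subseteq> pverts ?T" using i by (simp add: transitive_tournament_def)
    have "is_module ?T M" unfolding is_module_def
    proof (intro conjI ballI)
      fix x y v assume H: "x \<in> M" "y \<in> M" "v \<in> pverts ?T - M"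
      then have "v < 2 * i \<or> 2 * i + 1 < v" using i by auto
      then show "(v, x) \<in> parcs ?T \<longleftrightarrow> (v, y) \<in> parcs ?T"
        using H i by (auto simp: transitive_tournament_def)
    qed (rule sub)
    then show "M \<subseteq> pverts ?T \<and> M \<noteq> {} \<and>
      (is_module ?T M \<and> 2 \<le> card M \<or> is_module ?T (pverts ?T - M) \<and> 2 \<le> card (pverts ?T - M))"
      using sub i by simp
  qed simp
  then show ?thesis using c by blast
qed

lemma max_decomposability_index_eq:
  assumes n: "1 \<le> n"
  shows "max_decomposability_index (4 * n + 3) = n + 1"
  unfolding max_decomposability_index_def
proof (rule Max_eqI)
  let ?S = "{decomposability_index T |T :: nat pair_pre_digraph. tournament T \<and> card (pverts T) = 4 * n + 3}"
  have le: "m \<le> n + 1" if "m \<in> ?S" for m using that decomposability_index_iff(1)[OF _ n] by blast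
  then have "?S \<subseteq> {..n + 1}" by blast
  then show "finite ?S" using finite_subset by blast
  show "m \<le> n + 1" if "m \<in> ?S" for m using le that .
  have c: "card (pverts (transitive_tournament (4 * n + 3))) = 4 * n + 3"
    by (simp add: transitive_tournament_def)
  have "decomposability_index (transitive_tournament (4 * n + 3)) = n + 1"
    using decomposability_index_iff(2)[OF tournament_transitive n c] transitive_tournament_family[OF n] by blast
  then show "n + 1 \<in> ?S" using tournament_transitive c by (metis (mono_tags, lifting) mem_Collect_eq)
qed

lemma delta_maximal_iff:
  assumes "1 \<le> n" "tournament T"
  shows "T \<in> delta_maximal (4 * n + 3) \<longleftrightarrow>
    card (pverts T) = 4 * n + 3 \<and> (\<exists>P. comodule_family T P \<and> card P = 2 * n + 1)"
  unfolding delta_maximal_def max_decomposability_index_eq[OF assms(1)]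
  using decomposability_index_iff(2)[OF assms(2,1)] assms(2) by blast

section \<open>Isomorphisms and small tournaments\<close>

text \<open>The isomorphisms of the library also carry maps for arcs and their ends; in pair
  digraphs the vertex map determines these, and only it is kept.\<close>

definition tiso :: "'a pair_pre_digraph \<Rightarrow> 'b pair_pre_digraph \<Rightarrow> ('a \<Rightarrow> 'b) \<Rightarrow> bool" where
  "tiso T S f \<longleftrightarrow> bij_betw f (pverts T) (pverts S) \<and>
     (\<forall>u\<in>pverts T. \<forall>v\<in>pverts T. (u, v) \<in> parcs T \<longleftrightarrow> (f u, f v) \<in> parcs S)"

lemma tournament_iso_iff:
  assumes T: "tournament T" and S: "tournament S"
  shows "tournament_iso T S \<longleftrightarrow> (\<exists>f. tiso T S f)"
proof
  assume "tournament_iso T S"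
  then obtain h where h: "pre_digraph.digraph_isomorphism (with_proj T) h"
    "with_proj S = app_iso h (with_proj T)"
    unfolding digraph_iso_def by blast
  let ?f = "iso_verts h"
  have inj: "inj_on ?f (pverts T)" using h(1) by (simp add: pre_digraph.digraph_isomorphism_def)
  have V: "pverts S = ?f ` pverts T" using arg_cong[OF h(2), of verts] by simp
  have A: "parcs S = iso_arcs h ` parcs T" using arg_cong[OF h(2), of arcs] by simp
  have fs: "iso_tail h = fst" "iso_head h = snd"
    using arg_cong[OF h(2), of tail] arg_cong[OF h(2), of head] by simp_all
  have "iso_arcs h (u, v) = (?f u, ?f v)" if "(u, v) \<in> parcs T" for u v
    using h(1) that by (auto simp: pre_digraph.digraph_isomorphism_def fs prod_eq_iff)
  then have S': "parcs S = (\<lambda>(u, v). (?f u, ?f v)) ` parcs T" unfolding A by (intro image_cong) auto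
  have "(u, v) \<in> parcs T \<longleftrightarrow> (?f u, ?f v) \<in> parcs S" if uv: "u \<in> pverts T" "v \<in> pverts T" for u v
  proof
    assume "(u, v) \<in> parcs T"
    then show "(?f u, ?f v) \<in> parcs S" unfolding S' by (rule rev_image_eqI) simp
  next
    assume "(?f u, ?f v) \<in> parcs S"
    then obtain u' v' where "(u', v') \<in> parcs T" "?f u' = ?f u" "?f v' = ?f v" unfolding S' by auto
    then show "(u, v) \<in> parcs T" using inj_onD[OF inj] uv tournamentD(2,3)[OF T] by metis
  qed
  then show "\<exists>f. tiso T S f" using inj V by (auto simp: tiso_def bij_betw_def)
next
  assume "\<exists>f. tiso T S f"
  then obtain f where b: "bij_betw f (pverts T) (pverts S)"
    and arc: "\<And>u v. u \<in> pverts T \<Longrightarrow> v \<in> pverts T \<Longrightarrow> (u, v) \<in> parcs T \<longleftrightarrow> (f u, f v) \<in> parcs S"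
    unfolding tiso_def by blast
  let ?h = "\<lparr>iso_verts = f, iso_arcs = map_prod f f, iso_head = snd, iso_tail = fst\<rparr>"
  have sub: "parcs T \<subseteq> pverts T \<times> pverts T" "parcs S \<subseteq> pverts S \<times> pverts S"
    using T S by (simp_all add: tournament_iff)
  have inj: "inj_on f (pverts T)" and im: "f ` pverts T = pverts S" using b by (auto simp: bij_betw_def)
  have "inj_on (map_prod f f) (pverts T \<times> pverts T)" using inj by (auto simp: inj_on_def)
  then have inja: "inj_on (map_prod f f) (parcs T)" using sub(1) inj_on_subset by blast
  have wf: "wf_digraph (with_proj T)" using sub(1) by unfold_locales auto
  have iso: "pre_digraph.digraph_isomorphism (with_proj T) ?h"
    using wf inj inja by (simp add: pre_digraph.digraph_isomorphism_def)
  have "map_prod f f ` parcs T = parcs S"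
  proof
    show "map_prod f f ` parcs T \<subseteq> parcs S" using arc sub(1) by auto
    show "parcs S \<subseteq> map_prod f f ` parcs T"
    proof clarify
      fix a b assume ab: "(a, b) \<in> parcs S"
      then obtain u v where "u \<in> pverts T" "v \<in> pverts T" "a = f u" "b = f v" using sub(2) im by blast
      then show "(a, b) \<in> map_prod f f ` parcs T" using arc ab by force
    qed
  qed
  then have "with_proj S = app_iso ?h (with_proj T)" using im by (simp add: app_iso_def with_proj_def)
  then show "tournament_iso T S" using iso unfolding digraph_iso_def by blast
qed

lemma tisoD:
  assumes "tiso T S f"
  shows "inj_on f (pverts T)" "f ` pverts T = pverts S"
    "u \<in> pverts T \<Longrightarrow> v \<in> pverts T \<Longrightarrow> (u, v) \<in> parcs T \<longleftrightarrow> (f u, f v) \<in> parcs S"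
  using assms by (auto simp: tiso_def bij_betw_def)

text \<open>The list gives the vertex of \<open>T\<close> for each label of \<open>S\<close>. Arcs
  have to be checked in one direction only, because in a tournament a missing arc is a reversed
  one.\<close>

lemma tiso_of_list:
  assumes T: "tournament T" and S: "tournament S" and V: "pverts S = {..<length ps}"
    and ps: "distinct ps" "set ps = pverts T"
    and arcs: "\<And>i j. (i, j) \<in> parcs S \<Longrightarrow> (ps ! i, ps ! j) \<in> parcs T"
  shows "\<exists>f. tiso T S f"
proof -
  have b: "bij_betw ((!) ps) (pverts S) (pverts T)"
    using bij_betw_nth[OF ps(1) V[symmetric, THEN sym]] ps(2) V by (simp add: bij_betw_nth)
  let ?f = "the_inv_into (pverts S) ((!) ps)"
  have bf: "bij_betw ?f (pverts T) (pverts S)" using bij_betw_the_inv_into[OF b] .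
  have inv: "ps ! (?f u) = u" if "u \<in> pverts T" for u
    using that b f_the_inv_into_f_bij_betw by metis
  have "(u, v) \<in> parcs T \<longleftrightarrow> (?f u, ?f v) \<in> parcs S" if uv: "u \<in> pverts T" "v \<in> pverts T" for u v
  proof (cases "u = v")
    case True then show ?thesis using tournamentD(4)[OF T] tournamentD(4)[OF S] by simp
  next
    case False
    have fS: "?f u \<in> pverts S" "?f v \<in> pverts S" using bf uv by (auto simp: bij_betw_def)
    have "?f u \<noteq> ?f v" using inv uv False by metis
    then have "(?f u, ?f v) \<in> parcs S \<longleftrightarrow> (?f v, ?f u) \<notin> parcs S" using tournamentD(5)[OF S fS] by blast
    moreover have "(u, v) \<in> parcs T \<longleftrightarrow> (v, u) \<notin> parcs T" using tournamentD(5)[OF T uv False] .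
    moreover have "(?f u, ?f v) \<in> parcs S \<Longrightarrow> (u, v) \<in> parcs T" "(?f v, ?f u) \<in> parcs S \<Longrightarrow> (v, u) \<in> parcs T"
      using arcs inv uv by metis+
    ultimately show ?thesis by blast
  qed
  then show ?thesis using bf unfolding tiso_def by blast
qed

lemma tournament_C3: "tournament C3"
  unfolding tournament_iff C3_def by auto

lemma parcs_U5: "parcs U5 = {(0,1),(0,2),(1,2),(3,0),(1,3),(2,3),(4,0),(4,1),(2,4),(3,4)}"
  and parcs_V5: "parcs V5 = {(0,1),(0,2),(1,2),(3,0),(1,3),(2,3),(4,0),(4,1),(2,4),(4,3)}"
  and parcs_W5: "parcs W5 = {(0,1),(0,2),(1,2),(0,3),(1,3),(2,3),(4,0),(4,2),(1,4),(3,4)}"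
proof -
  have t3: "parcs (transitive_tournament 3) = {(0,1),(0,2),(1,2)}"
    by (auto simp: transitive_tournament_def)
  have t4: "parcs (transitive_tournament 4) = {(0,1),(0,2),(1,2),(0,3),(1,3),(2,3)}"
    by (auto simp: transitive_tournament_def)
  show "parcs U5 = {(0,1),(0,2),(1,2),(3,0),(1,3),(2,3),(4,0),(4,1),(2,4),(3,4)}"
    unfolding U5_def t3 by auto
  then show "parcs V5 = {(0,1),(0,2),(1,2),(3,0),(1,3),(2,3),(4,0),(4,1),(2,4),(4,3)}"
    by (simp add: V5_def insert_Diff_if insert_commute)
  show "parcs W5 = {(0,1),(0,2),(1,2),(0,3),(1,3),(2,3),(4,0),(4,2),(1,4),(3,4)}"
    by (simp add: W5_def t4 insert_commute)
qed

lemma pverts_S5: "S \<in> {U5, V5, W5} \<Longrightarrow> pverts S = {0, 1, 2, 3, 4}"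
  by (auto simp: U5_def V5_def W5_def)

lemma tournament_S5: "S \<in> {U5, V5, W5} \<Longrightarrow> tournament S"
proof -
  have V: "pverts U5 = {0, 1, 2, 3, 4}" "pverts V5 = {0, 1, 2, 3, 4}" "pverts W5 = {0, 1, 2, 3, 4}"
    using pverts_S5 by blast+
  have "tournament U5" "tournament V5" "tournament W5"
    unfolding tournament_iff V parcs_U5 parcs_V5 parcs_W5 by (simp_all, auto)
  then show "S \<in> {U5, V5, W5} \<Longrightarrow> tournament S" by blast
qed

text \<open>Without a 3-cycle, a vertex \<open>m\<close> of largest out-degree beats everything:
  whoever beat \<open>m\<close> would also beat all that \<open>m\<close> beats. Then
  \<open>A - {m}\<close> is a nontrivial module.\<close>

lemma ex_three_cycle:
  assumes sk: "skew A g" and c: "3 \<le> card A"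
    and ind: "\<And>B. homog A g B \<Longrightarrow> B \<noteq> A \<Longrightarrow> card B < 2"
  shows "\<exists>a b c. {a, b, c} \<subseteq> A \<and> a \<noteq> b \<and> b \<noteq> c \<and> a \<noteq> c \<and> g a b \<and> g b c \<and> g c a"
proof (rule ccontr)
  assume n: "\<not> ?thesis"
  have no: False if "a \<in> A" "b \<in> A" "c \<in> A" "a \<noteq> b" "b \<noteq> c" "a \<noteq> c" "g a b" "g b c" "g c a" for a b c
    using n that by blast
  have fA: "finite A" using sk by (simp add: skew_def)
  have "A \<noteq> {}" using c by auto
  then obtain a0 where a0: "a0 \<in> A" by blast
  define out where "out a = {v \<in> A. v \<noteq> a \<and> g a v}" for a
  have fo: "finite (out a)" for a using fA by (simp add: out_def)
  have "card (out a) < Suc (card A)" for a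
    using fA by (auto simp: out_def less_Suc_eq_le intro!: card_mono)
  then obtain m where m: "m \<in> A" "\<And>a. a \<in> A \<Longrightarrow> card (out a) \<le> card (out m)"
    using ex_has_greatest_nat[of "\<lambda>a. a \<in> A" a0 "\<lambda>a. card (out a)" "Suc (card A)"] a0 by auto
  have dom: "g m u" if u: "u \<in> A" "u \<noteq> m" for u
  proof (rule ccontr)
    assume "\<not> g m u"
    then have um: "g u m" using skewD[OF sk u(1) m(1) u(2)] by blast
    have "insert m (out m) \<subseteq> out u"
    proof
      fix v assume v: "v \<in> insert m (out m)"
      show "v \<in> out u"
      proof (cases "v = m")
        case True then show ?thesis using um m u by (simp add: out_def)
      next
        case False
        then have mv: "v \<in> A" "g m v" using v by (auto simp: out_def)
        have vu: "v \<noteq> u" using mv \<open>\<not> g m u\<close> by blast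
        then have "\<not> g v u" using no[of u m v] u m mv um False by blast
        then have "g u v" using skewD[OF sk mv(1) u(1) vu] by blast
        then show ?thesis using mv vu by (simp add: out_def)
      qed
    qed
    then have "card (insert m (out m)) \<le> card (out u)" using fo by (intro card_mono)
    moreover have "m \<notin> out m" by (simp add: out_def)
    ultimately show False using m(2)[OF u(1)] fo by simp
  qed
  have "homog A g (A - {m})" unfolding homog_def
  proof (intro conjI ballI)
    fix a a' b assume H: "a \<in> A - {m}" "a' \<in> A - {m}" "b \<in> A - (A - {m})"
    then have "b = m" by blast
    then show "g a b = g a' b" using dom[of a] dom[of a'] skewD[OF sk, of a m] skewD[OF sk, of a' m] H m by blast
  qed blast
  then have "card (A - {m}) < 2" using ind m(1) by blast
  then show False using c m(1) fA by simp
qed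

text \<open>A 3-cycle is no module here, so some \<open>d\<close> treats its vertices differently
  and beats one or two of them. Either way a relabelling yields the same four-vertex tournament, the
  strong one.\<close>

lemma ex_strong_four:
  assumes sk: "skew A g" and c: "4 \<le> card A"
    and ind: "\<And>B. homog A g B \<Longrightarrow> B \<noteq> A \<Longrightarrow> card B < 2"
  shows "\<exists>a b c d. {a, b, c, d} \<subseteq> A \<and> distinct [a, b, c, d] \<and>
    g a b \<and> g b c \<and> g b d \<and> g c a \<and> g d a \<and> g c d"
proof -
  obtain a b c where abc: "{a, b, c} \<subseteq> A" "a \<noteq> b" "b \<noteq> c" "a \<noteq> c" "g a b" "g b c" "g c a"
    using ex_three_cycle[OF sk _ ind] c by auto
  have c3: "card {a, b, c} = 3" using abc by simp
  then have "{a, b, c} \<noteq> A" using c by force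
  then have "\<not> homog A g {a, b, c}" using ind[of "{a, b, c}"] c3 by linarith
  then obtain d where d: "d \<in> A" "d \<notin> {a, b, c}" "\<not> (g a d = g b d \<and> g b d = g c d)"
    using abc(1) unfolding homog_def by blast
  have s: "g d a = (\<not> g a d)" "g d b = (\<not> g b d)" "g d c = (\<not> g c d)"
    using skewD[OF sk] d abc by blast+
  have fin: ?thesis
    if "{p, q, r} = {a, b, c}" "p \<noteq> q" "q \<noteq> r" "p \<noteq> r" "g p q" "g q r" "g r p"
      "g q d \<and> g r d \<and> g d p \<or> g p d \<and> g d q \<and> g d r" for p q r
  proof -
    have in': "{p, q, r, d} \<subseteq> A" "d \<noteq> p" "d \<noteq> q" "d \<noteq> r" using that(1) abc(1) d by blast+
    from that(8) show ?thesis
    proof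
      assume "g q d \<and> g r d \<and> g d p"
      then show ?thesis
        by (intro exI[of _ p] exI[of _ q] exI[of _ r] exI[of _ d]) (use in' that(2-7) in simp)
    next
      assume "g p d \<and> g d q \<and> g d r"
      then show ?thesis
        by (intro exI[of _ r] exI[of _ p] exI[of _ d] exI[of _ q]) (use in' that(2-7) in simp)
    qed
  qed
  have "{b, c, a} = {a, b, c}" "{c, a, b} = {a, b, c}" by blast+
  moreover have "g b d \<and> g c d \<and> g d a \<or> g a d \<and> g d b \<and> g d c \<or>
     g c d \<and> g a d \<and> g d b \<or> g b d \<and> g d c \<and> g d a \<or>
     g a d \<and> g b d \<and> g d c \<or> g c d \<and> g d a \<and> g d b" using d(3) s by argo
  ultimately show ?thesis using fin[of a b c] fin[of b c a] fin[of c a b] abc(2-7) by metis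
qed

text \<open>In the strong subtournament \<open>c\<close> and \<open>d\<close> are twins, so the
  fifth vertex \<open>e\<close> must tell them apart, and it must not make \<open>{c, d, e}\<close>
  a module. Six patterns remain for the arcs at \<open>e\<close>; each list \<open>ps\<close> gives
  the vertices in the order of the labels of \<open>U5\<close>, \<open>V5\<close> or
  \<open>W5\<close>.\<close>

lemma five_vertices:
  assumes sk: "skew A g" and c: "card A = 5"
    and ind: "\<And>B. homog A g B \<Longrightarrow> B \<noteq> A \<Longrightarrow> card B < 2"
  shows "\<exists>S\<in>{U5, V5, W5}. \<exists>ps. distinct ps \<and> set ps = A \<and> (\<forall>(i, j)\<in>parcs S. g (ps ! i) (ps ! j))"
proof -
  have fA: "finite A" using sk by (simp add: skew_def)
  obtain a b c d where q: "{a, b, c, d} \<subseteq> A" "distinct [a, b, c, d]"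
    "g a b" "g b c" "g b d" "g c a" "g d a" "g c d"
    using ex_strong_four[OF sk _ ind] c by auto
  have "card (A - {a, b, c, d}) = 1" using q(1,2) fA c by (simp add: card_Diff_subset)
  then obtain e where "A - {a, b, c, d} = {e}" by (auto simp: card_1_singleton_iff)
  then have A: "A = {a, b, c, d, e}" and e: "e \<notin> {a, b, c, d}" using q(1) by blast+
  have s: "g e a = (\<not> g a e)" "g e b = (\<not> g b e)" "g e c = (\<not> g c e)" "g e d = (\<not> g d e)"
    using skewD[OF sk] A e by blast+
  have sk': "g x y = (\<not> g y x)" if "x \<in> A" "y \<in> A" "x \<noteq> y" for x y using skewD[OF sk that] .
  have "card {c, d} = 2" "{c, d} \<noteq> A" using q(2) e A by auto
  then have "\<not> homog A g {c, d}" using ind[of "{c, d}"] by auto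
  moreover have "g c a = g d a" "g c b = g d b" using q sk'[of c b] sk'[of d b] by auto
  ultimately have ce: "g c e \<noteq> g d e" using A unfolding homog_def by blast
  have "card {c, d, e} = 3" "{c, d, e} \<noteq> A" using q(2) e A by auto
  then have "\<not> homog A g {c, d, e}" using ind[of "{c, d, e}"] by auto
  then have cde: "\<not> (g e a \<and> g b e)"
    using A q s sk'[of c b] sk'[of d b] q(1) unfolding homog_def by auto
  consider "g a e" "g b e" "g c e" "g e d" | "g a e" "g b e" "g e c" "g d e" | "g a e" "g e b" "g c e" "g e d"
    | "g a e" "g e b" "g e c" "g d e" | "g e a" "g e b" "g c e" "g e d" | "g e a" "g e b" "g e c" "g d e"
    using ce cde s by argo
  then show ?thesis
  proof cases
    case 1
    then show ?thesis
      by (intro bexI[of _ W5] exI[of _ "[b, c, e, d, a]"]) (use q e A in \<open>auto simp: parcs_W5\<close>)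
  next
    case 2
    then show ?thesis
      by (intro bexI[of _ V5] exI[of _ "[c, d, a, e, b]"]) (use q e A in \<open>auto simp: parcs_V5\<close>)
  next
    case 3
    then show ?thesis
      by (intro bexI[of _ V5] exI[of _ "[a, e, b, d, c]"]) (use q e A in \<open>auto simp: parcs_V5\<close>)
  next
    case 4
    then show ?thesis
      by (intro bexI[of _ U5] exI[of _ "[e, b, c, d, a]"]) (use q e A in \<open>auto simp: parcs_U5\<close>)
  next
    case 5
    then show ?thesis
      by (intro bexI[of _ W5] exI[of _ "[c, e, d, a, b]"]) (use q e A in \<open>auto simp: parcs_W5\<close>)
  next
    case 6
    then show ?thesis
      by (intro bexI[of _ V5] exI[of _ "[b, c, d, a, e]"]) (use q e A in \<open>auto simp: parcs_V5\<close>)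
  qed
qed

section \<open>Lexicographic sums\<close>

definition induced :: "'a pair_pre_digraph \<Rightarrow> 'a set \<Rightarrow> 'a pair_pre_digraph" where
  "induced T M = \<lparr>pverts = M, parcs = parcs T \<inter> M \<times> M\<rparr>"

lemma induced_simps [simp]:
  "pverts (induced T M) = M" "(u, v) \<in> parcs (induced T M) \<longleftrightarrow> (u, v) \<in> parcs T \<and> u \<in> M \<and> v \<in> M"
  by (auto simp: induced_def)

lemma tournament_induced:
  assumes "tournament T" "M \<subseteq> pverts T" shows "tournament (induced T M)"
proof -
  note T = tournamentD[OF assms(1)]
  have "((x, y) \<in> parcs (induced T M)) = ((y, x) \<notin> parcs (induced T M))"
    if "x \<in> M" "y \<in> M" "x \<noteq> y" for x y
    using T(5)[of x y] that assms(2) by auto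
  moreover have "finite M" using T(1) assms(2) finite_subset by blast
  moreover have "(x, x) \<notin> parcs (induced T M)" for x using T(4) by simp
  moreover have "parcs (induced T M) \<subseteq> M \<times> M" by auto
  ultimately show ?thesis unfolding tournament_iff induced_simps(1) by blast
qed

lemma is_module_induced:
  assumes "is_module T M" "M \<subseteq> K" "K \<subseteq> pverts T" shows "is_module (induced T K) M"
  unfolding is_module_def
proof (intro conjI ballI)
  fix x y v assume H: "x \<in> M" "y \<in> M" "v \<in> pverts (induced T K) - M"
  have "(v, x) \<in> parcs T \<longleftrightarrow> (v, y) \<in> parcs T"
    using is_moduleD[OF assms(1) H(1,2), of v] H(3) assms(3) by auto
  then show "(v, x) \<in> parcs (induced T K) \<longleftrightarrow> (v, y) \<in> parcs (induced T K)" using H assms(2) by auto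
qed (use assms in auto)

lemma is_module_trans:
  assumes "is_module T K" "is_module (induced T K) M" shows "is_module T M"
  unfolding is_module_def
proof (intro conjI ballI)
  have MK: "M \<subseteq> K" using assms(2) by (simp add: is_module_def)
  have KV: "K \<subseteq> pverts T" using assms(1) by (simp add: is_module_def)
  show "M \<subseteq> pverts T" using MK KV by blast
  fix x y v assume H: "x \<in> M" "y \<in> M" "v \<in> pverts T - M"
  show "(v, x) \<in> parcs T \<longleftrightarrow> (v, y) \<in> parcs T"
  proof (cases "v \<in> K")
    case True
    have "(v, x) \<in> parcs (induced T K) \<longleftrightarrow> (v, y) \<in> parcs (induced T K)"
      using is_moduleD[OF assms(2) H(1,2), of v] True H(3) by simp
    moreover have "x \<in> K" "y \<in> K" using H MK by blast+
    ultimately show ?thesis using True by simp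
  next
    case False
    then show ?thesis using is_moduleD[OF assms(1), of x y v] H MK by blast
  qed
qed

lemma is_module_singleton: "v \<in> pverts T \<Longrightarrow> is_module T {v}"
  by (simp add: is_module_def)

lemma is_module_whole: "is_module T (pverts T)"
  by (simp add: is_module_def)

text \<open>This makes the quotient by a partition into modules well defined.\<close>

lemma module_arcs:
  assumes T: "tournament T" and M: "is_module T M" and N: "is_module T N" and d: "M \<inter> N = {}"
    and H: "u \<in> M" "u' \<in> M" "v \<in> N" "v' \<in> N"
  shows "(u, v) \<in> parcs T \<longleftrightarrow> (u', v') \<in> parcs T"
proof -
  have V: "M \<subseteq> pverts T" "N \<subseteq> pverts T" using M N by (simp_all add: is_module_def)
  have "(u, v) \<in> parcs T \<longleftrightarrow> (u, v') \<in> parcs T" using is_moduleD[OF N H(3,4), of u] V d H by blast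
  moreover have "(u, v') \<in> parcs T \<longleftrightarrow> (u', v') \<in> parcs T" using is_moduleD2[OF T M H(1,2), of v'] V d H by blast
  ultimately show ?thesis by blast
qed

lemma lex_sum_verts:
  "v \<in> pverts (lex_sum R Hs) \<longleftrightarrow> (\<exists>i x. v = prod_encode (i, x) \<and> i < length Hs \<and> x \<in> pverts (Hs ! i))"
  by (auto simp: lex_sum_def)

lemma lex_sum_arc:
  "(prod_encode (i, x), prod_encode (j, y)) \<in> parcs (lex_sum R Hs) \<longleftrightarrow>
     i < length Hs \<and> x \<in> pverts (Hs ! i) \<and> j < length Hs \<and> y \<in> pverts (Hs ! j) \<and>
     (i = j \<and> (x, y) \<in> parcs (Hs ! i) \<or> i \<noteq> j \<and> (i, j) \<in> parcs R)"
  by (auto simp: lex_sum_def)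

lemma lex_sum_pverts: "pverts (lex_sum R Hs) = (\<Union>i<length Hs. (\<lambda>x. prod_encode (i, x)) ` pverts (Hs ! i))"
  by (auto simp: lex_sum_def)

lemma tournament_lex_sum:
  assumes R: "tournament R" "{..<length Hs} \<subseteq> pverts R"
    and H: "\<And>i. i < length Hs \<Longrightarrow> tournament (Hs ! i)"
  shows "tournament (lex_sum R Hs)"
  unfolding tournament_iff
proof (intro conjI ballI allI impI)
  show "finite (pverts (lex_sum R Hs))" unfolding lex_sum_pverts using tournamentD(1)[OF H] by auto
  show "parcs (lex_sum R Hs) \<subseteq> pverts (lex_sum R Hs) \<times> pverts (lex_sum R Hs)"
    by (auto simp: lex_sum_def)
  fix v
  obtain i x where v: "v = prod_encode (i, x)" by (metis prod_decode_inverse surj_pair)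
  show "(v, v) \<notin> parcs (lex_sum R Hs)" unfolding v lex_sum_arc using tournamentD(4)[OF H] by blast
next
  fix u v assume uv: "u \<in> pverts (lex_sum R Hs)" "v \<in> pverts (lex_sum R Hs)" "u \<noteq> v"
  obtain i x j y where e: "u = prod_encode (i, x)" "i < length Hs" "x \<in> pverts (Hs ! i)"
    "v = prod_encode (j, y)" "j < length Hs" "y \<in> pverts (Hs ! j)" using uv(1,2) unfolding lex_sum_verts by blast
  show "((u, v) \<in> parcs (lex_sum R Hs)) = ((v, u) \<notin> parcs (lex_sum R Hs))"
  proof (cases "i = j")
    case True
    then have "x \<noteq> y" using uv(3) e by blast
    then have "(x, y) \<in> parcs (Hs ! i) \<longleftrightarrow> (y, x) \<notin> parcs (Hs ! i)"
      using tournamentD(5)[OF H[OF e(2)]] e True by blast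
    then show ?thesis unfolding e(1,4) lex_sum_arc using e True by blast
  next
    case False
    then have "(i, j) \<in> parcs R \<longleftrightarrow> (j, i) \<notin> parcs R"
      using tournamentD(5)[OF R(1)] R(2) e by (meson lessThan_iff subsetD)
    then show ?thesis unfolding e(1,4) lex_sum_arc using e False by blast
  qed
qed

lemma tiso_lex_sum:
  assumes len: "length Ms = length Hs" and V: "\<Union>(set Ms) = pverts T"
    and dis: "\<And>i j. i < length Ms \<Longrightarrow> j < length Ms \<Longrightarrow> i \<noteq> j \<Longrightarrow> Ms ! i \<inter> Ms ! j = {}"
    and iso: "\<And>i. i < length Ms \<Longrightarrow> \<exists>f. tiso (induced T (Ms ! i)) (Hs ! i) f"
    and arcs: "\<And>i j u v. i < length Ms \<Longrightarrow> j < length Ms \<Longrightarrow> i \<noteq> j \<Longrightarrow> u \<in> Ms ! i \<Longrightarrow> v \<in> Ms ! j \<Longrightarrow>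
       (u, v) \<in> parcs T \<longleftrightarrow> (i, j) \<in> parcs R"
  shows "\<exists>f. tiso T (lex_sum R Hs) f"
proof -
  have "\<exists>f. \<forall>i<length Ms. tiso (induced T (Ms ! i)) (Hs ! i) (f i)" using iso by metis
  then obtain f where f: "\<And>i. i < length Ms \<Longrightarrow> tiso (induced T (Ms ! i)) (Hs ! i) (f i)" by blast
  define ix where "ix v = (THE i. i < length Ms \<and> v \<in> Ms ! i)" for v
  have ix: "ix v = i" if "i < length Ms" "v \<in> Ms ! i" for v i
    unfolding ix_def by (rule the_equality) (use that dis in blast)+
  have ex: "\<exists>i<length Ms. v \<in> Ms ! i" if "v \<in> pverts T" for v
    using that V[symmetric] by (auto simp: in_set_conv_nth)
  have sub: "v \<in> pverts T" if "i < length Ms" "v \<in> Ms ! i" for v i using that V by force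
  define F where "F v = prod_encode (ix v, f (ix v) v)" for v
  have F: "F v = prod_encode (i, f i v)" if "i < length Ms" "v \<in> Ms ! i" for v i
    using ix[OF that] by (simp add: F_def)
  have fi: "inj_on (f i) (Ms ! i)" "f i ` (Ms ! i) = pverts (Hs ! i)" if "i < length Ms" for i
    using tisoD(1,2)[OF f[OF that]] by simp_all
  have "inj_on F (pverts T)"
  proof (rule inj_onI)
    fix u v assume H: "u \<in> pverts T" "v \<in> pverts T" "F u = F v"
    obtain i j where ij: "i < length Ms" "u \<in> Ms ! i" "j < length Ms" "v \<in> Ms ! j" using ex H by metis
    have "(i, f i u) = (j, f j v)" using H(3) unfolding F[OF ij(1,2)] F[OF ij(3,4)] prod_encode_eq .
    then show "u = v" using fi(1)[OF ij(1)] ij by (auto dest: inj_onD)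
  qed
  moreover have "F ` pverts T = pverts (lex_sum R Hs)"
  proof (intro set_eqI iffI)
    fix w assume "w \<in> F ` pverts T"
    then obtain v where v: "v \<in> pverts T" "w = F v" by blast
    obtain i where i: "i < length Ms" "v \<in> Ms ! i" using ex v by blast
    then have "f i v \<in> pverts (Hs ! i)" using fi(2)[OF i(1)] by blast
    then show "w \<in> pverts (lex_sum R Hs)" unfolding lex_sum_verts using v(2) F[OF i] i len by auto
  next
    fix w assume "w \<in> pverts (lex_sum R Hs)"
    then obtain i x where w: "w = prod_encode (i, x)" "i < length Ms" "x \<in> pverts (Hs ! i)"
      unfolding lex_sum_verts len[symmetric] by blast
    then obtain v where v: "v \<in> Ms ! i" "x = f i v" using fi(2)[OF w(2)] by blast
    then have "w = F v" using F[OF w(2)] w(1) by simp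
    then show "w \<in> F ` pverts T" using sub[OF w(2) v(1)] by blast
  qed
  moreover have "(u, v) \<in> parcs T \<longleftrightarrow> (F u, F v) \<in> parcs (lex_sum R Hs)"
    if uv: "u \<in> pverts T" "v \<in> pverts T" for u v
  proof -
    obtain i j where ij: "i < length Ms" "u \<in> Ms ! i" "j < length Ms" "v \<in> Ms ! j" using ex uv by metis
    have m: "f i u \<in> pverts (Hs ! i)" "f j v \<in> pverts (Hs ! j)" using fi(2) ij by blast+
    show ?thesis
    proof (cases "i = j")
      case True
      have "(u, v) \<in> parcs (induced T (Ms ! i)) \<longleftrightarrow> (f i u, f i v) \<in> parcs (Hs ! i)"
        using tisoD(3)[OF f[OF ij(1)], of u v] ij True by simp
      then have "(u, v) \<in> parcs T \<longleftrightarrow> (f i u, f i v) \<in> parcs (Hs ! i)" using ij True by simp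
      then show ?thesis unfolding F[OF ij(1,2)] F[OF ij(3,4)] lex_sum_arc using m ij len True by simp
    next
      case False
      then show ?thesis unfolding F[OF ij(1,2)] F[OF ij(3,4)] lex_sum_arc
        using m ij len arcs[OF ij(1,3) False ij(2,4)] by simp
    qed
  qed
  ultimately show ?thesis unfolding tiso_def bij_betw_def by blast
qed

text \<open>A partition into modules exhibits \<open>T\<close> as the lexicographic sum over its
  quotient \<open>R\<close>, which plays the arbitrary tournament in
  \<open>lex_sums\<close>.\<close>

lemma tiso_lex_sums:
  assumes T: "tournament T" and k: "length Ms = k" "length Xs \<le> k" and V: "\<Union>(set Ms) = pverts T"
    and dis: "\<And>i j. i < k \<Longrightarrow> j < k \<Longrightarrow> i \<noteq> j \<Longrightarrow> Ms ! i \<inter> Ms ! j = {}"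
    and iso: "\<And>i. i < k \<Longrightarrow> \<exists>f. tiso (induced T (Ms ! i)) ((Xs @ replicate (k - length Xs) tt2) ! i) f"
    and mods: "\<And>i. i < k \<Longrightarrow> is_module T (Ms ! i) \<and> Ms ! i \<noteq> {}"
  shows "\<exists>H\<in>lex_sums k Xs. \<exists>f. tiso T H f"
proof -
  define R where "R = \<lparr>pverts = {0..<k}, parcs = {(i, j). i < k \<and> j < k \<and> i \<noteq> j \<and> (\<exists>u\<in>Ms ! i. \<exists>v\<in>Ms ! j. (u, v) \<in> parcs T)}\<rparr>"
  have arcs: "(u, v) \<in> parcs T \<longleftrightarrow> (i, j) \<in> parcs R"
    if H: "i < k" "j < k" "i \<noteq> j" "u \<in> Ms ! i" "v \<in> Ms ! j" for i j u v
  proof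
    assume "(u, v) \<in> parcs T" then show "(i, j) \<in> parcs R" using H by (auto simp: R_def)
  next
    assume "(i, j) \<in> parcs R"
    then obtain u' v' where "u' \<in> Ms ! i" "v' \<in> Ms ! j" "(u', v') \<in> parcs T" by (auto simp: R_def)
    then show "(u, v) \<in> parcs T" using module_arcs[OF T _ _ dis[OF H(1-3)]] mods H by blast
  qed
  have "tournament R" unfolding tournament_iff
  proof (intro conjI ballI allI impI)
    fix i j assume "i \<in> pverts R" "j \<in> pverts R" and ne: "i \<noteq> j"
    then have ij: "i < k" "j < k" by (simp_all add: R_def)
    obtain u v where uv: "u \<in> Ms ! i" "v \<in> Ms ! j" using mods ij by blast
    have "u \<in> pverts T" "v \<in> pverts T" "u \<noteq> v"
      using uv mods ij dis[OF ij ne] unfolding is_module_def by blast+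
    then have "(u, v) \<in> parcs T \<longleftrightarrow> (v, u) \<notin> parcs T" using tournamentD(5)[OF T] by blast
    then show "((i, j) \<in> parcs R) = ((j, i) \<notin> parcs R)"
      using arcs[OF ij ne uv] arcs[OF ij(2,1) ne[symmetric] uv(2,1)] by blast
  qed (auto simp: R_def)
  moreover have "pverts R = {0..<k}" by (simp add: R_def)
  ultimately have mem: "lex_sum R (Xs @ replicate (k - length Xs) tt2) \<in> lex_sums k Xs"
    unfolding lex_sums_def using k(2) by blast
  have "\<exists>f. tiso T (lex_sum R (Xs @ replicate (k - length Xs) tt2)) f"
    by (rule tiso_lex_sum[OF _ V]) (use k dis iso arcs in simp_all)
  then show ?thesis using mem by blast
qed

section \<open>Recognizing blocks of at most five vertices\<close>

lemma tiso_tt1: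
  assumes "tournament T" shows "\<exists>f. tiso (induced T {v}) tt1 f"
proof -
  have "tiso (induced T {v}) tt1 (\<lambda>_. 0)"
    using tournamentD(4)[OF assms] by (auto simp: tiso_def bij_betw_def transitive_tournament_def)
  then show ?thesis by blast
qed

lemma tiso_tt2:
  assumes T: "tournament T" and M: "M \<subseteq> pverts T" "card M = 2"
  shows "\<exists>f. tiso (induced T M) tt2 f"
proof -
  obtain a b where ab: "M = {a, b}" "a \<noteq> b" using M(2) by (auto simp: card_2_iff)
  have "\<exists>a b. M = {a, b} \<and> a \<noteq> b \<and> (a, b) \<in> parcs T"
  proof (cases "(a, b) \<in> parcs T")
    case True then show ?thesis using ab by blast
  next
    case False
    then have "(b, a) \<in> parcs T" using tournamentD(5)[OF T, of a b] ab M(1) by blast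
    then show ?thesis using ab by blast
  qed
  then obtain a b where ab: "M = {a, b}" "a \<noteq> b" "(a, b) \<in> parcs T" by blast
  show ?thesis
  proof (rule tiso_of_list[where ps = "[a, b]"])
    show "(i, j) \<in> parcs tt2 \<Longrightarrow> ([a, b] ! i, [a, b] ! j) \<in> parcs (induced T M)" for i j
      using ab by (auto simp: transitive_tournament_def less_2_cases_iff)
  qed (use ab M tournament_induced[OF T M(1)] tournament_transitive in
      \<open>auto simp: transitive_tournament_def\<close>)
qed

lemma is_module_induced_iff_homog:
  assumes "tournament T" "M \<subseteq> pverts T"
  shows "is_module (induced T M) B \<longleftrightarrow> homog M (\<lambda>u v. (u, v) \<in> parcs T) B"
  using is_module_iff_homog[OF tournament_induced[OF assms], of B]
  unfolding homog_def induced_simps by blast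

lemma skew_parcs:
  assumes "tournament T" "M \<subseteq> pverts T" shows "skew M (\<lambda>u v. (u, v) \<in> parcs T)"
  using tournamentD(5)[OF assms(1)] finite_subset[OF assms(2) tournamentD(1)[OF assms(1)]] assms(2)
  unfolding skew_def by blast

text \<open>By \<open>min\<close> the block is indecomposable; on three vertices this leaves the
  3-cycle, on four nothing, on five \<open>U5\<close>, \<open>V5\<close> and
  \<open>W5\<close>.\<close>

lemma small_minimal_module:
  assumes T: "tournament T" and M: "M \<subseteq> pverts T" "2 \<le> card M" "card M \<le> 5"
    and min: "\<And>B. is_module (induced T M) B \<Longrightarrow> 2 \<le> card B \<Longrightarrow> B = M"
  shows "card M = 2 \<or> (card M = 3 \<and> (\<exists>f. tiso (induced T M) C3 f)) \<or>
     (card M = 5 \<and> (\<exists>S\<in>{U5, V5, W5}. \<exists>f. tiso (induced T M) S f))"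
proof -
  let ?g = "\<lambda>u v. (u, v) \<in> parcs T"
  have sk: "skew M ?g" using skew_parcs[OF T M(1)] .
  have ind: "card B < 2" if "homog M ?g B" "B \<noteq> M" for B
    using min[of B] that is_module_induced_iff_homog[OF T M(1)] by force
  have TM: "tournament (induced T M)" using tournament_induced[OF T M(1)] .
  have fM: "finite M" using M(1) tournamentD(1)[OF T] finite_subset by blast
  have "card M = 2 \<or> card M = 3 \<or> card M = 4 \<or> card M = 5" using M(2,3) by linarith
  then show ?thesis
  proof (elim disjE)
    assume c: "card M = 3"
    obtain a b d where abd: "{a, b, d} \<subseteq> M" "a \<noteq> b" "b \<noteq> d" "a \<noteq> d" "?g a b" "?g b d" "?g d a"
      using ex_three_cycle[OF sk _ ind] c by auto
    have "card {a, b, d} = 3" using abd by simp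
    then have Meq: "M = {a, b, d}" using card_subset_eq[OF fM abd(1)] c by simp
    have "\<exists>f. tiso (induced T M) C3 f"
    proof (rule tiso_of_list[where ps = "[a, b, d]"])
      show "(i, j) \<in> parcs C3 \<Longrightarrow> ([a, b, d] ! i, [a, b, d] ! j) \<in> parcs (induced T M)" for i j
        using abd Meq by (auto simp: C3_def)
      show "pverts C3 = {..<length [a, b, d]}" by (auto simp: C3_def)
    qed (use abd Meq TM tournament_C3 in auto)
    then show ?thesis using c by blast
  next
    assume c: "card M = 4"
    obtain B where "homog M ?g B" "B \<noteq> M" "2 \<le> card B" using four_vertices[OF sk c] .
    then show ?thesis using ind[of B] by simp
  next
    assume c: "card M = 5"
    obtain S ps where S: "S \<in> {U5, V5, W5}" and ps: "distinct ps" "set ps = M"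
      "\<forall>(i, j)\<in>parcs S. ?g (ps ! i) (ps ! j)" using five_vertices[OF sk c ind] by blast
    have l: "length ps = 5" using distinct_card[OF ps(1)] ps(2) c by simp
    have V: "pverts S = {..<length ps}" using pverts_S5[OF S] l by auto
    have tS: "tournament S" using tournament_S5[OF S] .
    have "\<exists>f. tiso (induced T M) S f"
    proof (rule tiso_of_list[OF TM tS V])
      show "(i, j) \<in> parcs S \<Longrightarrow> (ps ! i, ps ! j) \<in> parcs (induced T M)" for i j
        using ps tournamentD(2,3)[OF tS, of i j] V by auto
    qed (use ps in simp_all)
    then show ?thesis using c S by blast
  qed blast
qed

text \<open>Unlike in a family of co-modules, the whole vertex set may be a member; so each part of
  a lexicographic sum can contribute itself.\<close>

definition module_family :: "'a pair_pre_digraph \<Rightarrow> 'a set set \<Rightarrow> bool" where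
  "module_family T P \<longleftrightarrow> finite P \<and> pairwise disjnt P \<and> (\<forall>M\<in>P. is_module T M \<and> 2 \<le> card M)"

lemma is_module_lex_sum:
  assumes "i < length Hs" "is_module (Hs ! i) M"
  shows "is_module (lex_sum R Hs) ((\<lambda>x. prod_encode (i, x)) ` M)"
  unfolding is_module_def
proof (intro conjI ballI)
  have MV: "M \<subseteq> pverts (Hs ! i)" using assms(2) by (simp add: is_module_def)
  then show "(\<lambda>x. prod_encode (i, x)) ` M \<subseteq> pverts (lex_sum R Hs)" using assms(1) by (auto simp: lex_sum_verts)
  fix a b v assume H: "a \<in> (\<lambda>x. prod_encode (i, x)) ` M" "b \<in> (\<lambda>x. prod_encode (i, x)) ` M"
    "v \<in> pverts (lex_sum R Hs) - (\<lambda>x. prod_encode (i, x)) ` M"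
  obtain x y where xy: "a = prod_encode (i, x)" "b = prod_encode (i, y)" "x \<in> M" "y \<in> M" using H(1,2) by blast
  obtain j z where v: "v = prod_encode (j, z)" "j < length Hs" "z \<in> pverts (Hs ! j)"
    using H(3) lex_sum_verts[of v R Hs] by blast
  have "(z, x) \<in> parcs (Hs ! i) \<longleftrightarrow> (z, y) \<in> parcs (Hs ! i)" if "j = i"
    using is_moduleD[OF assms(2) xy(3,4), of z] v that H(3) by blast
  then show "(v, a) \<in> parcs (lex_sum R Hs) \<longleftrightarrow> (v, b) \<in> parcs (lex_sum R Hs)"
    unfolding v(1) xy(1,2) lex_sum_arc using xy(3,4) MV by blast
qed

lemma module_family_lex_sum:
  assumes P: "\<And>i. i < length Hs \<Longrightarrow> module_family (Hs ! i) (P i)"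
  shows "\<exists>Q. module_family (lex_sum R Hs) Q \<and> card Q = (\<Sum>i<length Hs. card (P i))"
proof -
  let ?e = "\<lambda>i x. prod_encode (i, x)"
  let ?Q = "\<lambda>i. (\<lambda>M. ?e i ` M) ` P i"
  have inj: "inj (?e i)" for i by (simp add: inj_def)
  have nonempty: "M \<noteq> {}" if "i < length Hs" "M \<in> P i" for i M
    using P[OF that(1)] that(2) unfolding module_family_def by force
  have fin: "finite (P i)" if "i < length Hs" for i using P[OF that] by (simp add: module_family_def)
  have across: "disjnt (?e i ` M) (?e j ` N)" if "i \<noteq> j" for i j M N
    using that by (auto simp: disjnt_def)
  have "module_family (lex_sum R Hs) (\<Union>i<length Hs. ?Q i)"
    unfolding module_family_def
  proof (intro conjI ballI)
    show "finite (\<Union>i<length Hs. ?Q i)" using fin by simp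
    show "pairwise disjnt (\<Union>i<length Hs. ?Q i)"
    proof (rule pairwiseI)
      fix A B assume "A \<in> (\<Union>i<length Hs. ?Q i)" "B \<in> (\<Union>i<length Hs. ?Q i)" and ne: "A \<noteq> B"
      then obtain i j M N where *: "i < length Hs" "M \<in> P i" "A = ?e i ` M" "j < length Hs" "N \<in> P j" "B = ?e j ` N"
        by blast
      show "disjnt A B"
      proof (cases "i = j")
        case True
        then have "M \<noteq> N" using ne * by blast
        then have "disjnt M N" using P[OF *(1)] * True unfolding module_family_def pairwise_def by blast
        then show ?thesis using * True inj[of i] by (auto simp: disjnt_def)
      next
        case False then show ?thesis using across * by blast
      qed
    qed
    fix A assume "A \<in> (\<Union>i<length Hs. ?Q i)"
    then obtain i M where *: "i < length Hs" "M \<in> P i" "A = ?e i ` M" by blast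
    then have m: "is_module (Hs ! i) M" "2 \<le> card M" using P[OF *(1)] by (simp_all add: module_family_def)
    show "is_module (lex_sum R Hs) A" using is_module_lex_sum[OF *(1) m(1)] * by simp
    have "card (?e i ` M) = card M" by (rule card_image) (simp add: inj_on_def)
    then show "2 \<le> card A" using m(2) *(3) by simp
  qed
  moreover have "card (\<Union>i<length Hs. ?Q i) = (\<Sum>i<length Hs. card (?Q i))"
  proof (rule card_UN_disjoint)
    show "\<forall>i\<in>{..<length Hs}. \<forall>j\<in>{..<length Hs}. i \<noteq> j \<longrightarrow> ?Q i \<inter> ?Q j = {}"
    proof (intro ballI impI, rule ccontr)
      fix i j assume ij: "i \<in> {..<length Hs}" "j \<in> {..<length Hs}" "i \<noteq> j" "?Q i \<inter> ?Q j \<noteq> {}"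
      then obtain M N where MN: "M \<in> P i" "?e i ` M = ?e j ` N" by blast
      then obtain x where "x \<in> M" using nonempty[of i M] ij(1) by blast
      then have "?e i x \<in> ?e j ` N" using MN(2) by blast
      then show False using ij(3) by auto
    qed
  qed (use fin in auto)
  moreover have "card (?Q i) = card (P i)" for i
    by (rule card_image) (use inj in \<open>auto intro!: inj_onI simp: inj_image_eq_iff\<close>)
  ultimately show ?thesis by auto
qed

lemma card_lex_sum:
  assumes "\<And>i. i < length Hs \<Longrightarrow> finite (pverts (Hs ! i))"
  shows "card (pverts (lex_sum R Hs)) = (\<Sum>i<length Hs. card (pverts (Hs ! i)))"
proof -
  have "card (pverts (lex_sum R Hs)) = (\<Sum>i<length Hs. card ((\<lambda>x. prod_encode (i, x)) ` pverts (Hs ! i)))"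
    unfolding lex_sum_pverts by (rule card_UN_disjoint) (use assms in auto)
  also have "\<dots> = (\<Sum>i<length Hs. card (pverts (Hs ! i)))"
    by (intro sum.cong refl card_image) (simp add: inj_on_def)
  finally show ?thesis .
qed

lemma tt_simps [simp]:
  "pverts (transitive_tournament k) = {0..<k}" "card (pverts C3) = 3"
  by (simp_all add: transitive_tournament_def C3_def)

lemma module_family_whole:
  "module_family X (if 2 \<le> card (pverts X) then {pverts X} else {})"
  by (simp add: module_family_def is_module_whole)

lemma sum_nth_eq_sum_list: "(\<Sum>i<length xs. f (xs ! i)) = (\<Sum>x\<leftarrow>xs. f x)"
  by (simp add: sum_list_sum_nth atLeast0LessThan)

text \<open>Each part with two or more vertices is a module of the sum, so vertices and modules are
  both counted off the list of parts.\<close>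

lemma lex_sums_properties:
  assumes H: "H \<in> lex_sums k Xs" and Xs: "\<And>X. X \<in> set Xs \<Longrightarrow> tournament X"
  shows "tournament H"
    "card (pverts H) = (\<Sum>X\<leftarrow>Xs. card (pverts X)) + 2 * (k - length Xs)"
    "\<exists>P. module_family H P \<and> card P = length (filter (\<lambda>X. 2 \<le> card (pverts X)) Xs) + (k - length Xs)"
proof -
  obtain R where R: "H = lex_sum R (Xs @ replicate (k - length Xs) tt2)" "tournament R" "pverts R = {0..<k}" "length Xs \<le> k"
    using H unfolding lex_sums_def by blast
  let ?Hs = "Xs @ replicate (k - length Xs) tt2"
  have len: "length ?Hs = k" using R(4) by simp
  have T: "tournament (?Hs ! i)" if "i < length ?Hs" for i
  proof -
    have "?Hs ! i \<in> set ?Hs" using that by (rule nth_mem)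
    then have "?Hs ! i \<in> set Xs \<or> ?Hs ! i = tt2" by auto
    then show ?thesis using Xs tournament_transitive by auto
  qed
  have sub: "{..<length ?Hs} \<subseteq> pverts R" unfolding R(3) len by auto
  show "tournament H" unfolding R(1) by (rule tournament_lex_sum[OF R(2) sub T])
  have "card (pverts H) = (\<Sum>i<length ?Hs. card (pverts (?Hs ! i)))"
    unfolding R(1) by (rule card_lex_sum) (use tournamentD(1)[OF T] in blast)
  also have "\<dots> = (\<Sum>X\<leftarrow>?Hs. card (pverts X))"
    by (rule sum_nth_eq_sum_list)
  finally show "card (pverts H) = (\<Sum>X\<leftarrow>Xs. card (pverts X)) + 2 * (k - length Xs)"
    by (simp add: sum_list_replicate)
  let ?P = "\<lambda>X :: nat pair_pre_digraph. if 2 \<le> card (pverts X) then {pverts X} else {}"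
  have "\<exists>Q. module_family H Q \<and> card Q = (\<Sum>i<length ?Hs. card (?P (?Hs ! i)))"
    unfolding R(1) by (rule module_family_lex_sum) (rule module_family_whole)
  then obtain Q where Q: "module_family H Q" "card Q = (\<Sum>i<length ?Hs. card (?P (?Hs ! i)))" by blast
  have "(\<Sum>i<length ?Hs. card (?P (?Hs ! i))) = (\<Sum>X\<leftarrow>?Hs. card (?P X))"
    by (rule sum_nth_eq_sum_list)
  also have "\<dots> = (\<Sum>X\<leftarrow>Xs. card (?P X)) + (k - length Xs)" by (simp add: sum_list_replicate)
  also have "(\<Sum>X\<leftarrow>Xs. card (?P X)) = length (filter (\<lambda>X. 2 \<le> card (pverts X)) Xs)"
    by (induction Xs) auto
  finally show "\<exists>P. module_family H P \<and> card P = length (filter (\<lambda>X. 2 \<le> card (pverts X)) Xs) + (k - length Xs)"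
    using Q by metis
qed

lemma comodule_family_of_module_family:
  assumes P: "module_family T P" "2 \<le> card P" shows "comodule_family T P"
proof (rule comodule_familyI)
  fix M assume "M \<in> P"
  then have m: "is_module T M" "2 \<le> card M" using P(1) by (simp_all add: module_family_def)
  moreover have "M \<subseteq> pverts T" using m(1) unfolding is_module_def by blast
  moreover have "M \<noteq> {}" using m(2) by auto
  ultimately show "M \<subseteq> pverts T \<and> M \<noteq> {} \<and>
      (is_module T M \<and> 2 \<le> card M \<or> is_module T (pverts T - M) \<and> 2 \<le> card (pverts T - M))"
    by blast
qed (use P in \<open>simp_all add: module_family_def\<close>)

text \<open>Modules of the component with index \<open>i\<close> are modules of the sum.
  \<open>N\<close> adds co-modules outside that component, recognized by their complements: a
  source, a sink, or the two single vertices in a sum over a 3-cycle.\<close>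

lemma comodule_family_lex_sum:
  assumes i: "i < length Hs" and P: "module_family (Hs ! i) P"
    and N: "finite N" "pairwise disjnt N" "2 \<le> card P + card N"
      "\<And>M. M \<in> N \<Longrightarrow> M \<noteq> {} \<and> M \<subseteq> pverts (lex_sum R Hs) - (\<lambda>x. prod_encode (i, x)) ` pverts (Hs ! i) \<and>
         is_module (lex_sum R Hs) (pverts (lex_sum R Hs) - M) \<and> 2 \<le> card (pverts (lex_sum R Hs) - M)"
  shows "\<exists>Q. comodule_family (lex_sum R Hs) Q \<and> card Q = card P + card N"
proof -
  let ?e = "\<lambda>x. prod_encode (i, x)" and ?S = "lex_sum R Hs"
  let ?Q = "(\<lambda>M. ?e ` M) ` P"
  have inj: "inj ?e" by (simp add: inj_def)
  have PV: "M \<subseteq> pverts (Hs ! i)" "is_module (Hs ! i) M" "2 \<le> card M" if "M \<in> P" for M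
  proof -
    show m: "is_module (Hs ! i) M" "2 \<le> card M" using P that by (simp_all add: module_family_def)
    show "M \<subseteq> pverts (Hs ! i)" using m(1) unfolding is_module_def by blast
  qed
  have fP: "finite P" using P by (simp add: module_family_def)
  have dj: "A \<inter> B = {}" if "A \<in> ?Q" "B \<in> N" for A B
    using that N(4)[of B] PV(1) by blast
  have ne: "A \<noteq> {}" if "A \<in> ?Q" for A using that PV(3) by force
  have int: "?Q \<inter> N = {}"
  proof (rule equals0I)
    fix A assume "A \<in> ?Q \<inter> N"
    then have "A \<in> ?Q" "A \<in> N" by (rule IntD1, rule IntD2)
    then show False using dj[of A A] ne[of A] by simp
  qed
  have cQ: "card ?Q = card P"
    by (rule card_image) (use inj in \<open>auto intro!: inj_onI simp: inj_image_eq_iff\<close>)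
  have c: "card (?Q \<union> N) = card P + card N" using card_Un_disjoint[OF _ N(1) int] fP cQ by simp
  have "comodule_family ?S (?Q \<union> N)"
  proof (rule comodule_familyI)
    show "finite (?Q \<union> N)" using fP N(1) by simp
    show "2 \<le> card (?Q \<union> N)" using c N(3) by simp
    have dQ: "pairwise disjnt ?Q"
    proof (rule pairwiseI)
      fix A B assume "A \<in> ?Q" "B \<in> ?Q" and n: "A \<noteq> B"
      then obtain M M' where *: "M \<in> P" "A = ?e ` M" "M' \<in> P" "B = ?e ` M'" by blast
      then have "disjnt M M'" using n P unfolding module_family_def pairwise_def by blast
      then show "disjnt A B" using * inj by (auto simp: disjnt_def)
    qed
    show "pairwise disjnt (?Q \<union> N)"
    proof (rule pairwiseI)
      fix A B assume AB: "A \<in> ?Q \<union> N" "B \<in> ?Q \<union> N" "A \<noteq> B"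
      from AB(1,2) show "disjnt A B"
      proof (elim UnE)
        assume "A \<in> ?Q" "B \<in> ?Q" then show ?thesis using pairwiseD[OF dQ] AB(3) by simp
      next
        assume "A \<in> ?Q" "B \<in> N" then show ?thesis using dj[of A B] by (simp add: disjnt_def)
      next
        assume "A \<in> N" "B \<in> ?Q" then show ?thesis using dj[of B A] by (simp add: disjnt_def Int_commute)
      next
        assume "A \<in> N" "B \<in> N" then show ?thesis using pairwiseD[OF N(2)] AB(3) by simp
      qed
    qed
    fix A assume A: "A \<in> ?Q \<union> N"
    show "A \<subseteq> pverts ?S \<and> A \<noteq> {} \<and>
      (is_module ?S A \<and> 2 \<le> card A \<or> is_module ?S (pverts ?S - A) \<and> 2 \<le> card (pverts ?S - A))"
    proof (cases "A \<in> N")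
      case True then show ?thesis using N(4)[OF True] by blast
    next
      case False
      then obtain M where M: "M \<in> P" "A = ?e ` M" using A by blast
      have m: "is_module ?S A" using is_module_lex_sum[OF i PV(2)[OF M(1)]] M(2) by simp
      moreover have "card (?e ` M) = card M" by (rule card_image) (simp add: inj_on_def)
      then have "2 \<le> card A" using PV(3)[OF M(1)] M(2) by simp
      ultimately show ?thesis using ne[of A] M unfolding is_module_def by blast
    qed
  qed
  then show ?thesis using c by blast
qed

lemma is_module_minus_vertex:
  assumes
    "(\<forall>v\<in>pverts T - {s}. (s, v) \<in> parcs T) \<or> (\<forall>v\<in>pverts T - {s}. (s, v) \<notin> parcs T)"
  shows "is_module T (pverts T - {s})"
  unfolding is_module_def
proof (intro conjI ballI)
  fix x y v assume H: "x \<in> pverts T - {s}" "y \<in> pverts T - {s}" "v \<in> pverts T - (pverts T - {s})"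
  then have "v = s" by blast
  then show "(v, x) \<in> parcs T \<longleftrightarrow> (v, y) \<in> parcs T" using assms H by blast
qed blast

lemma comodule_family_tiso:
  assumes f: "tiso T S f" and P: "comodule_family S P" and T: "tournament T"
  shows "\<exists>Q. comodule_family T Q \<and> card Q = card P"
proof -
  let ?p = "\<lambda>M. f -` M \<inter> pverts T"
  have inj: "inj_on f (pverts T)" and im: "f ` pverts T = pverts S" using tisoD[OF f] by auto
  have pim: "f ` ?p M = M" if "M \<subseteq> pverts S" for M
  proof (intro equalityI subsetI)
    fix x assume x: "x \<in> M"
    have "x \<in> f ` pverts T" unfolding im using x that by blast
    then obtain v where v: "v \<in> pverts T" "x = f v" by blast
    have "v \<in> ?p M" using v x by simp
    then show "x \<in> f ` ?p M" unfolding v(2) by (rule imageI)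
  qed auto
  have cp: "card (?p M) = card M" if "M \<subseteq> pverts S" for M
  proof -
    have "card (f ` ?p M) = card (?p M)" using inj by (intro card_image) (rule inj_on_subset, auto)
    then show ?thesis using pim[OF that] by simp
  qed
  have mod: "is_module T (?p M)" if "is_module S M" for M
    unfolding is_module_def
  proof (intro conjI ballI)
    fix x y v assume H: "x \<in> ?p M" "y \<in> ?p M" "v \<in> pverts T - ?p M"
    have "(f v, f x) \<in> parcs S \<longleftrightarrow> (f v, f y) \<in> parcs S"
      using is_moduleD[OF that, of "f x" "f y" "f v"] H im by blast
    then show "(v, x) \<in> parcs T \<longleftrightarrow> (v, y) \<in> parcs T"
      using tisoD(3)[OF f, of v x] tisoD(3)[OF f, of v y] H by blast
  qed blast
  have PS: "comodule S M" if "M \<in> P" for M using P that by (simp add: comodule_family_def)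
  have sub: "M \<subseteq> pverts S" if "M \<in> P" for M using PS[OF that] by (simp add: comodule_def)
  have injp: "inj_on ?p P"
  proof (rule inj_onI)
    fix M N assume H: "M \<in> P" "N \<in> P" "?p M = ?p N"
    have "M = f ` ?p M" using pim[OF sub[OF H(1)]] by simp
    also have "\<dots> = N" unfolding H(3) by (rule pim[OF sub[OF H(2)]])
    finally show "M = N" .
  qed
  have com: "comodule T (?p M)" if "M \<in> P" for M
  proof -
    have c: "comodule S M" using PS that .
    have compl: "?p (pverts S - M) = pverts T - ?p M" using im by blast
    have "?p M \<noteq> {}" "?p M \<noteq> pverts T"
      using pim[OF sub[OF that]] c im unfolding comodule_def by (metis image_is_empty, metis)
    moreover have "is_module T (?p M) \<and> 2 \<le> card (?p M) \<or>
       is_module T (pverts T - ?p M) \<and> 2 \<le> card (pverts T - ?p M)"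
      using c mod[of M] mod[of "pverts S - M"] cp[of M] cp[of "pverts S - M"]
      unfolding comodule_def compl by auto
    ultimately show ?thesis unfolding comodule_def by blast
  qed
  have "comodule_family T (?p ` P)"
    unfolding comodule_family_def
  proof (intro conjI ballI)
    show "finite (?p ` P)" using P by (simp add: comodule_family_def)
    show "comodule T M" if "M \<in> ?p ` P" for M using com that by blast
    show "pairwise disjnt (?p ` P)"
    proof (rule pairwiseI)
      fix A B assume "A \<in> ?p ` P" "B \<in> ?p ` P" "A \<noteq> B"
      then obtain M N where "M \<in> P" "N \<in> P" "M \<noteq> N" "A = ?p M" "B = ?p N" by blast
      moreover then have "disjnt M N" using P unfolding comodule_family_def pairwise_def by blast
      ultimately show "disjnt A B" by (auto simp: disjnt_def)
    qed
  qed
  then show ?thesis using card_image[OF injp] by blast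
qed

lemma is_module_dual:
  assumes "tournament T" shows "is_module (dual T) M \<longleftrightarrow> is_module T M"
proof -
  have d: "pverts (dual T) = pverts T" "(u, v) \<in> parcs (dual T) \<longleftrightarrow> (v, u) \<in> parcs T" for u v
    by (auto simp: dual_def)
  have "(\<forall>x\<in>M. \<forall>y\<in>M. \<forall>v\<in>pverts T - M. ((x, v) \<in> parcs T) = ((y, v) \<in> parcs T)) \<longleftrightarrow>
     (\<forall>x\<in>M. \<forall>y\<in>M. \<forall>v\<in>pverts T - M. ((v, x) \<in> parcs T) = ((v, y) \<in> parcs T))" if M: "M \<subseteq> pverts T"
  proof -
    have "(x, v) \<in> parcs T \<longleftrightarrow> (v, x) \<notin> parcs T" if "x \<in> M" "v \<in> pverts T - M" for x v
      using tournamentD(5)[OF assms, of x v] that M by blast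
    then show ?thesis by (intro ball_cong refl) blast
  qed
  then show ?thesis unfolding is_module_def d by blast
qed

lemma comodule_family_dual:
  assumes "tournament T" shows "comodule_family (dual T) P \<longleftrightarrow> comodule_family T P"
proof -
  have "pverts (dual T) = pverts T" by (simp add: dual_def)
  then show ?thesis unfolding comodule_family_def comodule_def is_module_dual[OF assms] by simp
qed

lemma tournament_dual:
  assumes T: "tournament T" shows "tournament (dual T)"
proof -
  note D = tournamentD[OF T]
  have "parcs (dual T) \<subseteq> pverts T \<times> pverts T" using D(2,3) by (auto simp: dual_def)
  moreover have "(x, x) \<notin> parcs (dual T)" for x using D(4) by (simp add: dual_def)
  moreover have "(x, y) \<in> parcs (dual T) \<longleftrightarrow> (y, x) \<notin> parcs (dual T)"
    if "x \<in> pverts T" "y \<in> pverts T" "x \<noteq> y" for x y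
    using D(5)[OF that] unfolding dual_def by auto
  moreover have "pverts (dual T) = pverts T" by (simp add: dual_def)
  ultimately show ?thesis unfolding tournament_iff using D(1) by metis
qed

section \<open>The listed tournaments\<close>

text \<open>Repeats the disjunction of the theorem word for word, so that it can be folded
  there.\<close>

definition listed :: "nat \<Rightarrow> nat pair_pre_digraph \<Rightarrow> bool" where
  "listed n S \<longleftrightarrow>
      (S \<in> lex_sums (2 * n + 2) [tt1]
       \<or> S \<in> lex_sums (2 * n + 1) [C3]
       \<or> (\<exists>H \<in> lex_sums (2 * n) [C3]. S = lex_sum C3 [tt1, tt1, H])
       \<or> (\<exists>H \<in> lex_sums (2 * n + 1) [tt1]. S = lex_sum C3 [tt1, tt1, H])
       \<or> (\<exists>H \<in> lex_sums (2 * n + 2) [tt1, tt1].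
            S = lex_sum tt2 [tt1, H] \<or> S = dual (lex_sum tt2 [tt1, H]))
       \<or> (\<exists>H \<in> lex_sums (2 * n + 1) [C3, tt1].
            S = lex_sum tt2 [tt1, H] \<or> S = dual (lex_sum tt2 [tt1, H]))
       \<or> (\<exists>H \<in> lex_sums (2 * n) [C3, C3].
            S = lex_sum tt2 [tt1, H] \<or> S = dual (lex_sum tt2 [tt1, H]))
       \<or> (\<exists>S5 \<in> {U5, V5, W5}. \<exists>H \<in> lex_sums (2 * n - 1) [S5]. S = lex_sum tt3 [tt1, H, tt1])
       \<or> (\<exists>H \<in> lex_sums (2 * n + 2) [tt1, tt1, tt1]. S = lex_sum tt3 [tt1, H, tt1])
       \<or> n \<ge> 2 \<and> (\<exists>H \<in> lex_sums (2 * n) [C3, C3, tt1]. S = lex_sum tt3 [tt1, H, tt1])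
       \<or> (\<exists>H \<in> lex_sums (2 * n + 1) [tt1, tt1, C3]. S = lex_sum tt3 [tt1, H, tt1])
       \<or> n \<ge> 2 \<and> (\<exists>H \<in> lex_sums (2 * n - 1) [C3, C3, C3]. S = lex_sum tt3 [tt1, H, tt1]))"

definition attains :: "'a pair_pre_digraph \<Rightarrow> nat \<Rightarrow> nat \<Rightarrow> bool" where
  "attains T v d \<longleftrightarrow> tournament T \<and> card (pverts T) = v \<and> (\<exists>P. comodule_family T P \<and> card P = d)"

lemma tournament_parts:
  assumes "tournament H"
  shows "i < length [tt1, H] \<Longrightarrow> tournament ([tt1, H] ! i)"
    "i < length [tt1, tt1, H] \<Longrightarrow> tournament ([tt1, tt1, H] ! i)"
    "i < length [tt1, H, tt1] \<Longrightarrow> tournament ([tt1, H, tt1] ! i)"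
  using assms tournament_transitive[of 1] by (auto simp: less_Suc_eq nth_Cons')

lemma module_family_card:
  assumes H: "tournament H" and P: "module_family H P" "1 \<le> card P"
  shows "2 \<le> card (pverts H)"
proof -
  obtain M where M: "M \<in> P" using P(2) by fastforce
  then have "2 \<le> card M" "M \<subseteq> pverts H" using P(1) unfolding module_family_def is_module_def by blast+
  then show ?thesis using card_mono[OF tournamentD(1)[OF H]] by (meson order_trans)
qed

text \<open>The two single vertices together form the additional co-module, as their complement is
  the component \<open>H\<close>; \<open>1 \<le> card P\<close> ensures that \<open>H\<close> has
  two vertices.\<close>

lemma attains_C3:
  assumes H: "tournament H" and P: "module_family H P" "1 \<le> card P"
  shows "attains (lex_sum C3 [tt1, tt1, H]) (card (pverts H) + 2) (card P + 1)"
proof -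
  let ?Hs = "[tt1, tt1, H]" and ?S = "lex_sum C3 [tt1, tt1, H]"
  let ?N = "{{prod_encode (0, 0), prod_encode (1, 0)}} :: nat set set"
  have "{..<length ?Hs} \<subseteq> pverts C3" by (auto simp: C3_def)
  then have T: "tournament ?S" by (intro tournament_lex_sum tournament_C3 tournament_parts(2)[OF H])
  have c: "card (pverts ?S) = card (pverts H) + 2"
    using card_lex_sum[of ?Hs C3] tournamentD(1)[OF tournament_parts(2)[OF H]]
    by (simp add: numeral_eq_Suc lessThan_Suc)
  have V: "pverts ?S = {prod_encode (0, 0), prod_encode (1, 0)} \<union> (\<lambda>x. prod_encode (2, x)) ` pverts H"
    unfolding lex_sum_pverts by (auto simp: less_Suc_eq numeral_eq_Suc lessThan_Suc)
  have D: "pverts ?S - {prod_encode (0, 0), prod_encode (1, 0)} = (\<lambda>x. prod_encode (2, x)) ` pverts H"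
    unfolding V by auto
  have m: "is_module ?S ((\<lambda>x. prod_encode (2, x)) ` pverts H)"
    using is_module_lex_sum[of 2 ?Hs "pverts H" C3] is_module_whole[of H] by simp
  have c2: "card ((\<lambda>x. prod_encode (2, x)) ` pverts H) = card (pverts H)"
    by (rule card_image) (simp add: inj_on_def)
  have "\<exists>Q. comodule_family ?S Q \<and> card Q = card P + card ?N"
  proof (rule comodule_family_lex_sum[where i = 2])
    fix M assume "M \<in> ?N"
    then have M: "M = {prod_encode (0, 0), prod_encode (1, 0)}" by simp
    have "M \<subseteq> pverts ?S - (\<lambda>x. prod_encode (2, x)) ` pverts (?Hs ! 2)" unfolding M V by auto
    then show "M \<noteq> {} \<and> M \<subseteq> pverts ?S - (\<lambda>x. prod_encode (2, x)) ` pverts (?Hs ! 2) \<and>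
       is_module ?S (pverts ?S - M) \<and> 2 \<le> card (pverts ?S - M)"
      using m c2 module_family_card[OF H P] unfolding M D by simp
  qed (use P in simp_all)
  then show ?thesis using T c unfolding attains_def by simp
qed

text \<open>The single vertex is a source, hence a co-module on its own.\<close>

lemma attains_tt2:
  assumes H: "tournament H" and P: "module_family H P" "1 \<le> card P"
  shows "attains (lex_sum tt2 [tt1, H]) (card (pverts H) + 1) (card P + 1)"
proof -
  let ?Hs = "[tt1, H]" and ?S = "lex_sum tt2 [tt1, H]"
  let ?N = "{{prod_encode (0, 0)}} :: nat set set"
  have "{..<length ?Hs} \<subseteq> pverts tt2" by auto
  then have T: "tournament ?S" by (intro tournament_lex_sum tournament_transitive tournament_parts(1)[OF H])
  have c: "card (pverts ?S) = card (pverts H) + 1"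
    using card_lex_sum[of ?Hs tt2] tournamentD(1)[OF tournament_parts(1)[OF H]]
    by (simp add: numeral_eq_Suc lessThan_Suc)
  have V: "pverts ?S = {prod_encode (0, 0)} \<union> (\<lambda>x. prod_encode (1, x)) ` pverts H"
    unfolding lex_sum_pverts by (auto simp: less_Suc_eq lessThan_Suc)
  have "(prod_encode (0, 0), v) \<in> parcs ?S" if "v \<in> pverts ?S - {prod_encode (0, 0)}" for v
    using that unfolding V by (auto simp: lex_sum_arc transitive_tournament_def)
  then have m: "is_module ?S (pverts ?S - {prod_encode (0, 0)})" by (intro is_module_minus_vertex) blast
  have c2: "card (pverts ?S - {prod_encode (0, 0)}) = card (pverts H)"
    using c V tournamentD(1)[OF T] by (subst card_Diff_singleton) auto
  have "\<exists>Q. comodule_family ?S Q \<and> card Q = card P + card ?N"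
  proof (rule comodule_family_lex_sum[where i = 1])
    fix M assume "M \<in> ?N"
    then have M: "M = {prod_encode (0, 0)}" by simp
    have "M \<subseteq> pverts ?S - (\<lambda>x. prod_encode (1, x)) ` pverts (?Hs ! 1)" unfolding M V by auto
    then show "M \<noteq> {} \<and> M \<subseteq> pverts ?S - (\<lambda>x. prod_encode (1, x)) ` pverts (?Hs ! 1) \<and>
       is_module ?S (pverts ?S - M) \<and> 2 \<le> card (pverts ?S - M)"
      using m c2 module_family_card[OF H P] unfolding M by simp
  qed (use P in simp_all)
  then show ?thesis using T c unfolding attains_def by simp
qed

text \<open>The source and the sink each form a co-module: two vertices, two new members.\<close>

lemma attains_tt3:
  assumes H: "tournament H" and P: "module_family H P" "1 \<le> card P"
  shows "attains (lex_sum tt3 [tt1, H, tt1]) (card (pverts H) + 2) (card P + 2)"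
proof -
  let ?Hs = "[tt1, H, tt1]" and ?S = "lex_sum tt3 [tt1, H, tt1]"
  let ?s = "prod_encode (0, 0)" and ?t = "prod_encode (2, 0)"
  let ?N = "{{?s}, {?t}} :: nat set set"
  have "{..<length ?Hs} \<subseteq> pverts tt3" by auto
  then have T: "tournament ?S" by (intro tournament_lex_sum tournament_transitive tournament_parts(3)[OF H])
  have c: "card (pverts ?S) = card (pverts H) + 2"
    using card_lex_sum[of ?Hs tt3] tournamentD(1)[OF tournament_parts(3)[OF H]]
    by (simp add: numeral_eq_Suc lessThan_Suc)
  have V: "pverts ?S = {?s, ?t} \<union> (\<lambda>x. prod_encode (1, x)) ` pverts H"
    unfolding lex_sum_pverts by (auto simp: less_Suc_eq lessThan_Suc numeral_eq_Suc)
  have "(?s, v) \<in> parcs ?S" if "v \<in> pverts ?S - {?s}" for v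
    using that unfolding V by (auto simp: lex_sum_arc transitive_tournament_def)
  then have ms: "is_module ?S (pverts ?S - {?s})" by (intro is_module_minus_vertex) blast
  have "(?t, v) \<notin> parcs ?S" if "v \<in> pverts ?S - {?t}" for v
    using that unfolding V by (auto simp: lex_sum_arc transitive_tournament_def)
  then have mt: "is_module ?S (pverts ?S - {?t})" by (intro is_module_minus_vertex) blast
  have c2: "card (pverts ?S - {?s}) = card (pverts H) + 1" "card (pverts ?S - {?t}) = card (pverts H) + 1"
    using c V tournamentD(1)[OF T] by (subst card_Diff_singleton; auto)+
  have "\<exists>Q. comodule_family ?S Q \<and> card Q = card P + card ?N"
  proof (rule comodule_family_lex_sum[where i = 1])
    fix M assume "M \<in> ?N"
    then consider "M = {?s}" | "M = {?t}" by blast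
    then show "M \<noteq> {} \<and> M \<subseteq> pverts ?S - (\<lambda>x. prod_encode (1, x)) ` pverts (?Hs ! 1) \<and>
       is_module ?S (pverts ?S - M) \<and> 2 \<le> card (pverts ?S - M)"
    proof cases
      case 1
      have "M \<subseteq> pverts ?S - (\<lambda>x. prod_encode (1, x)) ` pverts (?Hs ! 1)" unfolding 1 V by auto
      then show ?thesis using ms c2 module_family_card[OF H P] unfolding 1 by simp
    next
      case 2
      have "M \<subseteq> pverts ?S - (\<lambda>x. prod_encode (1, x)) ` pverts (?Hs ! 1)" unfolding 2 V by auto
      then show ?thesis using mt c2 module_family_card[OF H P] unfolding 2 by simp
    qed
  next
    show "pairwise disjnt ?N" by (simp add: pairwise_insert disjnt_def)
  qed (use P in simp_all)
  then show ?thesis using T c unfolding attains_def by simp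
qed

lemma attains_dual: "attains T v d \<Longrightarrow> attains (dual T) v d"
  unfolding attains_def using tournament_dual comodule_family_dual by (metis dual_def pair_pre_digraph.select_convs(1))

lemma listed_attains:
  assumes n: "1 \<le> n" and S: "listed n S"
  shows "attains S (4 * n + 3) (2 * n + 1)"
proof -
  have t: "tournament X" if "X \<in> {tt1, C3, U5, V5, W5}" for X
    using that tournament_transitive tournament_C3 tournament_S5 by blast
  have c5: "card (pverts X) = 5" if "X \<in> {U5, V5, W5}" for X using pverts_S5[OF that] by simp
  have facts: "tournament H \<and> card (pverts H) = (\<Sum>X\<leftarrow>Xs. card (pverts X)) + 2 * (k - length Xs) \<and>
      (\<exists>P. module_family H P \<and> card P = length (filter (\<lambda>X. 2 \<le> card (pverts X)) Xs) + (k - length Xs))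
      \<and> length Xs \<le> k"
    if "H \<in> lex_sums k Xs" "set Xs \<subseteq> {tt1, C3, U5, V5, W5}" for H k Xs
    using lex_sums_properties[OF that(1) t] that unfolding lex_sums_def by blast
  \<comment> \<open>In this and the next three facts, \<open>B\<close> absorbs the length condition
    that \<open>facts\<close> delivers at the end.\<close>
  have plain: "attains H v d" if "tournament H \<and> card (pverts H) = v \<and> (\<exists>P. module_family H P \<and> card P = d) \<and> B" "2 \<le> d" for H v d B
    using that comodule_family_of_module_family unfolding attains_def by blast
  have c3: "attains (lex_sum C3 [tt1, tt1, H]) (v + 2) (d + 1)"
    if "tournament H \<and> card (pverts H) = v \<and> (\<exists>P. module_family H P \<and> card P = d) \<and> B" "1 \<le> d" for H v d B
    using that attains_C3[of H] by blast
  have two: "attains (lex_sum tt2 [tt1, H]) (v + 1) (d + 1)"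
    if "tournament H \<and> card (pverts H) = v \<and> (\<exists>P. module_family H P \<and> card P = d) \<and> B" "1 \<le> d" for H v d B
    using that attains_tt2[of H] by blast
  have three: "attains (lex_sum tt3 [tt1, H, tt1]) (v + 2) (d + 2)"
    if "tournament H \<and> card (pverts H) = v \<and> (\<exists>P. module_family H P \<and> card P = d) \<and> B" "1 \<le> d" for H v d B
    using that attains_tt3[of H] by blast
  have eq: "attains S v d \<Longrightarrow> v = 4 * n + 3 \<Longrightarrow> d = 2 * n + 1 \<Longrightarrow> ?thesis" for v d by simp
  from S show ?thesis unfolding listed_def
  proof (elim disjE bexE conjE)
    assume "S \<in> lex_sums (2 * n + 2) [tt1]"
    from eq[OF plain[OF facts[OF this]]] n show ?thesis by simp
  next
    assume "S \<in> lex_sums (2 * n + 1) [C3]"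
    from eq[OF plain[OF facts[OF this]]] n show ?thesis by simp
  next
    fix H assume "H \<in> lex_sums (2 * n) [C3]" and e: "S = lex_sum C3 [tt1, tt1, H]"
    from eq[unfolded e, OF c3[OF facts[OF this(1)]]] n e show ?thesis by simp
  next
    fix H assume "H \<in> lex_sums (2 * n + 1) [tt1]" and e: "S = lex_sum C3 [tt1, tt1, H]"
    from eq[unfolded e, OF c3[OF facts[OF this(1)]]] n e show ?thesis by simp
  next
    fix H assume "H \<in> lex_sums (2 * n + 2) [tt1, tt1]" and e: "S = lex_sum tt2 [tt1, H]"
    from eq[unfolded e, OF two[OF facts[OF this(1)]]] n e show ?thesis by simp
  next
    fix H assume "H \<in> lex_sums (2 * n + 2) [tt1, tt1]" and e: "S = dual (lex_sum tt2 [tt1, H])"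
    from eq[unfolded e, OF attains_dual[OF two[OF facts[OF this(1)]]]] n e show ?thesis by simp
  next
    fix H assume "H \<in> lex_sums (2 * n + 1) [C3, tt1]" and e: "S = lex_sum tt2 [tt1, H]"
    from eq[unfolded e, OF two[OF facts[OF this(1)]]] n e show ?thesis by simp
  next
    fix H assume "H \<in> lex_sums (2 * n + 1) [C3, tt1]" and e: "S = dual (lex_sum tt2 [tt1, H])"
    from eq[unfolded e, OF attains_dual[OF two[OF facts[OF this(1)]]]] n e show ?thesis by simp
  next
    fix H assume "H \<in> lex_sums (2 * n) [C3, C3]" and e: "S = lex_sum tt2 [tt1, H]"
    from eq[unfolded e, OF two[OF facts[OF this(1)]]] n e show ?thesis by simp
  next
    fix H assume "H \<in> lex_sums (2 * n) [C3, C3]" and e: "S = dual (lex_sum tt2 [tt1, H])"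
    from eq[unfolded e, OF attains_dual[OF two[OF facts[OF this(1)]]]] n e show ?thesis by simp
  next
    fix X H assume X: "X \<in> {U5, V5, W5}" and H: "H \<in> lex_sums (2 * n - 1) [X]" and e: "S = lex_sum tt3 [tt1, H, tt1]"
    have "set [X] \<subseteq> {tt1, C3, U5, V5, W5}" using X by auto
    from eq[unfolded e, OF three[OF facts[OF H this]]] n e c5[OF X] show ?thesis by simp
  next
    fix H assume "H \<in> lex_sums (2 * n + 2) [tt1, tt1, tt1]" and e: "S = lex_sum tt3 [tt1, H, tt1]"
    from eq[unfolded e, OF three[OF facts[OF this(1)]]] n e show ?thesis by simp
  next
    fix H assume n2: "2 \<le> n" and "H \<in> lex_sums (2 * n) [C3, C3, tt1]" and e: "S = lex_sum tt3 [tt1, H, tt1]"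
    from eq[unfolded e, OF three[OF facts[OF this(2)]]] n2 e show ?thesis by simp
  next
    fix H assume "H \<in> lex_sums (2 * n + 1) [tt1, tt1, C3]" and e: "S = lex_sum tt3 [tt1, H, tt1]"
    from eq[unfolded e, OF three[OF facts[OF this(1)]]] n e show ?thesis by simp
  next
    fix H assume n2: "2 \<le> n" and "H \<in> lex_sums (2 * n - 1) [C3, C3, C3]" and e: "S = lex_sum tt3 [tt1, H, tt1]"
    from eq[unfolded e, OF three[OF facts[OF this(2)]]] n2 e show ?thesis by simp
  qed
qed

section \<open>Families of minimal co-modules\<close>

definition min_comodule :: "'a pair_pre_digraph \<Rightarrow> 'a set \<Rightarrow> bool" where
  "min_comodule T M \<longleftrightarrow> comodule T M \<and> (\<forall>N. comodule T N \<and> N \<subseteq> M \<longrightarrow> N = M)"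

lemma ex_min_comodule:
  assumes T: "tournament T" and M: "comodule T M"
  shows "\<exists>N \<subseteq> M. min_comodule T N"
proof -
  have "finite M" using comodule_finite[OF T M] .
  then show ?thesis using M
  proof (induction M rule: finite_psubset_induct)
    case (psubset M)
    show ?case
    proof (cases "min_comodule T M")
      case False
      then obtain N where "comodule T N" "N \<subset> M" using psubset.prems unfolding min_comodule_def by blast
      then show ?thesis using psubset.IH[of N] by blast
    qed blast
  qed
qed

text \<open>Shrinking each member to a minimal co-module inside it keeps the members nonempty and
  disjoint, hence also their number.\<close>

lemma minimal_family:
  assumes T: "tournament T" and P: "comodule_family T P"
  shows "\<exists>Q. comodule_family T Q \<and> card Q = card P \<and> (\<forall>M\<in>Q. min_comodule T M)"
proof -
  have "\<exists>N \<subseteq> M. min_comodule T N" if "M \<in> P" for M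
    using ex_min_comodule[OF T, of M] P that by (simp add: comodule_family_def)
  then obtain g where g: "\<And>M. M \<in> P \<Longrightarrow> g M \<subseteq> M" "\<And>M. M \<in> P \<Longrightarrow> min_comodule T (g M)" by metis
  have ne: "g M \<noteq> {}" if "M \<in> P" for M using g(2)[OF that] by (simp add: min_comodule_def comodule_def)
  have dj: "g M \<inter> g N = {}" if "M \<in> P" "N \<in> P" "M \<noteq> N" for M N
  proof -
    have "M \<inter> N = {}" using P that unfolding comodule_family_def pairwise_def disjnt_def by metis
    then show ?thesis using g(1) that by blast
  qed
  have "inj_on g P"
  proof (rule inj_onI, rule ccontr)
    fix M N assume "M \<in> P" "N \<in> P" "g M = g N" "M \<noteq> N"
    then show False using dj[of M N] ne[of M] by simp
  qed
  then have "card (g ` P) = card P" by (rule card_image)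
  moreover have "comodule_family T (g ` P)" unfolding comodule_family_def
  proof (intro conjI ballI)
    show "finite (g ` P)" using P by (simp add: comodule_family_def)
    show "pairwise disjnt (g ` P)"
    proof (rule pairwiseI)
      fix A B assume "A \<in> g ` P" "B \<in> g ` P" "A \<noteq> B"
      then obtain M N where "M \<in> P" "N \<in> P" "M \<noteq> N" "A = g M" "B = g N" by blast
      then show "disjnt A B" using dj by (simp add: disjnt_def)
    qed
    show "comodule T A" if "A \<in> g ` P" for A using that g(2) unfolding min_comodule_def by blast
  qed
  ultimately show ?thesis using g(2) by blast
qed

lemma skew_subset:
  assumes "skew W r" "A \<subseteq> W" shows "skew A r"
  unfolding skew_def
proof (intro conjI ballI impI)
  show "finite A" using assms finite_subset unfolding skew_def by blast
  fix x y assume "x \<in> A" "y \<in> A" "x \<noteq> y"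
  then show "r x y \<noteq> r y x" using skewD[OF assms(1), of x y] assms(2) by blast
qed

text \<open>With three vertices, \<open>M\<close> and \<open>None\<close> would form a minimal side
  of four points. Switching at a point outside turns it into a module, and its four points have a
  nontrivial module, which would be a smaller side.\<close>

lemma min_nonmodule_card:
  assumes T: "tournament T" and M: "min_comodule T M" and n: "\<not> is_module T M"
  shows "card M \<noteq> 3"
proof
  assume c: "card M = 3"
  let ?W = "hatV T" and ?r = "hat T" and ?S = "insert None (Some ` M)"
  have sk: "skew ?W ?r" using skew_hat[OF T] .
  have cM: "comodule T M" and MV: "M \<subseteq> pverts T" using M unfolding min_comodule_def comodule_def by blast+
  have fM: "finite M" using comodule_finite[OF T cM] .
  have K: "is_module T (pverts T - M)" "2 \<le> card (pverts T - M)" "pverts T - M \<noteq> pverts T"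
    using cM n unfolding comodule_def by blast+
  have "nside ?W ?r (Some ` (pverts T - M))" using nside_hat_iff[OF T, of "pverts T - M"] K by blast
  then have "nside ?W ?r (?W - Some ` (pverts T - M))" by (rule nside_compl[OF sk])
  moreover have "?W - Some ` (pverts T - M) = ?S" using MV by (auto simp: hatV_def)
  ultimately have nS: "nside ?W ?r ?S" by simp
  have "min_side ?W ?r ?S" unfolding min_side_def
  proof (intro conjI allI impI)
    \<comment> \<open>A side inside \<open>?S\<close> gives a co-module inside \<open>M\<close>,
      hence all of \<open>M\<close>; if it lacked \<open>None\<close>, then \<open>M\<close> itself
      would be a module.\<close>
    fix B assume B: "nside ?W ?r B" "B \<subseteq> ?S"
    have "Some -` B \<subseteq> M" using B(2) by auto
    then have eq: "Some -` B = M" using M comodule_of_nside[OF T B(1)] unfolding min_comodule_def by blast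
    show "B = ?S"
    proof (cases "None \<in> B")
      case True
      have "Some ` M \<subseteq> B" unfolding eq[symmetric] by blast
      then show ?thesis using True B(2) by blast
    next
      case False
      then have "Some ` M = B" using Some_vimage[OF False] eq by simp
      then have "is_module T M" using nside_hat_iff[OF T MV] B(1) by simp
      then show ?thesis using n by simp
    qed
  qed (rule nS)
  note mS = this
  have "card (?W - ?S) \<ge> 2" using nS by (simp add: nside_def)
  then obtain w where w: "w \<in> ?W" "w \<notin> ?S"
    by (metis Diff_iff all_not_in_conv card.empty not_numeral_le_zero)
  let ?g = "rebase w ?r"
  have SU: "?S \<subseteq> ?W - {w}" using nside_subset[OF nS] w by blast
  have "skew (?W - {w}) ?g" using skew_rebase[OF sk] .
  then have skS: "skew ?S ?g" using SU by (rule skew_subset)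
  have c4: "card ?S = 4" using fM c by (simp add: card_image image_iff)
  obtain B where B: "homog ?S ?g B" "B \<noteq> ?S" "2 \<le> card B" using four_vertices[OF skS c4] .
  have BS: "B \<subseteq> ?S" using B(1) by (simp only: homog_def)
  have hS: "homog (?W - {w}) ?g ?S" using side_iff_homog[OF w] nS by (simp add: nside_def)
  have wB: "w \<notin> B" using BS w by blast
  have sB: "side ?W ?r B" using side_iff_homog[OF w(1) wB] homog_trans[OF hS B(1)] by blast
  have "B \<noteq> {}" using B(3) by auto
  then obtain b where "b \<in> B" by blast
  then have "B = {b}" using min_side_sub[OF sk mS sB BS _ B(2)] by blast
  then show False using B(3) by simp
qed

text \<open>If the complement of \<open>N\<close> is a module, all its vertices look at
  \<open>N\<close> as \<open>s\<close> does, and a source or sink sees \<open>N\<close>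
  uniformly.\<close>

lemma module_beside_singleton:
  assumes T: "tournament T" and s: "comodule T {s}" and N: "comodule T N" "s \<notin> N" "2 \<le> card N"
  shows "is_module T N"
proof (cases "is_module T N")
  case False
  then have K: "is_module T (pverts T - N)" using N unfolding comodule_def by blast
  have NV: "N \<subseteq> pverts T" using N unfolding comodule_def by blast
  have sV: "s \<in> pverts T" using comodule_singleton(1)[OF T s] .
  have ds: "(\<forall>v\<in>pverts T - {s}. (s, v) \<in> parcs T) \<or> (\<forall>v\<in>pverts T - {s}. (v, s) \<in> parcs T)"
    using comodule_singleton(2)[OF T s] .
  show ?thesis unfolding is_module_def
  proof (intro conjI ballI)
    show "N \<subseteq> pverts T" using NV .
    fix x y v assume H: "x \<in> N" "y \<in> N" "v \<in> pverts T - N"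
    have e: "(v, z) \<in> parcs T \<longleftrightarrow> (s, z) \<in> parcs T" if "z \<in> N" for z
      using is_moduleD2[OF T K, of v s z] H N(2) sV NV that by blast
    have xs: "x \<noteq> s" "y \<noteq> s" "x \<in> pverts T" "y \<in> pverts T" using H N(2) NV by blast+
    have "(s, x) \<in> parcs T \<longleftrightarrow> (s, y) \<in> parcs T"
      using ds xs tournamentD(5)[OF T sV, of x] tournamentD(5)[OF T sV, of y] by blast
    then show "(v, x) \<in> parcs T \<longleftrightarrow> (v, y) \<in> parcs T" using e H by blast
  qed
qed

text \<open>If both complements are modules, a vertex outside \<open>M\<close> looks at
  \<open>M\<close> as a vertex of \<open>N\<close> does, and that one sees \<open>M\<close>
  uniformly because \<open>M\<close> lies in the complement of \<open>N\<close>. So a disjoint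
  family has at most one member that is not a module.\<close>

lemma module_beside_nonmodule:
  assumes T: "tournament T" and M: "comodule T M" and N: "comodule T N" "\<not> is_module T N" and d: "M \<inter> N = {}"
  shows "is_module T M"
proof (cases "is_module T M")
  case False
  then have K: "is_module T (pverts T - M)" using M unfolding comodule_def by blast
  have L: "is_module T (pverts T - N)" using N unfolding comodule_def by blast
  have V: "M \<subseteq> pverts T" "N \<subseteq> pverts T" using M N unfolding comodule_def by blast+
  obtain z where z: "z \<in> N" using N(1) unfolding comodule_def by blast
  show ?thesis unfolding is_module_def
  proof (intro conjI ballI)
    show "M \<subseteq> pverts T" using V by blast
    fix x y v assume H: "x \<in> M" "y \<in> M" "v \<in> pverts T - M"
    show "(v, x) \<in> parcs T \<longleftrightarrow> (v, y) \<in> parcs T"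
    proof (cases "v \<in> N")
      case True
      then show ?thesis using is_moduleD[OF L, of x y v] H V d by blast
    next
      case False
      have "(v, u) \<in> parcs T \<longleftrightarrow> (z, u) \<in> parcs T" if "u \<in> M" for u
        using is_moduleD2[OF T K, of v z u] H z V d that by blast
      moreover have "(z, x) \<in> parcs T \<longleftrightarrow> (z, y) \<in> parcs T"
        using is_moduleD[OF L, of x y z] H z V d by blast
      ultimately show ?thesis using H by blast
    qed
  qed
qed

text \<open>Blocks come as sets, whereas \<open>lex_sums\<close> prescribes the order of the
  displayed parts; any order with the right multiplicities can be matched.\<close>

lemma arrange_list:
  assumes "finite A" "finite B" "A \<inter> B = {}" "\<And>M. M \<in> A \<Longrightarrow> Q M x" "\<And>M. M \<in> B \<Longrightarrow> Q M y" "x \<noteq> y"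
    "set Xs \<subseteq> {x, y}" "count_list Xs x = card A" "count_list Xs y = card B"
  shows "\<exists>Ss. distinct Ss \<and> set Ss = A \<union> B \<and> list_all2 Q Ss Xs"
  using assms
proof (induction Xs arbitrary: A B)
  case Nil
  then show ?case by simp
next
  case (Cons z Xs)
  show ?case
  proof (cases "z = x")
    case True
    then have "0 < card A" using Cons.prems(8) by simp
    then obtain a where a: "a \<in> A" by fastforce
    have "\<exists>Ss. distinct Ss \<and> set Ss = (A - {a}) \<union> B \<and> list_all2 Q Ss Xs"
      by (rule Cons.IH) (use Cons.prems True a in auto)
    then obtain Ss where "distinct Ss" "set Ss = (A - {a}) \<union> B" "list_all2 Q Ss Xs" by blast
    then show ?thesis using a Cons.prems(3,4) True by (intro exI[of _ "a # Ss"]) auto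
  next
    case False
    then have zy: "z = y" using Cons.prems(7) by simp
    then have "0 < card B" using Cons.prems(9) by simp
    then obtain b where b: "b \<in> B" by fastforce
    have "\<exists>Ss. distinct Ss \<and> set Ss = A \<union> (B - {b}) \<and> list_all2 Q Ss Xs"
      by (rule Cons.IH) (use Cons.prems zy b in auto)
    then obtain Ss where "distinct Ss" "set Ss = A \<union> (B - {b})" "list_all2 Q Ss Xs" by blast
    then show ?thesis using b Cons.prems(3,5) zy by (intro exI[of _ "b # Ss"]) auto
  qed
qed

lemma blocks_to_lex_sums:
  assumes T: "tournament T" and Ss: "distinct Ss" "list_all2 (\<lambda>M X. \<exists>f. tiso (induced T M) X f) Ss Xs"
    and Q: "finite Q" "\<And>M. M \<in> Q \<Longrightarrow> card M = 2" "set Ss \<inter> Q = {}"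
    and blocks: "\<And>M. M \<in> set Ss \<union> Q \<Longrightarrow> is_module T M \<and> M \<noteq> {}" "pairwise disjnt (set Ss \<union> Q)"
      "\<Union>(set Ss \<union> Q) = pverts T"
  shows "\<exists>H\<in>lex_sums (length Xs + card Q) Xs. \<exists>f. tiso T H f"
proof -
  obtain qs where qs: "set qs = Q" "distinct qs" using finite_distinct_list[OF Q(1)] by blast
  have lq: "length qs = card Q" using distinct_card[OF qs(2)] qs(1) by simp
  have ls: "length Ss = length Xs" using Ss(2) by (rule list_all2_lengthD)
  let ?Ms = "Ss @ qs" and ?k = "length Xs + card Q"
  have len: "length ?Ms = ?k" using lq ls by simp
  have setM: "set ?Ms = set Ss \<union> Q" using qs by simp
  have dM: "distinct ?Ms" using Ss(1) qs Q(3) by simp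
  have mem: "?Ms ! i \<in> set Ss \<union> Q" if "i < ?k" for i
  proof -
    have "?Ms ! i \<in> set ?Ms" by (rule nth_mem) (simp only: len that)
    then show ?thesis unfolding setM .
  qed
  show ?thesis
  proof (rule tiso_lex_sums[OF T len])
    show "length Xs \<le> ?k" by simp
    show "\<Union>(set ?Ms) = pverts T" unfolding setM using blocks(3) .
    show "?Ms ! i \<inter> ?Ms ! j = {}" if "i < ?k" "j < ?k" "i \<noteq> j" for i j
    proof -
      have "?Ms ! i \<noteq> ?Ms ! j" using nth_eq_iff_index_eq[OF dM] that len by metis
      then show ?thesis using pairwiseD[OF blocks(2) mem[OF that(1)] mem[OF that(2)]] by (simp add: disjnt_def)
    qed
    show "is_module T (?Ms ! i) \<and> ?Ms ! i \<noteq> {}" if "i < ?k" for i using blocks(1)[OF mem[OF that]] .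
    show "\<exists>f. tiso (induced T (?Ms ! i)) ((Xs @ replicate (?k - length Xs) tt2) ! i) f" if i: "i < ?k" for i
    proof (cases "i < length Xs")
      case True
      then show ?thesis using list_all2_nthD2[OF Ss(2) True] ls by (simp add: nth_append)
    next
      case False
      then have j: "i - length Xs < length qs" using i lq by simp
      have "?Ms ! i = qs ! (i - length Xs)" using False ls by (simp add: nth_append)
      then have MQ: "?Ms ! i \<in> Q" using nth_mem[OF j] qs(1) by simp
      then have "?Ms ! i \<subseteq> pverts T" using blocks(3) by blast
      then have "\<exists>f. tiso (induced T (?Ms ! i)) tt2 f" using tiso_tt2[OF T] Q(2)[OF MQ] by blast
      moreover have "(Xs @ replicate (?k - length Xs) tt2) ! i = tt2"
        using False i by (simp add: nth_append)
      ultimately show ?thesis by simp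
    qed
  qed
qed

definition sum_shape :: "'a pair_pre_digraph \<Rightarrow> nat \<Rightarrow> nat pair_pre_digraph list \<Rightarrow> bool" where
  "sum_shape T k Xs \<longleftrightarrow> (\<exists>H\<in>lex_sums k Xs. \<exists>f. tiso T H f)"

lemma transitive_tournament_neq_C3 [simp]:
  "transitive_tournament k \<noteq> C3" "C3 \<noteq> transitive_tournament k"
proof -
  have "(2, 0) \<in> parcs C3" "(2, 0) \<notin> parcs (transitive_tournament k)"
    by (simp_all add: C3_def transitive_tournament_def)
  then show "transitive_tournament k \<noteq> C3" "C3 \<noteq> transitive_tournament k" by metis+
qed

text \<open>The excess \<open>e\<close> over two vertices per module is shared out: a leftover
  vertex or a 3-cycle takes one unit, a block of five takes three, and blocks of four do not occur.
  Here \<open>t\<close> counts the 3-cycles and \<open>l\<close> the leftover vertices; each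
  leftover vertex is a further entry of the sum.\<close>

lemma module_family_shape:
  assumes T: "tournament T" and Q: "module_family T Q"
    and min: "\<And>M B. M \<in> Q \<Longrightarrow> is_module (induced T M) B \<Longrightarrow> 2 \<le> card B \<Longrightarrow> B = M"
    and c: "card (pverts T) = 2 * card Q + e" "e \<le> 3"
  shows "(\<exists>t l. t + l = e \<and> t \<le> card Q \<and> (\<forall>Xs. set Xs \<subseteq> {C3, tt1} \<longrightarrow> count_list Xs C3 = t \<longrightarrow>
       count_list Xs tt1 = l \<longrightarrow> sum_shape T (card Q + l) Xs)) \<or>
    e = 3 \<and> (\<exists>S\<in>{U5, V5, W5}. sum_shape T (card Q) [S])"
proof -
  let ?V = "pverts T" and ?L = "pverts T - \<Union>Q"
  have fV: "finite ?V" using tournamentD(1)[OF T] .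
  have mQ: "is_module T M" "2 \<le> card M" if "M \<in> Q" for M
    using Q that by (simp_all add: module_family_def)
  have fQ: "finite Q" and dQ: "pairwise disjnt Q" using Q by (simp_all add: module_family_def)
  have QV: "M \<subseteq> ?V" if "M \<in> Q" for M using mQ(1)[OF that] unfolding is_module_def by blast
  have fM: "finite M" if "M \<in> Q" for M using QV[OF that] fV finite_subset by blast
  have UV: "\<Union>Q \<subseteq> ?V" using QV by blast
  have "card (\<Union>Q) = sum card Q" using dQ fM by (rule card_Union_disjoint)
  moreover have "card ?V = card (\<Union>Q) + card ?L"
    using UV fV by (metis card_Diff_subset card_mono finite_subset le_add_diff_inverse)
  moreover have "sum card Q = (\<Sum>M\<in>Q. 2 + (card M - 2))"
  proof (rule sum.cong)
    show "card M = 2 + (card M - 2)" if "M \<in> Q" for M using mQ(2)[OF that] by linarith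
  qed simp
  moreover have "\<dots> = 2 * card Q + (\<Sum>M\<in>Q. card M - 2)" unfolding sum.distrib by simp
  ultimately have ex: "(\<Sum>M\<in>Q. card M - 2) + card ?L = e" using c(1) by linarith
  have le: "card M - 2 + (\<Sum>N\<in>Q - {M}. card N - 2) + card ?L = e" if "M \<in> Q" for M
    using ex sum.remove[OF fQ that, of "\<lambda>M. card M - 2"] by simp
  have small: "card M = 2 \<or> (card M = 3 \<and> (\<exists>f. tiso (induced T M) C3 f)) \<or>
     (card M = 5 \<and> (\<exists>S\<in>{U5, V5, W5}. \<exists>f. tiso (induced T M) S f))" if "M \<in> Q" for M
    by (rule small_minimal_module[OF T QV[OF that] mQ(2)[OF that]]) (use le[OF that] c(2) min[OF that] in auto)
  have single: "is_module T {v} \<and> {v} \<noteq> {}" "\<exists>f. tiso (induced T {v}) tt1 f" if "v \<in> ?L" for v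
    using that is_module_singleton tiso_tt1[OF T] by auto
  show ?thesis
  proof (cases "\<exists>M\<in>Q. card M = 5")
    case True
    then obtain M where M: "M \<in> Q" "card M = 5" by blast
    \<comment> \<open>A block of five uses up the whole excess, so all other blocks are pairs and no
      vertex is left over.\<close>
    have z: "(\<Sum>N\<in>Q - {M}. card N - 2) = 0" "card ?L = 0" "e = 3" using le[OF M(1)] M(2) c(2) by linarith+
    have L: "?L = {}" using z(2) fV by simp
    have two: "card N = 2" if "N \<in> Q - {M}" for N
    proof -
      have "card N - 2 = 0" using z(1) fQ that by (simp add: sum_eq_0_iff)
      then show ?thesis using mQ(2)[of N] that by simp
    qed
    obtain S f where S: "S \<in> {U5, V5, W5}" "tiso (induced T M) S f" using small[OF M(1)] M(2) by auto
    have ins: "set [M] \<union> (Q - {M}) = Q" using M(1) by auto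
    have "\<exists>H\<in>lex_sums (length [S] + card (Q - {M})) [S]. \<exists>f. tiso T H f"
    proof (rule blocks_to_lex_sums[OF T, where Ss = "[M]"], unfold ins)
      show "list_all2 (\<lambda>M X. \<exists>f. tiso (induced T M) X f) [M] [S]" using S(2) by auto
      show "is_module T N \<and> N \<noteq> {}" if "N \<in> Q" for N using mQ[OF that] by auto
      show "\<Union>Q = ?V" using L UV by blast
    qed (use fQ two dQ in auto)
    moreover have "length [S] + card (Q - {M}) = card Q"
      using card.remove[OF fQ M(1)] by simp
    ultimately have "sum_shape T (card Q) [S]" by (simp add: sum_shape_def)
    then show ?thesis using S(1) z(3) by blast
  next
    case False
    let ?A = "{M \<in> Q. card M = 3}" and ?B = "(\<lambda>v. {v}) ` ?L" and ?C = "{M \<in> Q. card M = 2}"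
    have QAC: "Q = ?A \<union> ?C" "?A \<inter> ?C = {}" using small False by auto
    have cQ: "card Q = card ?A + card ?C" using card_Un_disjoint[of ?A ?C] fQ QAC by auto
    have "(\<Sum>M\<in>Q. card M - 2) = (\<Sum>M\<in>?A. card M - 2) + (\<Sum>M\<in>?C. card M - 2)"
      using sum.union_disjoint[of ?A ?C "\<lambda>M. card M - 2"] fQ QAC by auto
    also have "\<dots> = card ?A" by simp
    finally have tl: "card ?A + card ?L = e" using ex by simp
    have cB: "card ?B = card ?L" by (rule card_image) simp
    have cA: "card M = 3" if "M \<in> ?A" for M using that by simp
    have AB: "?A \<inter> ?B = {}" using cA by fastforce
    have "sum_shape T (card Q + card ?L) Xs"
      if Xs: "set Xs \<subseteq> {C3, tt1}" "count_list Xs C3 = card ?A" "count_list Xs tt1 = card ?L" for Xs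
    proof -
      have fA: "finite ?A" "finite ?B" using fQ fV by simp_all
      have isoA: "\<exists>f. tiso (induced T M) C3 f" if "M \<in> ?A" for M using small[of M] that by auto
      have isoB: "\<exists>f. tiso (induced T M) tt1 f" if "M \<in> ?B" for M using tiso_tt1[OF T] that by blast
      have cc: "count_list Xs tt1 = card ?B" using Xs(3) cB by simp
      obtain Ss where Ss: "distinct Ss" "set Ss = ?A \<union> ?B" "list_all2 (\<lambda>M X. \<exists>f. tiso (induced T M) X f) Ss Xs"
        using arrange_list[OF fA AB, where Q = "\<lambda>M X. \<exists>f. tiso (induced T M) X f", OF isoA isoB transitive_tournament_neq_C3(2)[of 1] Xs(1,2) cc]
        by blast
      have un: "set Ss \<union> ?C = Q \<union> ?B" using Ss(2) QAC(1) by blast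
      have BQ: "b \<inter> M = {}" if "b \<in> ?B" "M \<in> Q" for b M using that by blast
      have "\<exists>H\<in>lex_sums (length Xs + card ?C) Xs. \<exists>f. tiso T H f"
      proof (rule blocks_to_lex_sums[OF T Ss(1,3)], unfold un)
        show "finite ?C" "\<And>M. M \<in> ?C \<Longrightarrow> card M = 2" using fQ by simp_all
        show "set Ss \<inter> ?C = {}" unfolding Ss(2) by auto
        show "is_module T M \<and> M \<noteq> {}" if "M \<in> Q \<union> ?B" for M
        proof (cases "M \<in> Q")
          case True then show ?thesis using mQ[OF True] by auto
        next
          case False then show ?thesis using that single(1) by blast
        qed
        show "\<Union>(Q \<union> ?B) = ?V" using UV by auto
        show "pairwise disjnt (Q \<union> ?B)"
        proof (rule pairwiseI)
          fix M N assume MN: "M \<in> Q \<union> ?B" "N \<in> Q \<union> ?B" "M \<noteq> N"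
          from MN(1,2) show "disjnt M N"
          proof (elim UnE)
            assume "M \<in> Q" "N \<in> Q" then show ?thesis using pairwiseD[OF dQ] MN(3) by simp
          next
            assume "M \<in> Q" "N \<in> ?B" then show ?thesis using BQ[of N M] by (simp add: disjnt_def Int_commute)
          next
            assume "M \<in> ?B" "N \<in> Q" then show ?thesis using BQ[of M N] by (simp add: disjnt_def)
          next
            assume "M \<in> ?B" "N \<in> ?B" then show ?thesis using MN(3) by (auto simp: disjnt_def)
          qed
        qed
      qed
      moreover have "length Xs = card ?A + card ?L"
      proof -
        have "length Xs = count_list Xs C3 + count_list Xs tt1"
          using Xs(1) transitive_tournament_neq_C3(2)[of 1] by (induction Xs) auto
        then show ?thesis using Xs(2,3) by simp
      qed
      ultimately have "\<exists>H\<in>lex_sums (card ?A + card ?L + card ?C) Xs. \<exists>f. tiso T H f" by simp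
      moreover have "card ?A + card ?L + card ?C = card Q + card ?L" using cQ by simp
      ultimately show ?thesis unfolding sum_shape_def by metis
    qed
    moreover have "card ?A \<le> card Q" using cQ by simp
    ultimately show ?thesis using tl by blast
  qed
qed

lemma tiso_lex_sum_C3:
  assumes T: "tournament T" and V: "pverts T = insert a (insert b K)" "a \<notin> K" "b \<notin> K" "a \<noteq> b"
    and arcs: "(a, b) \<in> parcs T" "\<And>k. k \<in> K \<Longrightarrow> (b, k) \<in> parcs T" "\<And>k. k \<in> K \<Longrightarrow> (k, a) \<in> parcs T"
    and f: "tiso (induced T K) H f"
  shows "\<exists>f. tiso T (lex_sum C3 [tt1, tt1, H]) f"
proof (rule tiso_lex_sum)
  let ?Ms = "[{a}, {b}, K]"
  have n: "(b, a) \<notin> parcs T" "\<And>k. k \<in> K \<Longrightarrow> (k, b) \<notin> parcs T" "\<And>k. k \<in> K \<Longrightarrow> (a, k) \<notin> parcs T"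
    using arcs V tournamentD(2,3,5)[OF T] by metis+
  have cases3: "i = 0 \<or> i = 1 \<or> i = 2" if "i < length ?Ms" for i using that by auto
  show "\<Union>(set ?Ms) = pverts T" using V(1) by auto
  show "?Ms ! i \<inter> ?Ms ! j = {}" if "i < length ?Ms" "j < length ?Ms" "i \<noteq> j" for i j
    using cases3[OF that(1)] cases3[OF that(2)] that(3) V by auto
  show "\<exists>f. tiso (induced T (?Ms ! i)) ([tt1, tt1, H] ! i) f" if "i < length ?Ms" for i
    using cases3[OF that] tiso_tt1[OF T] f by auto
  show "(u, v) \<in> parcs T \<longleftrightarrow> (i, j) \<in> parcs C3"
    if "i < length ?Ms" "j < length ?Ms" "i \<noteq> j" "u \<in> ?Ms ! i" "v \<in> ?Ms ! j" for i j u v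
    using cases3[OF that(1)] cases3[OF that(2)] that(3-5) arcs n by (auto simp: C3_def)
qed simp

lemma tiso_lex_sum_tt2:
  assumes T: "tournament T" and V: "pverts T = insert s K" "s \<notin> K"
    and arcs: "\<And>k. k \<in> K \<Longrightarrow> (s, k) \<in> parcs T"
    and f: "tiso (induced T K) H f"
  shows "\<exists>f. tiso T (lex_sum tt2 [tt1, H]) f"
proof (rule tiso_lex_sum)
  let ?Ms = "[{s}, K]"
  have n: "\<And>k. k \<in> K \<Longrightarrow> (k, s) \<notin> parcs T" using arcs V tournamentD(2,3,5)[OF T] by metis
  have cases2: "i = 0 \<or> i = 1" if "i < length ?Ms" for i using that by auto
  show "\<Union>(set ?Ms) = pverts T" using V(1) by auto
  show "?Ms ! i \<inter> ?Ms ! j = {}" if "i < length ?Ms" "j < length ?Ms" "i \<noteq> j" for i j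
    using cases2[OF that(1)] cases2[OF that(2)] that(3) V by auto
  show "\<exists>f. tiso (induced T (?Ms ! i)) ([tt1, H] ! i) f" if "i < length ?Ms" for i
    using cases2[OF that] tiso_tt1[OF T] f by auto
  show "(u, v) \<in> parcs T \<longleftrightarrow> (i, j) \<in> parcs tt2"
    if "i < length ?Ms" "j < length ?Ms" "i \<noteq> j" "u \<in> ?Ms ! i" "v \<in> ?Ms ! j" for i j u v
    using cases2[OF that(1)] cases2[OF that(2)] that(3-5) arcs n by (auto simp: transitive_tournament_def)
qed simp

lemma tiso_lex_sum_tt3:
  assumes T: "tournament T" and V: "pverts T = insert s (insert t K)" "s \<notin> K" "t \<notin> K" "s \<noteq> t"
    and arcs: "(s, t) \<in> parcs T" "\<And>k. k \<in> K \<Longrightarrow> (s, k) \<in> parcs T" "\<And>k. k \<in> K \<Longrightarrow> (k, t) \<in> parcs T"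
    and f: "tiso (induced T K) H f"
  shows "\<exists>f. tiso T (lex_sum tt3 [tt1, H, tt1]) f"
proof (rule tiso_lex_sum)
  let ?Ms = "[{s}, K, {t}]"
  have n: "(t, s) \<notin> parcs T" "\<And>k. k \<in> K \<Longrightarrow> (k, s) \<notin> parcs T" "\<And>k. k \<in> K \<Longrightarrow> (t, k) \<notin> parcs T"
    using arcs V tournamentD(2,3,5)[OF T] by metis+
  have cases3: "i = 0 \<or> i = 1 \<or> i = 2" if "i < length ?Ms" for i using that by auto
  show "\<Union>(set ?Ms) = pverts T" using V(1) by auto
  show "?Ms ! i \<inter> ?Ms ! j = {}" if "i < length ?Ms" "j < length ?Ms" "i \<noteq> j" for i j
    using cases3[OF that(1)] cases3[OF that(2)] that(3) V by auto
  show "\<exists>f. tiso (induced T (?Ms ! i)) ([tt1, H, tt1] ! i) f" if "i < length ?Ms" for i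
    using cases3[OF that] tiso_tt1[OF T] f by auto
  show "(u, v) \<in> parcs T \<longleftrightarrow> (i, j) \<in> parcs tt3"
    if "i < length ?Ms" "j < length ?Ms" "i \<noteq> j" "u \<in> ?Ms ! i" "v \<in> ?Ms ! j" for i j u v
    using cases3[OF that(1)] cases3[OF that(2)] that(3-5) arcs n by (auto simp: transitive_tournament_def)
qed simp

lemma induced_whole: "tournament T \<Longrightarrow> induced T (pverts T) = T"
  unfolding induced_def tournament_iff by (auto intro!: pair_pre_digraph.equality)

lemma induced_induced: "M \<subseteq> K \<Longrightarrow> induced (induced T K) M = induced T M"
  by (auto simp: induced_def)

definition module_blocks :: "'a pair_pre_digraph \<Rightarrow> 'a set set \<Rightarrow> bool" where
  "module_blocks T Q \<longleftrightarrow> finite Q \<and> pairwise disjnt Q \<and>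
     (\<forall>M\<in>Q. min_comodule T M \<and> is_module T M \<and> 2 \<le> card M)"

text \<open>A module of a block is a module of \<open>T\<close> and, if it has two vertices, a
  co-module; so minimality makes each block indecomposable. \<open>K\<close> leaves room for
  removing a source, a sink or an exceptional pair.\<close>

lemma module_blocks_shape:
  assumes T: "tournament T" and Q: "module_blocks T Q" and K: "\<Union>Q \<subseteq> K" "K \<subseteq> pverts T"
    and c: "card K = 2 * card Q + e" "e \<le> 3"
  shows "(\<exists>t l. t + l = e \<and> t \<le> card Q \<and> (\<forall>Xs. set Xs \<subseteq> {C3, tt1} \<longrightarrow> count_list Xs C3 = t \<longrightarrow>
       count_list Xs tt1 = l \<longrightarrow> sum_shape (induced T K) (card Q + l) Xs)) \<or>
    e = 3 \<and> (\<exists>S\<in>{U5, V5, W5}. sum_shape (induced T K) (card Q) [S])"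
proof (rule module_family_shape)
  show "tournament (induced T K)" using tournament_induced[OF T K(2)] .
  have MK: "M \<subseteq> K" if "M \<in> Q" for M using that K(1) by blast
  show "module_family (induced T K) Q"
    using Q is_module_induced[OF _ MK K(2)] unfolding module_blocks_def module_family_def by blast
  show "card (pverts (induced T K)) = 2 * card Q + e" using c(1) by simp
  show "e \<le> 3" using c(2) .
  fix M B assume M: "M \<in> Q" and B: "is_module (induced (induced T K) M) B" "2 \<le> card B"
  have m: "min_comodule T M" "is_module T M" using Q M by (simp_all add: module_blocks_def)
  have B': "is_module (induced T M) B" using B(1) induced_induced[OF MK[OF M]] by simp
  have BM: "B \<subseteq> M" using B' by (simp only: is_module_def induced_simps(1))
  have cM: "comodule T M" using m(1) by (simp add: min_comodule_def)
  have "is_module T B" using is_module_trans[OF m(2) B'] .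
  moreover have "B \<noteq> {}" using B(2) by auto
  moreover have "B \<subseteq> pverts T" "B \<noteq> pverts T" using BM cM unfolding comodule_def by blast+
  ultimately have "comodule T B" using B(2) by (simp add: comodule_def)
  then show "B = M" using m(1) BM unfolding min_comodule_def by blast
qed

lemma shape_excess1:
  assumes T: "tournament T" and Q: "module_blocks T Q" and K: "\<Union>Q \<subseteq> K" "K \<subseteq> pverts T"
    and c: "card K = 2 * card Q + 1"
  shows "sum_shape (induced T K) (card Q + 1) [tt1] \<or> sum_shape (induced T K) (card Q) [C3]"
proof -
  from module_blocks_shape[OF T Q K c] obtain t l where tl: "t + l = 1" and
    all: "\<And>Xs. set Xs \<subseteq> {C3, tt1} \<Longrightarrow> count_list Xs C3 = t \<Longrightarrow>
       count_list Xs tt1 = l \<Longrightarrow> sum_shape (induced T K) (card Q + l) Xs" by auto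
  from tl consider "t = 0" "l = 1" | "t = 1" "l = 0" by linarith
  then show ?thesis
  proof cases
    case 1 then show ?thesis using all[of "[tt1]"] by simp
  next
    case 2 then show ?thesis using all[of "[C3]"] by simp
  qed
qed

lemma shape_excess2:
  assumes T: "tournament T" and Q: "module_blocks T Q" and K: "\<Union>Q \<subseteq> K" "K \<subseteq> pverts T"
    and c: "card K = 2 * card Q + 2"
  shows "sum_shape (induced T K) (card Q + 2) [tt1, tt1] \<or> sum_shape (induced T K) (card Q + 1) [C3, tt1] \<or>
    sum_shape (induced T K) (card Q) [C3, C3]"
proof -
  from module_blocks_shape[OF T Q K c] obtain t l where tl: "t + l = 2" and
    all: "\<And>Xs. set Xs \<subseteq> {C3, tt1} \<Longrightarrow> count_list Xs C3 = t \<Longrightarrow>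
       count_list Xs tt1 = l \<Longrightarrow> sum_shape (induced T K) (card Q + l) Xs" by auto
  from tl consider "t = 0" "l = 2" | "t = 1" "l = 1" | "t = 2" "l = 0" by linarith
  then show ?thesis
  proof cases
    case 1 then show ?thesis using all[of "[tt1, tt1]"] by simp
  next
    case 2 then show ?thesis using all[of "[C3, tt1]"] by simp
  next
    case 3 then show ?thesis using all[of "[C3, C3]"] by simp
  qed
qed

text \<open>The lower bounds on \<open>card Q\<close> say that there are enough blocks for the
  3-cycles; they turn into \<open>2 \<le> n\<close> later.\<close>

lemma shape_excess3:
  assumes T: "tournament T" and Q: "module_blocks T Q" and K: "\<Union>Q \<subseteq> K" "K \<subseteq> pverts T"
    and c: "card K = 2 * card Q + 3"
  shows "(\<exists>S\<in>{U5, V5, W5}. sum_shape (induced T K) (card Q) [S]) \<or>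
    sum_shape (induced T K) (card Q + 3) [tt1, tt1, tt1] \<or>
    2 \<le> card Q \<and> sum_shape (induced T K) (card Q + 1) [C3, C3, tt1] \<or>
    sum_shape (induced T K) (card Q + 2) [tt1, tt1, C3] \<or>
    3 \<le> card Q \<and> sum_shape (induced T K) (card Q) [C3, C3, C3]"
  using module_blocks_shape[OF T Q K c order_refl]
proof (elim disjE exE conjE)
  fix t l assume tl: "t + l = 3" "t \<le> card Q" and all: "\<forall>Xs. set Xs \<subseteq> {C3, tt1} \<longrightarrow> count_list Xs C3 = t \<longrightarrow>
       count_list Xs tt1 = l \<longrightarrow> sum_shape (induced T K) (card Q + l) Xs"
  from tl(1) consider "t = 0" "l = 3" | "t = 1" "l = 2" | "t = 2" "l = 1" | "t = 3" "l = 0" by linarith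
  then show ?thesis
  proof cases
    case 1 then show ?thesis using all[rule_format, of "[tt1, tt1, tt1]"] by simp
  next
    case 2 then show ?thesis using all[rule_format, of "[tt1, tt1, C3]"] by simp
  next
    case 3 then show ?thesis using all[rule_format, of "[C3, C3, tt1]"] tl(2) by simp
  next
    case 4 then show ?thesis using all[rule_format, of "[C3, C3, C3]"] tl(2) by simp
  qed
qed blast

section \<open>Tournaments with \<open>2 * n + 1\<close> disjoint co-modules have a listed
  form\<close>

definition realizes :: "nat \<Rightarrow> 'a pair_pre_digraph \<Rightarrow> bool" where
  "realizes n T \<longleftrightarrow> (\<exists>S. listed n S \<and> (\<exists>f. tiso T S f))"

text \<open>Besides the source there are \<open>4 * n + 2\<close> vertices, two more than
  \<open>2 * n\<close> pairs would take.\<close>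

lemma realizes_source:
  assumes T: "tournament T" and c: "card (pverts T) = 4 * n + 3"
    and s: "s \<in> pverts T" "\<And>v. v \<in> pverts T \<Longrightarrow> v \<noteq> s \<Longrightarrow> (s, v) \<in> parcs T"
    and Q: "module_blocks T Q" "card Q = 2 * n" "\<Union>Q \<subseteq> pverts T - {s}"
  shows "\<exists>H. (H \<in> lex_sums (2 * n + 2) [tt1, tt1] \<or> H \<in> lex_sums (2 * n + 1) [C3, tt1] \<or> H \<in> lex_sums (2 * n) [C3, C3])
    \<and> (\<exists>f. tiso T (lex_sum tt2 [tt1, H]) f)"
proof -
  let ?K = "pverts T - {s}"
  have cK: "card ?K = 2 * card Q + 2" using c s(1) tournamentD(1)[OF T] Q(2) by simp
  have outer: "\<exists>f. tiso T (lex_sum tt2 [tt1, H]) f" if "tiso (induced T ?K) H f" for H f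
    by (rule tiso_lex_sum_tt2[OF T _ _ _ that]) (use s in auto)
  have "\<exists>H f. (H \<in> lex_sums (2 * n + 2) [tt1, tt1] \<or> H \<in> lex_sums (2 * n + 1) [C3, tt1] \<or> H \<in> lex_sums (2 * n) [C3, C3])
     \<and> tiso (induced T ?K) H f"
    using shape_excess2[OF T Q(1,3) Diff_subset cK] unfolding sum_shape_def Q(2) by blast
  then show ?thesis using outer by blast
qed

lemma tiso_dual: "tiso (dual T) S f \<Longrightarrow> tiso T (dual S) f"
  unfolding tiso_def dual_def by simp

lemma module_blocks_dual:
  assumes "tournament T" shows "module_blocks (dual T) Q \<longleftrightarrow> module_blocks T Q"
proof -
  have "pverts (dual T) = pverts T" by (simp add: dual_def)
  then have "comodule (dual T) M \<longleftrightarrow> comodule T M" for M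
    unfolding comodule_def is_module_dual[OF assms] by simp
  then show ?thesis unfolding module_blocks_def min_comodule_def is_module_dual[OF assms] by simp
qed

text \<open>Besides source and sink there are \<open>4 * n + 1\<close> vertices, three more than
  \<open>2 * n - 1\<close> pairs would take.\<close>

lemma realizes_source_sink:
  assumes n: "1 \<le> n" and T: "tournament T" and c: "card (pverts T) = 4 * n + 3"
    and s: "s \<in> pverts T" "\<And>v. v \<in> pverts T \<Longrightarrow> v \<noteq> s \<Longrightarrow> (s, v) \<in> parcs T"
    and t: "t \<in> pverts T" "\<And>v. v \<in> pverts T \<Longrightarrow> v \<noteq> t \<Longrightarrow> (v, t) \<in> parcs T" and st: "s \<noteq> t"
    and Q: "module_blocks T Q" "card Q = 2 * n - 1" "\<Union>Q \<subseteq> pverts T - {s, t}"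
  shows "realizes n T"
proof -
  let ?K = "pverts T - {s, t}"
  have cK: "card ?K = 2 * card Q + 3"
    using c s(1) t(1) st tournamentD(1)[OF T] Q(2) n by (simp add: card_Diff_subset)
  have outer: "\<exists>f. tiso T (lex_sum tt3 [tt1, H, tt1]) f" if "tiso (induced T ?K) H f" for H f
    by (rule tiso_lex_sum_tt3[OF T _ _ _ _ _ _ _ that]) (use s t st in auto)
  \<comment> \<open>For \<open>n = 1\<close> there is a single block, so two or three 3-cycles among
    the blocks mean \<open>2 \<le> n\<close>.\<close>
  have k: "2 * n - 1 + 3 = 2 * n + 2" "2 * n - 1 + 1 = 2 * n" "2 * n - 1 + 2 = 2 * n + 1"
    "2 \<le> 2 * n - 1 \<longleftrightarrow> 2 \<le> n" "3 \<le> 2 * n - 1 \<longleftrightarrow> 2 \<le> n" using n by auto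
  have "\<exists>H f. ((\<exists>S\<in>{U5, V5, W5}. H \<in> lex_sums (2 * n - 1) [S]) \<or> H \<in> lex_sums (2 * n + 2) [tt1, tt1, tt1] \<or>
     2 \<le> n \<and> H \<in> lex_sums (2 * n) [C3, C3, tt1] \<or> H \<in> lex_sums (2 * n + 1) [tt1, tt1, C3] \<or>
     2 \<le> n \<and> H \<in> lex_sums (2 * n - 1) [C3, C3, C3]) \<and> tiso (induced T ?K) H f"
    using shape_excess3[OF T Q(1,3) Diff_subset cK] unfolding sum_shape_def Q(2) k by blast
  then obtain H where H: "(\<exists>S\<in>{U5, V5, W5}. H \<in> lex_sums (2 * n - 1) [S]) \<or> H \<in> lex_sums (2 * n + 2) [tt1, tt1, tt1] \<or>
     2 \<le> n \<and> H \<in> lex_sums (2 * n) [C3, C3, tt1] \<or> H \<in> lex_sums (2 * n + 1) [tt1, tt1, C3] \<or>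
     2 \<le> n \<and> H \<in> lex_sums (2 * n - 1) [C3, C3, C3]" "\<exists>f. tiso T (lex_sum tt3 [tt1, H, tt1]) f"
    using outer by blast
  have "listed n (lex_sum tt3 [tt1, H, tt1])" using H(1) unfolding listed_def by blast
  then show ?thesis using H(2) unfolding realizes_def by blast
qed

text \<open>If all members are modules, the excess is one. Otherwise exactly one member
  \<open>N\<close> is no module; counting gives it at most three vertices,
  \<open>min_nonmodule_card\<close> excludes three, and its two vertices form a 3-cycle with the
  module \<open>pverts T - N\<close>.\<close>

lemma realizes_no_singletons:
  assumes T: "tournament T" and c: "card (pverts T) = 4 * n + 3"
    and P: "comodule_family T P" "card P = 2 * n + 1" "\<And>M. M \<in> P \<Longrightarrow> min_comodule T M" "\<And>M. M \<in> P \<Longrightarrow> 2 \<le> card M"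
  shows "realizes n T"
proof -
  have cP: "comodule T M" if "M \<in> P" for M using P(1) that by (simp add: comodule_family_def)
  have fP: "finite P" and dP: "pairwise disjnt P" using P(1) by (simp_all add: comodule_family_def)
  have PV: "M \<subseteq> pverts T" if "M \<in> P" for M using cP[OF that] by (simp add: comodule_def)
  show ?thesis
  proof (cases "\<forall>M\<in>P. is_module T M")
    case True
    then have B: "module_blocks T P" using fP dP P(3,4) by (simp add: module_blocks_def)
    have U: "\<Union>P \<subseteq> pverts T" using PV by blast
    have "card (pverts T) = 2 * card P + 1" using c P(2) by simp
    from shape_excess1[OF T B U order_refl this]
    have "\<exists>S. (S \<in> lex_sums (2 * n + 2) [tt1] \<or> S \<in> lex_sums (2 * n + 1) [C3]) \<and> (\<exists>f. tiso T S f)"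
      unfolding induced_whole[OF T] sum_shape_def P(2) by auto
    then show ?thesis unfolding realizes_def listed_def by blast
  next
    case False
    then obtain N where N: "N \<in> P" "\<not> is_module T N" by blast
    let ?Q = "P - {N}" and ?K = "pverts T - N"
    have K: "is_module T ?K" using cP[OF N(1)] N(2) unfolding comodule_def by blast
    have dN: "M \<inter> N = {}" if "M \<in> ?Q" for M
      using that pairwiseD[OF dP, of M N] N(1) by (simp add: disjnt_def)
    have cQ: "card ?Q = 2 * n" using N(1) fP P(2) by simp
    have BQ: "module_blocks T ?Q" unfolding module_blocks_def
    proof (intro conjI ballI)
      show "pairwise disjnt ?Q" using dP by (rule pairwise_subset) blast
      show "is_module T M" if "M \<in> ?Q" for M
        by (rule module_beside_nonmodule[OF T cP cP N(2) dN]) (use that N(1) in auto)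
    qed (use fP P(3,4) in auto)
    have UK: "\<Union>?Q \<subseteq> ?K" using PV dN by blast
    have fV: "finite (pverts T)" using tournamentD(1)[OF T] .
    have "(\<Sum>M\<in>P. card M) = card N + (\<Sum>M\<in>?Q. card M)" using sum.remove[OF fP N(1)] by simp
    moreover have "(\<Sum>M\<in>?Q. 2) \<le> (\<Sum>M\<in>?Q. card M)" by (rule sum_mono) (use P(4) in auto)
    ultimately have "card N + 2 * (2 * n) \<le> 4 * n + 3"
      using sum_card_comodule_family[OF T P(1)] c cQ by simp
    then have cN: "card N = 2" using P(4)[OF N(1)] min_nonmodule_card[OF T P(3)[OF N(1)] N(2)] by linarith
    have NV: "N \<subseteq> pverts T" using PV[OF N(1)] .
    have cK: "card ?K = 2 * card ?Q + 1"
      using card_Diff_subset[OF finite_subset[OF NV fV] NV] c cN cQ by simp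
    have "\<exists>a b. N = {a, b} \<and> a \<noteq> b \<and> (a, b) \<in> parcs T"
    proof -
      obtain a b where ab: "N = {a, b}" "a \<noteq> b" using cN by (auto simp: card_2_iff)
      have "(a, b) \<in> parcs T \<or> (b, a) \<in> parcs T" using tournamentD(5)[OF T, of a b] ab NV by blast
      then show ?thesis using ab by blast
    qed
    then obtain a b where ab: "N = {a, b}" "a \<noteq> b" "(a, b) \<in> parcs T" by blast
    have abV: "a \<in> pverts T" "b \<in> pverts T" using NV ab by blast+
    obtain v where v: "v \<in> ?K" "(v, a) \<in> parcs T \<longleftrightarrow> (v, b) \<notin> parcs T"
      using N(2) NV unfolding is_module_def ab(1) by blast
    have hom: "(k, u) \<in> parcs T \<longleftrightarrow> (v, u) \<in> parcs T" if "k \<in> ?K" "u \<in> N" for k u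
      using is_moduleD2[OF T K that(1) v(1), of u] that(2) NV by blast
    \<comment> \<open>If \<open>v\<close> did not beat \<open>a\<close>, no vertex outside
      \<open>N\<close> would, so \<open>a\<close> would be a source and \<open>{a}\<close> a smaller
      co-module.\<close>
    have va: "(v, a) \<in> parcs T"
    proof (rule ccontr)
      assume n: "(v, a) \<notin> parcs T"
      have "(a, k) \<in> parcs T" if "k \<in> pverts T - {a}" for k
      proof (cases "k = b")
        case False
        then have kK: "k \<in> ?K" using that ab by blast
        then have "(k, a) \<notin> parcs T" using hom[OF kK, of a] n ab by blast
        then show ?thesis using tournamentD(5)[OF T abV(1), of k] that by blast
      qed (use ab in simp)
      then have m: "is_module T (pverts T - {a})" by (intro is_module_minus_vertex) blast
      have "2 \<le> card (pverts T - {a})" using c fV abV(1) by simp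
      moreover have "{a} \<noteq> pverts T" using abV(2) ab(2) by (metis singletonD)
      ultimately have "comodule T {a}" using m abV(1) by (simp add: comodule_def)
      then have "{a} = N" using P(3)[OF N(1)] ab(1) unfolding min_comodule_def by blast
      then show False using ab by blast
    qed
    have arcs: "(k, a) \<in> parcs T" "(b, k) \<in> parcs T" if "k \<in> ?K" for k
    proof -
      show "(k, a) \<in> parcs T" using hom[OF that, of a] va ab by blast
      have "(k, b) \<notin> parcs T" using hom[OF that, of b] va v(2) ab by blast
      then show "(b, k) \<in> parcs T" using tournamentD(5)[OF T abV(2), of k] that ab by blast
    qed
    have outer: "\<exists>f. tiso T (lex_sum C3 [tt1, tt1, H]) f" if "tiso (induced T ?K) H f" for H f
      by (rule tiso_lex_sum_C3[OF T _ _ _ ab(2,3) arcs(2,1) that]) (use ab NV in auto)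
    have "\<exists>H f. (H \<in> lex_sums (2 * n + 1) [tt1] \<or> H \<in> lex_sums (2 * n) [C3]) \<and> tiso (induced T ?K) H f"
      using shape_excess1[OF T BQ UK Diff_subset cK] unfolding sum_shape_def cQ by blast
    then obtain H where H: "H \<in> lex_sums (2 * n + 1) [tt1] \<or> H \<in> lex_sums (2 * n) [C3]"
      "\<exists>f. tiso T (lex_sum C3 [tt1, tt1, H]) f" using outer by blast
    have "listed n (lex_sum C3 [tt1, tt1, H])" using H(1) unfolding listed_def by blast
    then show ?thesis using H(2) unfolding realizes_def by blast
  qed
qed

text \<open>The number of singletons among the minimal members decides the outer sum: none leads to
  a plain sum or one over a 3-cycle, one to \<open>tt2\<close> or its dual, two to
  \<open>tt3\<close>. Beside a singleton all larger members are modules.\<close>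

lemma realizes_of_family:
  assumes n: "1 \<le> n" and T: "tournament T" and c: "card (pverts T) = 4 * n + 3"
    and P0: "comodule_family T P0" "card P0 = 2 * n + 1"
  shows "realizes n T"
proof -
  obtain P where P: "comodule_family T P" "card P = 2 * n + 1" "\<And>M. M \<in> P \<Longrightarrow> min_comodule T M"
    using minimal_family[OF T P0(1)] P0(2) by auto
  have cP: "comodule T M" if "M \<in> P" for M using P(1) that by (simp add: comodule_family_def)
  have fP: "finite P" and dP: "pairwise disjnt P" using P(1) by (simp_all add: comodule_family_def)
  have fV: "finite (pverts T)" using tournamentD(1)[OF T] .
  define A where "A = {s. {s} \<in> P}"
  have Asub: "A \<subseteq> {s. comodule T {s}}" using cP by (auto simp: A_def)
  have fA: "finite A" "card A \<le> 2"
    using finite_subset[OF Asub] card_mono[OF _ Asub] card_comodule_singletons[OF T] by auto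
  have AV: "A \<subseteq> pverts T" using Asub comodule_singleton(1)[OF T] by blast
  let ?Q = "P - (\<lambda>s. {s}) ` A"
  have big: "2 \<le> card M" if "M \<in> ?Q" for M
  proof -
    have "M \<in> P" using that by blast
    then have "finite M" "M \<noteq> {}" using comodule_finite[OF T cP] cP[of M] unfolding comodule_def by blast+
    then have "card M \<noteq> 0" by simp
    moreover have "card M \<noteq> 1"
    proof
      assume "card M = 1"
      then obtain s where "M = {s}" by (auto simp: card_1_singleton_iff)
      then show False using that by (auto simp: A_def)
    qed
    ultimately show ?thesis by linarith
  qed
  have cA: "card ((\<lambda>s. {s}) ` A) = card A" by (rule card_image) simp
  have subA: "(\<lambda>s. {s}) ` A \<subseteq> P" by (auto simp: A_def)
  have cQ: "card ?Q = 2 * n + 1 - card A"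
    using card_Diff_subset[OF finite_imageI[OF fA(1)] subA] cA P(2) by simp
  have sM: "s \<notin> M" if "M \<in> ?Q" "s \<in> A" for s M
  proof -
    have "{s} \<in> P" "M \<noteq> {s}" "M \<in> P" using that by (auto simp: A_def)
    then have "disjnt M {s}" using pairwiseD[OF dP] by blast
    then show ?thesis by simp
  qed
  have UQ: "\<Union>?Q \<subseteq> pverts T - A" using sM cP unfolding comodule_def by blast
  have BQ: "module_blocks T ?Q" if ne: "s0 \<in> A" for s0
    unfolding module_blocks_def
  proof (intro conjI ballI)
    show "finite ?Q" using fP by simp
    show "pairwise disjnt ?Q" using dP by (rule pairwise_subset) blast
    fix M assume M: "M \<in> ?Q"
    show "min_comodule T M" using P(3) M by blast
    show "2 \<le> card M" using big[OF M] .
    have "comodule T {s0}" using Asub ne by blast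
    then show "is_module T M" using module_beside_singleton[OF T _ cP sM[OF M ne] big[OF M]] M by blast
  qed
  have dir: "(\<forall>v\<in>pverts T - {s}. (s, v) \<in> parcs T) \<or> (\<forall>v\<in>pverts T - {s}. (v, s) \<in> parcs T)" if "s \<in> A" for s
    using comodule_singleton(2)[OF T] Asub that by blast
  consider "card A = 0" | "card A = 1" | "card A = 2" using fA(2) by linarith
  then show ?thesis
  proof cases
    case 1
    then have "A = {}" using fA(1) by simp
    then show ?thesis using realizes_no_singletons[OF T c P] big by simp
  next
    case 2
    then obtain s where A: "A = {s}" by (auto simp: card_1_singleton_iff)
    have sV: "s \<in> pverts T" using AV A by blast
    have Q: "module_blocks T ?Q" "card ?Q = 2 * n" "\<Union>?Q \<subseteq> pverts T - {s}"
      using BQ[of s] cQ UQ 2 A by simp_all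
    have "s \<in> A" using A by simp
    from dir[OF this] show ?thesis
    proof
      assume "\<forall>v\<in>pverts T - {s}. (s, v) \<in> parcs T"
      then have "(s, v) \<in> parcs T" if "v \<in> pverts T" "v \<noteq> s" for v using that by blast
      from realizes_source[OF T c sV this Q] obtain H where
        H: "H \<in> lex_sums (2 * n + 2) [tt1, tt1] \<or> H \<in> lex_sums (2 * n + 1) [C3, tt1] \<or> H \<in> lex_sums (2 * n) [C3, C3]"
        "\<exists>f. tiso T (lex_sum tt2 [tt1, H]) f" by blast
      have "listed n (lex_sum tt2 [tt1, H])" using H(1) unfolding listed_def by blast
      then show ?thesis using H(2) unfolding realizes_def by blast
    next
      assume sink: "\<forall>v\<in>pverts T - {s}. (v, s) \<in> parcs T"
      \<comment> \<open>A sink is a source of the dual, which has the same modules and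
        co-modules.\<close>
      let ?D = "dual T"
      have VD: "pverts ?D = pverts T" by (simp add: dual_def)
      have "(s, v) \<in> parcs ?D" if "v \<in> pverts ?D" "v \<noteq> s" for v using that sink by (simp add: dual_def)
      from realizes_source[OF tournament_dual[OF T], unfolded VD module_blocks_dual[OF T], OF c sV this[unfolded VD] Q]
      obtain H where
        H: "H \<in> lex_sums (2 * n + 2) [tt1, tt1] \<or> H \<in> lex_sums (2 * n + 1) [C3, tt1] \<or> H \<in> lex_sums (2 * n) [C3, C3]"
        "\<exists>f. tiso ?D (lex_sum tt2 [tt1, H]) f" by blast
      have "listed n (dual (lex_sum tt2 [tt1, H]))" using H(1) unfolding listed_def by blast
      then show ?thesis using H(2) tiso_dual unfolding realizes_def by blast
    qed
  next
    case 3
    then obtain s t where A: "A = {s, t}" "s \<noteq> t" by (auto simp: card_2_iff)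
    have V: "s \<in> pverts T" "t \<in> pverts T" using AV A by blast+
    have Q: "module_blocks T ?Q" "card ?Q = 2 * n - 1" "\<Union>?Q \<subseteq> pverts T - {s, t}"
      using BQ[of s] cQ UQ 3 A by simp_all
    have asym: "\<not> ((s, t) \<in> parcs T \<and> (t, s) \<in> parcs T)" using tournamentD(5)[OF T V A(2)] by blast
    have d: "(\<forall>v\<in>pverts T - {s}. (s, v) \<in> parcs T) \<or> (\<forall>v\<in>pverts T - {s}. (v, s) \<in> parcs T)"
      "(\<forall>v\<in>pverts T - {t}. (t, v) \<in> parcs T) \<or> (\<forall>v\<in>pverts T - {t}. (v, t) \<in> parcs T)"
      using dir[of s] dir[of t] A by blast+
    have "(\<forall>v\<in>pverts T - {s}. (s, v) \<in> parcs T) \<and> (\<forall>v\<in>pverts T - {t}. (v, t) \<in> parcs T) \<or>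
      (\<forall>v\<in>pverts T - {t}. (t, v) \<in> parcs T) \<and> (\<forall>v\<in>pverts T - {s}. (v, s) \<in> parcs T)"
      using d asym V A(2) by blast
    then show ?thesis
    proof
      assume "(\<forall>v\<in>pverts T - {s}. (s, v) \<in> parcs T) \<and> (\<forall>v\<in>pverts T - {t}. (v, t) \<in> parcs T)"
      then show ?thesis by (intro realizes_source_sink[OF n T c V(1) _ V(2) _ A(2) Q]) blast+
    next
      assume "(\<forall>v\<in>pverts T - {t}. (t, v) \<in> parcs T) \<and> (\<forall>v\<in>pverts T - {s}. (v, s) \<in> parcs T)"
      then show ?thesis
        by (intro realizes_source_sink[OF n T c V(2) _ V(1) _ A(2)[symmetric] Q(1,2) Q(3)[unfolded insert_commute[of s]]]) blast+
    qed
  qed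
qed

theorem theorem6p4:
  fixes n :: nat and T :: "'a pair_pre_digraph"
  assumes "n \<ge> 1" and "tournament T"
  shows "T \<in> delta_maximal (4 * n + 3) \<longleftrightarrow>
    (\<exists>S. tournament_iso T S \<and>
      (S \<in> lex_sums (2 * n + 2) [tt1]
       \<or> S \<in> lex_sums (2 * n + 1) [C3]
       \<or> (\<exists>H \<in> lex_sums (2 * n) [C3]. S = lex_sum C3 [tt1, tt1, H])
       \<or> (\<exists>H \<in> lex_sums (2 * n + 1) [tt1]. S = lex_sum C3 [tt1, tt1, H])
       \<or> (\<exists>H \<in> lex_sums (2 * n + 2) [tt1, tt1].
            S = lex_sum tt2 [tt1, H] \<or> S = dual (lex_sum tt2 [tt1, H]))
       \<or> (\<exists>H \<in> lex_sums (2 * n + 1) [C3, tt1].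
            S = lex_sum tt2 [tt1, H] \<or> S = dual (lex_sum tt2 [tt1, H]))
       \<or> (\<exists>H \<in> lex_sums (2 * n) [C3, C3].
            S = lex_sum tt2 [tt1, H] \<or> S = dual (lex_sum tt2 [tt1, H]))
       \<or> (\<exists>S5 \<in> {U5, V5, W5}. \<exists>H \<in> lex_sums (2 * n - 1) [S5]. S = lex_sum tt3 [tt1, H, tt1])
       \<or> (\<exists>H \<in> lex_sums (2 * n + 2) [tt1, tt1, tt1]. S = lex_sum tt3 [tt1, H, tt1])
       \<or> n \<ge> 2 \<and> (\<exists>H \<in> lex_sums (2 * n) [C3, C3, tt1]. S = lex_sum tt3 [tt1, H, tt1])
       \<or> (\<exists>H \<in> lex_sums (2 * n + 1) [tt1, tt1, C3]. S = lex_sum tt3 [tt1, H, tt1])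
       \<or> n \<ge> 2 \<and> (\<exists>H \<in> lex_sums (2 * n - 1) [C3, C3, C3]. S = lex_sum tt3 [tt1, H, tt1])))"
  unfolding listed_def[symmetric]
proof
  assume "T \<in> delta_maximal (4 * n + 3)"
  then have "realizes n T" using realizes_of_family[OF assms] delta_maximal_iff[OF assms] by blast
  then obtain S where S: "listed n S" "\<exists>f. tiso T S f" unfolding realizes_def by blast
  \<comment> \<open>Passing from \<open>tiso\<close> to \<open>tournament_iso\<close> requires that
    \<open>S\<close> is a tournament, which the counting lemma for listed forms also
    provides.\<close>
  have "tournament S" using listed_attains[OF assms(1) S(1)] by (simp add: attains_def)
  then show "\<exists>S. tournament_iso T S \<and> listed n S" using S tournament_iso_iff[OF assms(2)] by blast
next
  assume "\<exists>S. tournament_iso T S \<and> listed n S"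
  then obtain S where S: "tournament_iso T S" "listed n S" by blast
  have a: "tournament S" "card (pverts S) = 4 * n + 3" "\<exists>P. comodule_family S P \<and> card P = 2 * n + 1"
    using listed_attains[OF assms(1) S(2)] by (simp_all add: attains_def)
  obtain f where f: "tiso T S f" using S(1) tournament_iso_iff[OF assms(2) a(1)] by blast
  have "card (pverts T) = 4 * n + 3" using f a(2) bij_betw_same_card unfolding tiso_def by metis
  then show "T \<in> delta_maximal (4 * n + 3)"
    using delta_maximal_iff[OF assms] comodule_family_tiso[OF f _ assms(2)] a(3) by metis
qed

end
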